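(* Let $k$ be a constant, and let $a_1,\dots,a_k$ be such that $a_{i+1}/a_i\in\Omega(n)$ for $i=1,\dots,k-1$, where $n$ is the number of agents; suppose that the private valuations take on only the values $a_1,\dots,a_k$. There exists a polynomial-time, monotone, constant-fraction welfare-preserving transformation (for downward-closed single-parameter environments). Moreover, if $a_{i+1}/a_i>n$ for all $i$, then the transformation can be modified so that it also preserves full welfare at a $\frac{1}{(k-1)n}$ fraction of the inputs.
   Context: A single-parameter environment consists of $n$ agents, where agent $i$ has a private valuation $v_i\in\mathbb{R}$ (its value per unit of stuff that it gets; here $v_i\in\{a_1,\dots,a_k\}$), and a feasibility set $\mathcal{F}$ whose elements, the feasible allocations, are vectors $\mathbf{x}=(x_i)_{i=1}^n$ with $x_i\in\mathbb{R}$ denoting the amount of stuff given to agent $i$. The environment is downward-closed if, whenever we take an allocation in $\mathcal{F}$ and decrease the amount of stuff given to one of the agents, the resulting allocation is also in $\mathcal{F}$. Constant means not depending on $n$. An algorithm (or allocation rule) $\mathcal{A}$ is a function that takes a valuation vector $\mathbf{v}=(v_i)_{i=1}^n$ (the input) and outputs an allocation $\mathbf{x}\in\mathcal{F}$. The welfare of $\mathcal{A}$ at $\mathbf{v}$ is $\mathbf{v}\cdot\mathbf{x}=v_1x_1+\dots+v_nx_n$. An allocation rule is monotone if, whenever an agent increases its declared valuation while the declared valuations of the remaining agents stay fixed, the agent is allocated at least as much stuff as before. A transformation $\mathcal{T}$ is an algorithm that has black-box access to some other algorithm $\mathcal{A}$: in each query it specifies a valuation vector and obtains the allocation that $\mathcal{A}$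 returns there. $\mathcal{T}(\mathcal{A})$ denotes $\mathcal{T}$ with access to $\mathcal{A}$. $\mathcal{T}$ has the knowledge that $\mathcal{F}$ is downward-closed. For this positive result, the transformation does not make queries about membership in $\mathcal{F}$ and is not adaptive (it does not adjust its queries based on responses to previous queries). Polynomial means polynomial in $n$. $\mathcal{T}$ is monotone if $\mathcal{T}(\mathcal{A})$ is a monotone allocation rule for any algorithm $\mathcal{A}$. $\mathcal{T}$ is constant-fraction welfare-preserving if, for any algorithm $\mathcal{A}$, $\mathcal{T}(\mathcal{A})$ preserves a constant fraction of the welfare of $\mathcal{A}$ at every input, i.e. for some constant $c>0$ its welfare at every input is at least $c$ times that of $\mathcal{A}$. $\mathcal{T}$ preserves full welfare at a given input if the welfare of $\mathcal{T}(\mathcal{A})$ there is at least that of $\mathcal{A}$; it does so at a $p$ fraction of the inputs if, for any algorithm $\mathcal{A}$, this holds for at least a $p$ fraction of the $k^n$ inputs.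
   Formalization: Amounts of stuff are taken to be nonnegative and decreasing stops at 0 (with negative amounts a constant negative rule would force c ≥ 1, and the claim fails); for k = 1 the undefined fraction 1/((k-1)n) is read as 0. *)

theory Defs
  imports Complex_Main "HOL-Library.Landau_Symbols"
begin

section \<open>Downward-closed single-parameter environments\<close>

text \<open>
  Agents are \<open>0, \<dots>, n - 1\<close>. Valuation vectors and allocations are real lists of length \<open>n\<close>.
\<close>

definition valuations :: "nat \<Rightarrow> real set \<Rightarrow> real list set" where
  "valuations n V = {v. length v = n \<and> set v \<subseteq> V}"

text \<open>
  An entry of an allocation is an amount of stuff, hence nonnegative; decreasing an amount
  stops at zero. Without nonnegativity every constant rule with a negative allocation would
  turn the requirement of keeping a fraction \<open>c\<close> of the (negative) welfare into \<open>c \<ge> 1\<close>.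
\<close>

definition downward_closed :: "nat \<Rightarrow> real list set \<Rightarrow> bool" where
  "downward_closed n F \<longleftrightarrow>
     (\<forall>x\<in>F. length x = n \<and> (\<forall>i<n. 0 \<le> x ! i)) \<and>
     (\<forall>x\<in>F. \<forall>i<n. \<forall>y. 0 \<le> y \<and> y \<le> x ! i \<longrightarrow> x[i := y] \<in> F)"

definition allocation_rule ::
    "nat \<Rightarrow> real set \<Rightarrow> real list set \<Rightarrow> (real list \<Rightarrow> real list) \<Rightarrow> bool" where
  "allocation_rule n V F A \<longleftrightarrow> (\<forall>v\<in>valuations n V. A v \<in> F)"

definition welfare :: "real list \<Rightarrow> real list \<Rightarrow> real" where
  "welfare v x = (\<Sum>i<length v. v ! i * x ! i)"

definition monotone_rule :: "nat \<Rightarrow> real set \<Rightarrow> (real list \<Rightarrow> real list) \<Rightarrow> bool" where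
  "monotone_rule n V A \<longleftrightarrow>
     (\<forall>v\<in>valuations n V. \<forall>i<n. \<forall>b\<in>V. v ! i \<le> b \<longrightarrow> A v ! i \<le> A (v[i := b]) ! i)"


section \<open>Programs with black-box access to an allocation rule\<close>

text \<open>
  Programs run on a real random access machine: a state consists of index registers holding
  natural numbers and of real cells, which are addressed indirectly through index registers.
  Real arithmetic and comparisons are exact and cost one step each. Index registers only
  support addition and subtraction, so that the length of the addresses stays linear in the
  running time. \<open>Query p q\<close> passes the \<open>n\<close> cells from address \<open>p\<close> on to the black box
  and stores the answer from address \<open>q\<close> on.
\<close>

datatype com =
    IConst nat nat
  | IAdd nat nat nat
  | ISub nat nat nat
  | RConst nat nat
  | RMove nat nat
  | RAdd nat nat nat
  | RSub nat nat nat
  | RMul nat nat nat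
  | RDiv nat nat nat
  | Query nat nat
  | Seq com com
  | IIf nat nat com com
  | RIf nat nat com com
  | IWhile nat nat com

type_synonym state = "(nat \<Rightarrow> nat) \<times> (nat \<Rightarrow> real)"

definition read_block :: "nat \<Rightarrow> (nat \<Rightarrow> real) \<Rightarrow> nat \<Rightarrow> real list" where
  "read_block n R p = map (\<lambda>i. R (p + i)) [0..<n]"

definition write_block :: "nat \<Rightarrow> real list \<Rightarrow> nat \<Rightarrow> (nat \<Rightarrow> real) \<Rightarrow> (nat \<Rightarrow> real)" where
  "write_block n x q R = (\<lambda>j. if q \<le> j \<and> j < q + n then x ! (j - q) else R j)"

text \<open>
  \<open>exec n A c s t Q s'\<close>: with black box \<open>A\<close>, program \<open>c\<close> started in \<open>s\<close> terminates in \<open>s'\<close>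
  after \<open>t\<close> steps, and \<open>Q\<close> is the list of the queries that it made, in order.
\<close>

inductive exec ::
    "nat \<Rightarrow> (real list \<Rightarrow> real list) \<Rightarrow> com \<Rightarrow> state \<Rightarrow> nat \<Rightarrow> real list list \<Rightarrow> state \<Rightarrow> bool"
  for n :: nat and A :: "real list \<Rightarrow> real list" where
  IConst: "exec n A (IConst d c) (N, R) 1 [] (N(d := c), R)"
| IAdd: "exec n A (IAdd d r s) (N, R) 1 [] (N(d := N r + N s), R)"
| ISub: "exec n A (ISub d r s) (N, R) 1 [] (N(d := N r - N s), R)"
| RConst: "exec n A (RConst d c) (N, R) 1 [] (N, R(N d := real c))"
| RMove: "exec n A (RMove d r) (N, R) 1 [] (N, R(N d := R (N r)))"
| RAdd: "exec n A (RAdd d r s) (N, R) 1 [] (N, R(N d := R (N r) + R (N s)))"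
| RSub: "exec n A (RSub d r s) (N, R) 1 [] (N, R(N d := R (N r) - R (N s)))"
| RMul: "exec n A (RMul d r s) (N, R) 1 [] (N, R(N d := R (N r) * R (N s)))"
| RDiv: "exec n A (RDiv d r s) (N, R) 1 [] (N, R(N d := R (N r) / R (N s)))"
| Query: "exec n A (Query p q) (N, R) 1 [read_block n R (N p)]
            (N, write_block n (A (read_block n R (N p))) (N q) R)"
| Seq: "exec n A c1 s t1 Q1 s' \<Longrightarrow> exec n A c2 s' t2 Q2 s'' \<Longrightarrow>
          exec n A (Seq c1 c2) s (t1 + t2) (Q1 @ Q2) s''"
| IIf_True: "N r < N s \<Longrightarrow> exec n A c1 (N, R) t Q s' \<Longrightarrow>
          exec n A (IIf r s c1 c2) (N, R) (Suc t) Q s'"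
| IIf_False: "\<not> N r < N s \<Longrightarrow> exec n A c2 (N, R) t Q s' \<Longrightarrow>
          exec n A (IIf r s c1 c2) (N, R) (Suc t) Q s'"
| RIf_True: "R (N p) < R (N q) \<Longrightarrow> exec n A c1 (N, R) t Q s' \<Longrightarrow>
          exec n A (RIf p q c1 c2) (N, R) (Suc t) Q s'"
| RIf_False: "\<not> R (N p) < R (N q) \<Longrightarrow> exec n A c2 (N, R) t Q s' \<Longrightarrow>
          exec n A (RIf p q c1 c2) (N, R) (Suc t) Q s'"
| IWhile_False: "\<not> N r < N s \<Longrightarrow> exec n A (IWhile r s c) (N, R) 1 [] (N, R)"
| IWhile_True: "N r < N s \<Longrightarrow> exec n A c (N, R) t1 Q1 s' \<Longrightarrow>
          exec n A (IWhile r s c) s' t2 Q2 s'' \<Longrightarrow>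
          exec n A (IWhile r s c) (N, R) (Suc (t1 + t2)) (Q1 @ Q2) s''"

lemma exec_deterministic:
  assumes "exec n A c s t Q s'" and "exec n A c s t2 Q2 s2"
  shows "t2 = t \<and> Q2 = Q \<and> s2 = s'"
  using assms
proof (induction arbitrary: t2 Q2 s2 rule: exec.induct)
  case (Seq c1 s t1 Q1 s' c2 t2' Q2' s'')
  from Seq.prems show ?case
  proof (cases rule: exec.cases)
    case (Seq u1 P1 w u2 P2)
    then show ?thesis using Seq.IH(1)[of u1 P1 w] Seq.IH(2)[of u2 P2 s2] by simp
  qed
next
  case (IWhile_True N r s c R t1 Q1 s' t2' Q2' s'')
  from IWhile_True.prems show ?case
  proof (cases rule: exec.cases)
    case IWhile_False
    then show ?thesis using IWhile_True.hyps by simp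
  next
    case (IWhile_True u1 P1 w u2 P2)
    then show ?thesis
      using IWhile_True.IH(1)[of u1 P1 w] IWhile_True.IH(2)[of u2 P2 s2] by simp
  qed
next
  case (IIf_True N r s c1 R t Q s' c2)
  from IIf_True.prems IIf_True.hyps show ?case
    by (cases rule: exec.cases) (auto dest: IIf_True.IH)
next
  case (IIf_False N r s c2 R t Q s' c1)
  from IIf_False.prems IIf_False.hyps show ?case
    by (cases rule: exec.cases) (auto dest: IIf_False.IH)
next
  case (RIf_True R N p q c1 t Q s' c2)
  from RIf_True.prems RIf_True.hyps show ?case
    by (cases rule: exec.cases) (auto dest: RIf_True.IH)
next
  case (RIf_False R N p q c2 t Q s' c1)
  from RIf_False.prems RIf_False.hyps show ?case
    by (cases rule: exec.cases) (auto dest: RIf_False.IH)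
qed (erule exec.cases; simp)+

text \<open>
  Initially index register 0 contains \<open>n\<close>, and the real cells contain the input \<open>v\<close> followed
  by the list \<open>as\<close> of the possible values; the output is read off the first \<open>n\<close> real cells.
  The program has no access to the feasibility set.
\<close>

definition init_state :: "nat \<Rightarrow> real list \<Rightarrow> real list \<Rightarrow> state" where
  "init_state n as v =
     ((\<lambda>_. 0)(0 := n), \<lambda>j. if j < length (v @ as) then (v @ as) ! j else 0)"

definition runs :: "nat \<Rightarrow> real list \<Rightarrow> com \<Rightarrow> (real list \<Rightarrow> real list) \<Rightarrow> real list \<Rightarrow>
    nat \<Rightarrow> real list list \<Rightarrow> real list \<Rightarrow> bool" where
  "runs n as T A v t Q x \<longleftrightarrow>
     (\<exists>N R. exec n A T (init_state n as v) t Q (N, R) \<and> x = read_block n R 0)"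

definition transformed ::
    "nat \<Rightarrow> real list \<Rightarrow> com \<Rightarrow> (real list \<Rightarrow> real list) \<Rightarrow> real list \<Rightarrow> real list" where
  "transformed n as T A v = (THE x. \<exists>t Q. runs n as T A v t Q x)"

lemma transformed_eq: "runs n as T A v t Q x \<Longrightarrow> transformed n as T A v = x"
  unfolding transformed_def runs_def by (rule the_equality) (blast dest: exec_deterministic)+


section \<open>Properties of transformations\<close>

text \<open>
  The possible values may depend on the number of agents: \<open>a n i\<close> is the \<open>i\<close>-th one, for
  \<open>i = 1, \<dots>, k\<close>, when there are \<open>n\<close> agents. Below, \<open>as\<close> is such a family of lists indexed
  by \<open>n\<close>; the program \<open>T\<close> does not depend on \<open>n\<close>.
\<close>

definition value_lists :: "nat \<Rightarrow> (nat \<Rightarrow> nat \<Rightarrow> real) \<Rightarrow> nat \<Rightarrow> real list" where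
  "value_lists k a n = map (a n) [1..<Suc k]"

definition black_box :: "nat \<Rightarrow> real list \<Rightarrow> real list set \<Rightarrow> (real list \<Rightarrow> real list) \<Rightarrow> bool" where
  "black_box n as F A \<longleftrightarrow> downward_closed n F \<and> allocation_rule n (set as) F A"

definition transformation :: "(nat \<Rightarrow> real list) \<Rightarrow> com \<Rightarrow> bool" where
  "transformation as T \<longleftrightarrow>
     (\<forall>n\<ge>1. \<forall>F A. black_box n (as n) F A \<longrightarrow>
        (\<forall>v\<in>valuations n (set (as n)). \<exists>t Q x. runs n (as n) T A v t Q x \<and>
           set Q \<subseteq> valuations n (set (as n)) \<and> x \<in> F))"

definition nonadaptive :: "(nat \<Rightarrow> real list) \<Rightarrow> com \<Rightarrow> bool" where
  "nonadaptive as T \<longleftrightarrow>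
     (\<forall>n\<ge>1. \<forall>F A F' A'. black_box n (as n) F A \<longrightarrow> black_box n (as n) F' A' \<longrightarrow>
        (\<forall>v\<in>valuations n (set (as n)). \<forall>t Q x t' Q' x'.
           runs n (as n) T A v t Q x \<longrightarrow> runs n (as n) T A' v t' Q' x' \<longrightarrow> Q = Q'))"

definition polynomial_time :: "(nat \<Rightarrow> real list) \<Rightarrow> com \<Rightarrow> bool" where
  "polynomial_time as T \<longleftrightarrow>
     (\<exists>C d. \<forall>n\<ge>1. \<forall>F A. black_box n (as n) F A \<longrightarrow>
        (\<forall>v\<in>valuations n (set (as n)). \<exists>t Q x. runs n (as n) T A v t Q x \<and> t \<le> C * n ^ d))"

definition monotone_transformation :: "(nat \<Rightarrow> real list) \<Rightarrow> com \<Rightarrow> bool" where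
  "monotone_transformation as T \<longleftrightarrow>
     (\<forall>n\<ge>1. \<forall>F A. black_box n (as n) F A \<longrightarrow>
        monotone_rule n (set (as n)) (transformed n (as n) T A))"

definition constant_fraction_preserving :: "(nat \<Rightarrow> real list) \<Rightarrow> com \<Rightarrow> bool" where
  "constant_fraction_preserving as T \<longleftrightarrow>
     (\<exists>c>0. \<forall>n\<ge>1. \<forall>F A. black_box n (as n) F A \<longrightarrow>
        (\<forall>v\<in>valuations n (set (as n)).
           welfare v (transformed n (as n) T A v) \<ge> c * welfare v (A v)))"

definition preserves_full_welfare_at_fraction ::
    "(nat \<Rightarrow> real list) \<Rightarrow> com \<Rightarrow> (nat \<Rightarrow> real) \<Rightarrow> bool" where
  "preserves_full_welfare_at_fraction as T p \<longleftrightarrow>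
     (\<forall>n\<ge>1. \<forall>F A. black_box n (as n) F A \<longrightarrow>
        real (card {v \<in> valuations n (set (as n)).
                welfare v (transformed n (as n) T A v) \<ge> welfare v (A v)})
          \<ge> p n * real (card (valuations n (set (as n)))))"

end

theory Submission
  imports Defs "HOL-Number_Theory.Cong"
begin

text \<open>
  On input \<open>y\<close> the transformation chooses, among the vectors \<open>u\<close> that differ from \<open>y\<close> in at
  most a constant number \<open>r\<close> of coordinates, one that maximises the welfare at \<open>y\<close> of \<open>A u\<close>
  discounted by a factor that decreases slowly with \<open>r\<close>. If agent \<open>j\<close> contributes more than a
  share of order \<open>1 / n\<close>, then raising its value multiplies its contribution by a factor of order
  \<open>n\<close>, so that the choice at the raised vector still has to give it a constant fraction of what it
  had. Hence the minimum of these amounts over all raised values of \<open>j\<close>, which is monotone by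
  construction, loses only a constant factor.

  The options at \<open>y\<close> and at a raised \<open>y'\<close> agree only up to a bounded shift of \<open>r\<close>. For small \<open>r\<close>
  the discount absorbs the shift. Larger distances are cut off at a bound that decreases
  with a level \<open>P y\<close>: when \<open>j\<close> raises its value beyond this level, then near-optimal options at \<open>y'\<close>
  draw a constant fraction of their welfare from \<open>j\<close>, the level rises as well, and the options at
  \<open>y'\<close> are nested in those at \<open>y\<close>.

  For full welfare at a fraction of the inputs, a vector that arises by raising one coordinate of
  a center chooses among the neighbours of that center. Then raising a coordinate of a center does
  not change the options at all, and the choice is maximal in a fixed range. Centers are the
  solutions of two congruences on the ranks of the coordinates, modulo \<open>k - 1\<close> and modulo a number
  \<open>p \<le> n\<close> that is coprime to all numbers up to \<open>k\<close>; coprimality makes the center unique,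
  and a character sum shows that there are at least \<open>k ^ n / ((k - 1) p)\<close> centers.
\<close>


section \<open>Expressions with loops and their compilation\<close>

text \<open>Fixed \<open>k\<close> is what makes bounded distances affordable: the level takes at
  most \<open>k\<close> values, and the cutoff is lexicographic. It grows with the rank by more than
  any change of the level can take back, so a raised agent keeps its old option in sight, while each
  rise of the level shortens the cutoff by the shift of one raise. All radii stay below a constant
  depending on \<open>k\<close> and \<open>D\<close>, and so does the degree of the running time.

  The shift is 3: the base of a vector is within one change of it, the raise is one change, and so
  is the way to the new base.

  A coordinate whose raise leaves the options alone must not lower the level. Therefore the level at
  \<open>y\<close> may be witnessed by suitably lowered versions of \<open>y\<close> too.

  The modulus \<open>k - 1\<close> does two jobs. Rank differences lie in
  \<open>1, ..., k - 1\<close> and are distinct modulo it; and \<open>w ^ (k - 1) = 1\<close> gives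
  \<open>w ^ k = w\<close>, which is why the character sums collapse to nonnegative
  integers.\<close>

datatype bnd = BN | BK | BF | BX nat

text \<open>Constants are fractions of naturals, which is why the gap enters the program as a
  natural number. \<open>Best\<close> separates the key from the returned value, so that a nested
  maximum can decide where something else is evaluated. \<open>Upd\<close> binds a new vector
  instead of changing one; no expression has side effects.\<close>

datatype expr =
    Num nat nat
  | Val nat nat
  | As nat
  | Qry nat nat
  | Add expr expr
  | Sub expr expr
  | Mul expr expr
  | Div expr expr
  | Ifl expr expr expr expr
  | Sum bnd nat expr
  | Best bnd nat expr expr
  | Upd nat nat nat nat expr

primrec bval :: "nat \<Rightarrow> nat \<Rightarrow> nat \<Rightarrow> (nat \<Rightarrow> nat) \<Rightarrow> bnd \<Rightarrow> nat" where
  "bval n k f ix BN = n"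
| "bval n k f ix BK = k"
| "bval n k f ix BF = f"
| "bval n k f ix (BX y) = ix y"

text \<open>The keys that occur below are nonnegative, so the initial key \<open>-1\<close> is always replaced.\<close>

primrec bfold :: "(nat \<Rightarrow> real) \<Rightarrow> (nat \<Rightarrow> real) \<Rightarrow> nat \<Rightarrow> real \<times> real" where
  "bfold key pay 0 = (-1, 0)"
| "bfold key pay (Suc m) =
     (if fst (bfold key pay m) < key m then (key m, pay m) else bfold key pay m)"

primrec ev :: "nat \<Rightarrow> real list \<Rightarrow> nat \<Rightarrow> (real list \<Rightarrow> real list) \<Rightarrow> expr \<Rightarrow>
    (nat \<Rightarrow> nat) \<Rightarrow> (nat \<Rightarrow> real list) \<Rightarrow> real" where
  "ev n as f A (Num m d) = (\<lambda>ix vs. real m / real d)"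
| "ev n as f A (Val a i) = (\<lambda>ix vs. vs a ! ix i)"
| "ev n as f A (As c) = (\<lambda>ix vs. as ! ix c)"
| "ev n as f A (Qry a i) = (\<lambda>ix vs. A (vs a) ! ix i)"
| "ev n as f A (Add e1 e2) = (\<lambda>ix vs. ev n as f A e1 ix vs + ev n as f A e2 ix vs)"
| "ev n as f A (Sub e1 e2) = (\<lambda>ix vs. ev n as f A e1 ix vs - ev n as f A e2 ix vs)"
| "ev n as f A (Mul e1 e2) = (\<lambda>ix vs. ev n as f A e1 ix vs * ev n as f A e2 ix vs)"
| "ev n as f A (Div e1 e2) = (\<lambda>ix vs. ev n as f A e1 ix vs / ev n as f A e2 ix vs)"
| "ev n as f A (Ifl e1 e2 e3 e4) = (\<lambda>ix vs. if ev n as f A e1 ix vs < ev n as f A e2 ix vs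
      then ev n as f A e3 ix vs else ev n as f A e4 ix vs)"
| "ev n as f A (Sum b x e) = (\<lambda>ix vs.
      \<Sum>j<bval n (length as) f ix b. ev n as f A e (ix(x := j)) vs)"
| "ev n as f A (Best b x e1 e2) = (\<lambda>ix vs.
      snd (bfold (\<lambda>j. ev n as f A e1 (ix(x := j)) vs) (\<lambda>j. ev n as f A e2 (ix(x := j)) vs)
        (bval n (length as) f ix b)))"
| "ev n as f A (Upd a' a i c e) = (\<lambda>ix vs. ev n as f A e ix (vs(a' := (vs a)[ix i := as ! ix c])))"

text \<open>Both branches of a conditional are evaluated, so the queries do not depend on the answers.\<close>

primrec qs :: "nat \<Rightarrow> real list \<Rightarrow> nat \<Rightarrow> expr \<Rightarrow> (nat \<Rightarrow> nat) \<Rightarrow> (nat \<Rightarrow> real list) \<Rightarrow> real list list" where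
  "qs n as f (Num m d) = (\<lambda>ix vs. [])"
| "qs n as f (Val a i) = (\<lambda>ix vs. [])"
| "qs n as f (As c) = (\<lambda>ix vs. [])"
| "qs n as f (Qry a i) = (\<lambda>ix vs. [vs a])"
| "qs n as f (Add e1 e2) = (\<lambda>ix vs. qs n as f e1 ix vs @ qs n as f e2 ix vs)"
| "qs n as f (Sub e1 e2) = (\<lambda>ix vs. qs n as f e1 ix vs @ qs n as f e2 ix vs)"
| "qs n as f (Mul e1 e2) = (\<lambda>ix vs. qs n as f e1 ix vs @ qs n as f e2 ix vs)"
| "qs n as f (Div e1 e2) = (\<lambda>ix vs. qs n as f e1 ix vs @ qs n as f e2 ix vs)"
| "qs n as f (Ifl e1 e2 e3 e4) = (\<lambda>ix vs.
     qs n as f e1 ix vs @ qs n as f e2 ix vs @ qs n as f e3 ix vs @ qs n as f e4 ix vs)"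
| "qs n as f (Sum b x e) = (\<lambda>ix vs.
     concat (map (\<lambda>j. qs n as f e (ix(x := j)) vs) [0..<bval n (length as) f ix b]))"
| "qs n as f (Best b x e1 e2) = (\<lambda>ix vs.
     concat (map (\<lambda>j. qs n as f e1 (ix(x := j)) vs @ qs n as f e2 (ix(x := j)) vs)
       [0..<bval n (length as) f ix b]))"
| "qs n as f (Upd a' a i c e) = (\<lambda>ix vs. qs n as f e ix (vs(a' := (vs a)[ix i := as ! ix c])))"


text \<open>
  Variables are numbered by binding depth. The list \<open>ks\<close> tells which index variables range over
  agents; the others range over positions in the list of values.
\<close>

primrec wfb :: "bool list \<Rightarrow> bnd \<Rightarrow> bool" where
  "wfb ks BN \<longleftrightarrow> True"
| "wfb ks BK \<longleftrightarrow> True"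
| "wfb ks BF \<longleftrightarrow> True"
| "wfb ks (BX y) \<longleftrightarrow> y < length ks \<and> ks ! y"

abbreviation kind :: "bnd \<Rightarrow> bool" where "kind b \<equiv> b \<noteq> BK"

primrec wfe :: "expr \<Rightarrow> bool list \<Rightarrow> nat \<Rightarrow> bool" where
  "wfe (Num m d) = (\<lambda>ks lv. True)"
| "wfe (Val a i) = (\<lambda>ks lv. a < lv \<and> i < length ks \<and> ks ! i)"
| "wfe (As c) = (\<lambda>ks lv. c < length ks \<and> \<not> ks ! c)"
| "wfe (Qry a i) = (\<lambda>ks lv. a < lv \<and> i < length ks \<and> ks ! i)"
| "wfe (Add e1 e2) = (\<lambda>ks lv. wfe e1 ks lv \<and> wfe e2 ks lv)"
| "wfe (Sub e1 e2) = (\<lambda>ks lv. wfe e1 ks lv \<and> wfe e2 ks lv)"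
| "wfe (Mul e1 e2) = (\<lambda>ks lv. wfe e1 ks lv \<and> wfe e2 ks lv)"
| "wfe (Div e1 e2) = (\<lambda>ks lv. wfe e1 ks lv \<and> wfe e2 ks lv)"
| "wfe (Ifl e1 e2 e3 e4) = (\<lambda>ks lv. wfe e1 ks lv \<and> wfe e2 ks lv \<and> wfe e3 ks lv \<and> wfe e4 ks lv)"
| "wfe (Sum b x e) = (\<lambda>ks lv. x = length ks \<and> wfb ks b \<and> wfe e (ks @ [kind b]) lv)"
| "wfe (Best b x e1 e2) = (\<lambda>ks lv. x = length ks \<and> wfb ks b \<and>
     wfe e1 (ks @ [kind b]) lv \<and> wfe e2 (ks @ [kind b]) lv)"
| "wfe (Upd a' a i c e) = (\<lambda>ks lv. a' = lv \<and> a < lv \<and> i < length ks \<and> ks ! i \<and>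
     c < length ks \<and> \<not> ks ! c \<and> wfe e ks (Suc lv))"

text \<open>Numbers of temporary cells and of vectors that the evaluation needs.\<close>

primrec nt :: "expr \<Rightarrow> nat" where
  "nt (Num m d) = 2" | "nt (Val a i) = 1" | "nt (As c) = 1" | "nt (Qry a i) = 1"
| "nt (Add e1 e2) = max (nt e1) (Suc (nt e2))"
| "nt (Sub e1 e2) = max (nt e1) (Suc (nt e2))"
| "nt (Mul e1 e2) = max (nt e1) (Suc (nt e2))"
| "nt (Div e1 e2) = max (nt e1) (Suc (nt e2))"
| "nt (Ifl e1 e2 e3 e4) = nt e1 + nt e2 + nt e3 + nt e4 + 4"
| "nt (Sum b x e) = nt e + 2"
| "nt (Best b x e1 e2) = nt e1 + nt e2 + 4"
| "nt (Upd a' a i c e) = Suc (nt e)"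

primrec nv :: "expr \<Rightarrow> nat" where
  "nv (Num m d) = 0" | "nv (Val a i) = 0" | "nv (As c) = 0" | "nv (Qry a i) = 0"
| "nv (Add e1 e2) = max (nv e1) (nv e2)"
| "nv (Sub e1 e2) = max (nv e1) (nv e2)"
| "nv (Mul e1 e2) = max (nv e1) (nv e2)"
| "nv (Div e1 e2) = max (nv e1) (nv e2)"
| "nv (Ifl e1 e2 e3 e4) = max (max (nv e1) (nv e2)) (max (nv e3) (nv e4))"
| "nv (Sum b x e) = nv e"
| "nv (Best b x e1 e2) = max (nv e1) (nv e2)"
| "nv (Upd a' a i c e) = max (Suc a') (nv e)"

lemma nt_pos: "0 < nt e"
  by (induction e) auto

text \<open>
  Registers: 0 holds \<open>n\<close> (also the address of the list of values), 1 holds 1, 2 holds the number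
  of values, 3 holds \<open>f\<close>, 4 to 6 are scratch, 7 holds the address for answers.
\<close>

definition rT :: "nat \<Rightarrow> nat" where "rT t = 8 + 3 * t"
definition rV :: "nat \<Rightarrow> nat" where "rV a = 9 + 3 * a"
definition rX :: "nat \<Rightarrow> nat" where "rX x = 10 + 3 * x"

primrec rB :: "bnd \<Rightarrow> nat" where
  "rB BN = 0" | "rB BK = 2" | "rB BF = 3" | "rB (BX y) = rX y"

abbreviation mv :: "nat \<Rightarrow> nat \<Rightarrow> com" where "mv d s \<equiv> RMove (rT d) (rT s)"

definition loop :: "nat \<Rightarrow> nat \<Rightarrow> com \<Rightarrow> com" where
  "loop x b c = Seq (IConst x 0) (IWhile x b (Seq c (IAdd x x 1)))"

definition copy :: "nat \<Rightarrow> nat \<Rightarrow> com" where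
  "copy p q = loop 4 0 (Seq (IAdd 5 p 4) (Seq (IAdd 6 q 4) (RMove 6 5)))"

text \<open>The value goes to temporary \<open>d\<close>, and temporaries below \<open>d\<close>
  survive, so pending operands are safe. Constants of the machine are naturals; the initial key
  \<open>-1\<close> of \<open>Best\<close> is therefore computed as \<open>0 - 1\<close>.
  \<open>IConst 5 0\<close> serves as a step without effect.\<close>

primrec compile :: "expr \<Rightarrow> nat \<Rightarrow> com" where
  "compile (Num m c) = (\<lambda>d. Seq (RConst (rT d) m) (Seq (RConst (rT (Suc d)) c) (RDiv (rT d) (rT d) (rT (Suc d)))))"
| "compile (Val a i) = (\<lambda>d. Seq (IAdd 5 (rV a) (rX i)) (RMove (rT d) 5))"
| "compile (As c) = (\<lambda>d. Seq (IAdd 5 0 (rX c)) (RMove (rT d) 5))"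
| "compile (Qry a i) = (\<lambda>d. Seq (Query (rV a) 7) (Seq (IAdd 5 7 (rX i)) (RMove (rT d) 5)))"
| "compile (Add e1 e2) = (\<lambda>d. Seq (compile e1 d) (Seq (compile e2 (Suc d)) (RAdd (rT d) (rT d) (rT (Suc d)))))"
| "compile (Sub e1 e2) = (\<lambda>d. Seq (compile e1 d) (Seq (compile e2 (Suc d)) (RSub (rT d) (rT d) (rT (Suc d)))))"
| "compile (Mul e1 e2) = (\<lambda>d. Seq (compile e1 d) (Seq (compile e2 (Suc d)) (RMul (rT d) (rT d) (rT (Suc d)))))"
| "compile (Div e1 e2) = (\<lambda>d. Seq (compile e1 d) (Seq (compile e2 (Suc d)) (RDiv (rT d) (rT d) (rT (Suc d)))))"
| "compile (Ifl e1 e2 e3 e4) = (\<lambda>d. Seq (compile e1 d) (Seq (compile e2 (d + 1)) (Seq (compile e3 (d + 2))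
     (Seq (compile e4 (d + 3)) (RIf (rT d) (rT (d + 1)) (mv d (d + 2)) (mv d (d + 3)))))))"
| "compile (Sum b x e) = (\<lambda>d. Seq (RConst (rT d) 0)
     (loop (rX x) (rB b) (Seq (compile e (Suc d)) (RAdd (rT d) (rT d) (rT (Suc d))))))"
| "compile (Best b x e1 e2) = (\<lambda>d. Seq (RConst (rT d) 0) (Seq (RConst (rT (d + 1)) 1)
     (Seq (RSub (rT (d + 1)) (rT d) (rT (d + 1)))
     (loop (rX x) (rB b) (Seq (compile e1 (d + 2)) (Seq (compile e2 (d + 3))
       (RIf (rT (d + 1)) (rT (d + 2)) (Seq (mv (d + 1) (d + 2)) (mv d (d + 3))) (IConst 5 0))))))))"
| "compile (Upd a' a i c e) = (\<lambda>d. Seq (copy (rV a) (rV a')) (Seq (IAdd 5 (rV a') (rX i))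
     (Seq (IAdd 6 0 (rX c)) (Seq (RMove 5 6) (compile e d)))))"

text \<open>\<open>B\<close> is a common bound for all loop lengths; it is instantiated with the
  number of agents plus the number of values.\<close>

primrec tm :: "nat \<Rightarrow> expr \<Rightarrow> nat" where
  "tm B (Num m d) = 3" | "tm B (Val a i) = 2" | "tm B (As c) = 2" | "tm B (Qry a i) = 3"
| "tm B (Add e1 e2) = tm B e1 + tm B e2 + 1"
| "tm B (Sub e1 e2) = tm B e1 + tm B e2 + 1"
| "tm B (Mul e1 e2) = tm B e1 + tm B e2 + 1"
| "tm B (Div e1 e2) = tm B e1 + tm B e2 + 1"
| "tm B (Ifl e1 e2 e3 e4) = tm B e1 + tm B e2 + tm B e3 + tm B e4 + 2"
| "tm B (Sum b x e) = B * (tm B e + 3) + 3"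
| "tm B (Best b x e1 e2) = B * (tm B e1 + tm B e2 + 5) + 5"
| "tm B (Upd a' a i c e) = B * 5 + tm B e + 5"

section \<open>Proof rules for programs, with queries and running time\<close>

lemma exec_loop:
  assumes start: "P 0 (N(x := 0)) R"
    and guard: "\<And>j N R. P j N R \<Longrightarrow> N x = j \<and> N b = m"
    and body: "\<And>j N R. P j N R \<Longrightarrow> j < m \<Longrightarrow> \<exists>t N' R'.
       exec n A (Seq c (IAdd x x 1)) (N, R) t (Q j) (N', R') \<and> t \<le> tb \<and> P (Suc j) N' R'"
  shows "\<exists>t N' R'. exec n A (loop x b c) (N, R) t (concat (map Q [0..<m])) (N', R') \<and>
     t \<le> m * (tb + 1) + 2 \<and> P m N' R'"
proof -
  have loop: "\<exists>t N' R'. exec n A (IWhile x b (Seq c (IAdd x x 1))) (N, R) t (concat (map Q [j..<m])) (N', R') \<and>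
     t \<le> (m - j) * (tb + 1) + 1 \<and> P m N' R'" if "P j N R" "j \<le> m" for j N R
    using that
  proof (induction "m - j" arbitrary: j N R)
    case 0
    then have "j = m" by simp
    with 0 guard[OF 0(2)] show ?case
      using exec.IWhile_False[of N x b n A "Seq c (IAdd x x 1)" R]
      by (intro exI[of _ 1] exI[of _ N] exI[of _ R]) auto
  next
    case (Suc d)
    then have jm: "j < m" by simp
    obtain t1 N1 R1 where 1: "exec n A (Seq c (IAdd x x 1)) (N, R) t1 (Q j) (N1, R1)" "t1 \<le> tb" "P (Suc j) N1 R1"
      using body[OF Suc(3) jm] by blast
    obtain t2 N2 R2 where 2: "exec n A (IWhile x b (Seq c (IAdd x x 1))) (N1, R1) t2 (concat (map Q [Suc j..<m])) (N2, R2)"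
       "t2 \<le> (m - Suc j) * (tb + 1) + 1" "P m N2 R2"
      using Suc(1)[OF _ 1(3)] Suc(2) jm by (metis Suc_diff_Suc Suc_leI diff_Suc_Suc nat.inject)
    have e: "exec n A (IWhile x b (Seq c (IAdd x x 1))) (N, R) (Suc (t1 + t2))
        (Q j @ concat (map Q [Suc j..<m])) (N2, R2)"
      using guard[OF Suc(3)] jm by (intro exec.IWhile_True[OF _ 1(1) 2(1)]) simp
    have q: "Q j @ concat (map Q [Suc j..<m]) = concat (map Q [j..<m])"
      using jm by (simp add: upt_conv_Cons)
    have "m - j = Suc (m - Suc j)" using jm by simp
    then have "Suc (t1 + t2) \<le> (m - j) * (tb + 1) + 1" using 1(2) 2(2) by simp
    then show ?case using e 2(3) unfolding q by blast
  qed
  obtain t N' R' where "exec n A (IWhile x b (Seq c (IAdd x x 1))) (N(x := 0), R) t (concat (map Q [0..<m])) (N', R')"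
     "t \<le> (m - 0) * (tb + 1) + 1" "P m N' R'"
    using loop[OF start] by blast
  then show ?thesis
    unfolding loop_def using exec.Seq[OF exec.IConst[of n A x 0 N R]] by fastforce
qed


text \<open>A total correctness statement that fixes the query list exactly but only bounds the
  time: nonadaptivity needs equality of the queries, polynomial time needs only an estimate.\<close>

definition exq :: "nat \<Rightarrow> (real list \<Rightarrow> real list) \<Rightarrow> com \<Rightarrow> (nat \<Rightarrow> nat) \<Rightarrow> (nat \<Rightarrow> real) \<Rightarrow>
    real list list \<Rightarrow> nat \<Rightarrow> ((nat \<Rightarrow> nat) \<Rightarrow> (nat \<Rightarrow> real) \<Rightarrow> bool) \<Rightarrow> bool" where
  "exq n A c N R Q tb Post \<longleftrightarrow>
     (\<exists>t N' R'. exec n A c (N, R) t Q (N', R') \<and> t \<le> tb \<and> Post N' R')"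

lemma exq_seq:
  assumes "exq n A c1 N R Q1 t1 Mid" "\<And>N R. Mid N R \<Longrightarrow> exq n A c2 N R Q2 t2 Post"
  shows "exq n A (Seq c1 c2) N R (Q1 @ Q2) (t1 + t2) Post"
proof -
  obtain s N1 R1 where 1: "exec n A c1 (N, R) s Q1 (N1, R1)" "s \<le> t1" "Mid N1 R1"
    using assms(1) unfolding exq_def by blast
  obtain s2 N2 R2 where 2: "exec n A c2 (N1, R1) s2 Q2 (N2, R2)" "s2 \<le> t2" "Post N2 R2"
    using assms(2)[OF 1(3)] unfolding exq_def by blast
  show ?thesis unfolding exq_def
    using exec.Seq[OF 1(1) 2(1)] 1(2) 2(2,3) by (intro exI[of _ "s + s2"]) auto
qed

lemma exq_mono:
  "exq n A c N R Q t Post \<Longrightarrow> (\<And>N R. Post N R \<Longrightarrow> Post' N R) \<Longrightarrow> t \<le> t' \<Longrightarrow> exq n A c N R Q t' Post'"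
  unfolding exq_def by (meson le_trans)

lemma exq_IConst: "Post (N(d := c)) R \<Longrightarrow> exq n A (IConst d c) N R [] 1 Post"
  unfolding exq_def using exec.IConst by blast
lemma exq_IAdd: "Post (N(d := N r + N s)) R \<Longrightarrow> exq n A (IAdd d r s) N R [] 1 Post"
  unfolding exq_def using exec.IAdd by blast
lemma exq_RConst: "Post N (R(N d := real c)) \<Longrightarrow> exq n A (RConst d c) N R [] 1 Post"
  unfolding exq_def using exec.RConst by blast
lemma exq_RMove: "Post N (R(N d := R (N r))) \<Longrightarrow> exq n A (RMove d r) N R [] 1 Post"
  unfolding exq_def using exec.RMove by blast
lemma exq_RAdd: "Post N (R(N d := R (N r) + R (N s))) \<Longrightarrow> exq n A (RAdd d r s) N R [] 1 Post"
  unfolding exq_def using exec.RAdd by blast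
lemma exq_RSub: "Post N (R(N d := R (N r) - R (N s))) \<Longrightarrow> exq n A (RSub d r s) N R [] 1 Post"
  unfolding exq_def using exec.RSub by blast
lemma exq_RMul: "Post N (R(N d := R (N r) * R (N s))) \<Longrightarrow> exq n A (RMul d r s) N R [] 1 Post"
  unfolding exq_def using exec.RMul by blast
lemma exq_RDiv: "Post N (R(N d := R (N r) / R (N s))) \<Longrightarrow> exq n A (RDiv d r s) N R [] 1 Post"
  unfolding exq_def using exec.RDiv by blast
lemma exq_Query: "read_block n R (N p) = v \<Longrightarrow> Post N (write_block n (A v) (N q) R) \<Longrightarrow>
    exq n A (Query p q) N R [v] 1 Post"
  unfolding exq_def using exec.Query by blast

lemma exq_RIf:
  assumes "R (N p) < R (N q) \<Longrightarrow> exq n A c1 N R [] t Post" "\<not> R (N p) < R (N q) \<Longrightarrow> exq n A c2 N R [] t Post"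
  shows "exq n A (RIf p q c1 c2) N R [] (Suc t) Post"
  using assms exec.RIf_True[of R N p q n A c1] exec.RIf_False[of R N p q n A c2]
  unfolding exq_def by (metis Suc_le_mono)

text \<open>The increment adds register 1 to the counter, so the body has to guarantee that this
  register still holds 1.\<close>

lemma exq_loop:
  assumes "P 0 (N(x := 0)) R"
    and "\<And>j N R. P j N R \<Longrightarrow> N x = j \<and> N b = m"
    and "\<And>j N R. P j N R \<Longrightarrow> j < m \<Longrightarrow> exq n A c N R (Q j) tb (\<lambda>N R. N 1 = 1 \<and> P (Suc j) (N(x := Suc (N x))) R)"
    and "m \<le> B"
  shows "exq n A (loop x b c) N R (concat (map Q [0..<m])) (B * (tb + 2) + 2) (P m)"
proof -
  have "\<exists>t N' R'. exec n A (loop x b c) (N, R) t (concat (map Q [0..<m])) (N', R') \<and>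
     t \<le> m * (Suc tb + 1) + 2 \<and> P m N' R'"
  proof (rule exec_loop[where P = P])
    fix j N R assume "P j N R" "j < m"
    then have "exq n A c N R (Q j) tb (\<lambda>N R. N 1 = 1 \<and> P (Suc j) (N(x := Suc (N x))) R)"
      using assms(3) by blast
    then have "exq n A (Seq c (IAdd x x 1)) N R (Q j @ []) (tb + 1) (P (Suc j))"
      by (rule exq_seq) (rule exq_IAdd, simp)
    then show "\<exists>t N' R'. exec n A (Seq c (IAdd x x 1)) (N, R) t (Q j) (N', R') \<and> t \<le> Suc tb \<and> P (Suc j) N' R'"
      unfolding exq_def by simp
  qed (use assms in auto)
  moreover have "m * (Suc tb + 1) \<le> B * (tb + 2)" using mult_le_mono[OF assms(4), of "Suc tb + 1" "tb + 2"] by simp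
  ultimately show ?thesis unfolding exq_def by (meson add_le_mono le_refl le_trans)
qed

lemma reg_simps [simp]:
  "rT t = rT t' \<longleftrightarrow> t = t'" "rV t = rV t' \<longleftrightarrow> t = t'" "rX t = rX t' \<longleftrightarrow> t = t'"
  "rT t \<noteq> rV a" "rT t \<noteq> rX x" "rV a \<noteq> rT t" "rV a \<noteq> rX x" "rX x \<noteq> rT t" "rX x \<noteq> rV a"
  unfolding rT_def rV_def rX_def by presburger+

lemma reg_num [simp]:
  "rT t \<noteq> 0" "rT t \<noteq> 1" "rT t \<noteq> Suc 0" "rT t \<noteq> 2" "rT t \<noteq> 3" "rT t \<noteq> 4" "rT t \<noteq> 5" "rT t \<noteq> 6" "rT t \<noteq> 7"
  "rV t \<noteq> 0" "rV t \<noteq> 1" "rV t \<noteq> Suc 0" "rV t \<noteq> 2" "rV t \<noteq> 3" "rV t \<noteq> 4" "rV t \<noteq> 5" "rV t \<noteq> 6" "rV t \<noteq> 7"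
  "rX t \<noteq> 0" "rX t \<noteq> 1" "rX t \<noteq> Suc 0" "rX t \<noteq> 2" "rX t \<noteq> 3" "rX t \<noteq> 4" "rX t \<noteq> 5" "rX t \<noteq> 6" "rX t \<noteq> 7"
  unfolding rT_def rV_def rX_def by presburger+

lemmas reg_num' [simp] = reg_num[symmetric]

section \<open>Memory layout and correctness of the compiled expressions\<close>

locale machine =
  fixes n :: nat and as :: "real list" and f :: nat and A :: "real list \<Rightarrow> real list"
    and Tm Am :: nat
begin

text \<open>The cells are, in order: \<open>n\<close> for the input and later the output, the list
  of values, \<open>Tm\<close> temporaries, a block of \<open>n\<close> for answers starting at
  \<open>tb Tm\<close>, and blocks of \<open>n\<close> for the vectors.\<close>

definition tb :: "nat \<Rightarrow> nat" where "tb t = n + length as + t"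
definition vb :: "nat \<Rightarrow> nat" where "vb a = n + length as + Tm + n * Suc a"

text \<open>Nothing is said about the first \<open>n\<close> cells: they are being filled with the
  output while later coordinates are still to be evaluated.\<close>

definition rel :: "bool list \<Rightarrow> nat \<Rightarrow> (nat \<Rightarrow> nat) \<Rightarrow> (nat \<Rightarrow> real list) \<Rightarrow> (nat \<Rightarrow> nat) \<Rightarrow> (nat \<Rightarrow> real) \<Rightarrow> bool" where
  "rel ks lv ix vs N R \<longleftrightarrow> N 0 = n \<and> N 1 = 1 \<and> N 2 = length as \<and> N 3 = f \<and> N 7 = tb Tm \<and> f \<le> n \<and>
     (\<forall>t<Tm. N (rT t) = tb t) \<and> (\<forall>a<Am. N (rV a) = vb a) \<and>
     (\<forall>x<length ks. N (rX x) = ix x \<and> ix x < (if ks ! x then n else length as)) \<and>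
     (\<forall>a<lv. length (vs a) = n \<and> (\<forall>i<n. R (vb a + i) = vs a ! i)) \<and>
     (\<forall>c<length as. R (n + c) = as ! c)"

definition frame :: "bool list \<Rightarrow> nat \<Rightarrow> nat \<Rightarrow> (nat \<Rightarrow> nat) \<Rightarrow> (nat \<Rightarrow> real) \<Rightarrow> (nat \<Rightarrow> nat) \<Rightarrow> (nat \<Rightarrow> real) \<Rightarrow> bool" where
  "frame ks lv d N R N' R' \<longleftrightarrow> (\<forall>j<tb d. R' j = R j) \<and> (\<forall>a<lv. \<forall>i<n. R' (vb a + i) = R (vb a + i)) \<and>
     (\<forall>r. r \<noteq> 4 \<longrightarrow> r \<noteq> 5 \<longrightarrow> r \<noteq> 6 \<longrightarrow> (\<forall>x\<ge>length ks. r \<noteq> rX x) \<longrightarrow> N' r = N r)"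

lemma tb_eq [simp]: "tb a = tb b \<longleftrightarrow> a = b"
  unfolding tb_def by simp

lemma relD:
  assumes "rel ks lv ix vs N R"
  shows "N 0 = n" "N 1 = 1" "N (Suc 0) = Suc 0" "N 2 = length as" "N 3 = f" "N 7 = tb Tm" "f \<le> n"
    "t < Tm \<Longrightarrow> N (rT t) = tb t" "a < Am \<Longrightarrow> N (rV a) = vb a" "x < length ks \<Longrightarrow> N (rX x) = ix x"
    "x < length ks \<Longrightarrow> ks ! x \<Longrightarrow> ix x < n" "x < length ks \<Longrightarrow> \<not> ks ! x \<Longrightarrow> ix x < length as"
    "b < lv \<Longrightarrow> length (vs b) = n" "b < lv \<Longrightarrow> i < n \<Longrightarrow> R (vb b + i) = vs b ! i"
    "c < length as \<Longrightarrow> R (n + c) = as ! c"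
  using assms unfolding rel_def by auto

lemma frame_refl: "frame ks lv d N R N R"
  unfolding frame_def by simp

lemma frame_trans: "frame ks lv d N R N1 R1 \<Longrightarrow> frame ks lv d N1 R1 N2 R2 \<Longrightarrow> frame ks lv d N R N2 R2"
  unfolding frame_def by simp

lemma frame_keep: "frame ks lv d N R N' R' \<Longrightarrow> x < length ks \<Longrightarrow> N' (rX x) = N (rX x)"
  unfolding frame_def by (elim conjE allE[of _ "rX x"]) auto

lemma frame_weaken: "frame ks' lv' d' N R N1 R1 \<Longrightarrow> length ks \<le> length ks' \<Longrightarrow> lv \<le> lv' \<Longrightarrow> d \<le> d' \<Longrightarrow> frame ks lv d N R N1 R1"
  unfolding frame_def tb_def by (meson add_le_mono le_refl less_le_trans order_trans)

lemma frame_rel: "frame ks lv d N R N' R' \<Longrightarrow> rel ks lv ix vs N R \<Longrightarrow> rel ks lv ix vs N' R'"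
  unfolding frame_def rel_def tb_def by (auto simp: linorder_not_less)

lemma frame_reg: "frame ks lv d N R N' R' \<Longrightarrow> r \<in> {4, 5, 6} \<or> (\<exists>x\<ge>length ks. r = rX x) \<Longrightarrow> frame ks lv d N R (N'(r := c)) R'"
  unfolding frame_def by auto

lemma frame_cell: "frame ks lv d N R N' R' \<Longrightarrow> tb d \<le> j \<Longrightarrow> j < tb Tm \<Longrightarrow> frame ks lv d N R N' (R'(j := c))"
  unfolding frame_def vb_def tb_def by auto

lemma bval_le: "rel ks lv ix vs N R \<Longrightarrow> wfb ks b \<Longrightarrow> bval n (length as) f ix b \<le> n + length as \<and>
    N (rB b) = bval n (length as) f ix b \<and>
    (\<forall>j<bval n (length as) f ix b. j < (if kind b then n else length as))"
  by (cases b) (auto simp: rel_def split: if_splits dest: order_less_trans)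

lemma rel_ext:
  assumes "rel ks lv ix vs N R" "j < (if b then n else length as)" "N (rX (length ks)) = j"
  shows "rel (ks @ [b]) lv (ix(length ks := j)) vs N R"
  using assms unfolding rel_def by (auto simp: nth_append less_Suc_eq)


lemma exq_binop:
  assumes rel: "rel ks lv ix vs N R" and d: "Suc d < Tm"
    and 1: "\<And>N R. rel ks lv ix vs N R \<Longrightarrow>
       exq n A c1 N R Q1 t1 (\<lambda>N' R'. frame ks lv d N R N' R' \<and> R' (tb d) = r1)"
    and 2: "\<And>N R. rel ks lv ix vs N R \<Longrightarrow>
       exq n A c2 N R Q2 t2 (\<lambda>N' R'. frame ks lv (Suc d) N R N' R' \<and> R' (tb (Suc d)) = r2)"
    and op: "\<And>N R Post. Post N (R(N (rT d) := g (R (N (rT d))) (R (N (rT (Suc d)))))) \<Longrightarrow> exq n A c N R [] 1 Post"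
  shows "exq n A (Seq c1 (Seq c2 c)) N R (Q1 @ Q2) (t1 + t2 + 1)
    (\<lambda>N' R'. frame ks lv d N R N' R' \<and> R' (tb d) = g r1 r2)"
proof -
  have "exq n A (Seq c1 (Seq c2 c)) N R (Q1 @ (Q2 @ [])) (t1 + (t2 + 1))
    (\<lambda>N' R'. frame ks lv d N R N' R' \<and> R' (tb d) = g r1 r2)"
  proof (rule exq_seq[OF 1[OF rel]], rule exq_seq[OF 2])
    fix N1 R1 assume f1: "frame ks lv d N R N1 R1 \<and> R1 (tb d) = r1"
    then show "rel ks lv ix vs N1 R1" using frame_rel rel by blast
    fix N2 R2 assume f2: "frame ks lv (Suc d) N1 R1 N2 R2 \<and> R2 (tb (Suc d)) = r2"
    have f12: "frame ks lv d N R N2 R2"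
      by (rule frame_trans[OF conjunct1[OF f1] frame_weaken[OF conjunct1[OF f2]]]) auto
    have rel2: "rel ks lv ix vs N2 R2" using frame_rel f12 rel by blast
    then have T: "N2 (rT d) = tb d" "N2 (rT (Suc d)) = tb (Suc d)" using d by (auto simp: rel_def)
    have "R2 (tb d) = r1" using f1 f2 by (auto simp: frame_def tb_def)
    then show "exq n A c N2 R2 [] 1 (\<lambda>N' R'. frame ks lv d N R N' R' \<and> R' (tb d) = g r1 r2)"
      using f2 d by (intro op) (auto simp: T intro!: frame_cell[OF f12], auto simp: tb_def)
  qed
  then show ?thesis by simp
qed

lemma exec_copy:
  assumes "rel ks lv ix vs N R" "a < lv" "lv < Am"
  shows "exq n A (copy (rV a) (rV lv)) N R [] ((n + length as) * 5 + 2)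
    (\<lambda>N' R'. frame ks lv Tm N R N' R' \<and> (\<forall>i<n. R' (vb lv + i) = vs a ! i))"
proof -
  let ?P = "\<lambda>j N' R'. frame ks lv Tm N R N' R' \<and> N' 4 = j \<and> (\<forall>i<j. i < n \<longrightarrow> R' (vb lv + i) = vs a ! i)"
  have "exq n A (copy (rV a) (rV lv)) N R (concat (map (\<lambda>_. []) [0..<n])) ((n + length as) * (3 + 2) + 2) (?P n)"
    unfolding copy_def
  proof (rule exq_loop[where P = ?P and m = n and B = "n + length as"])
    show "?P 0 (N(4 := 0)) R" by (auto intro!: frame_reg[OF frame_refl])
    fix j N1 R1 assume P: "?P j N1 R1"
    then have r1: "rel ks lv ix vs N1 R1" using frame_rel assms(1) by blast
    then show "N1 4 = j \<and> N1 0 = n" using P by (simp add: relD)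
    assume jn: "j < n"
    have regs: "N1 (rV a) = vb a" "N1 (rV lv) = vb lv" "N1 1 = 1" "R1 (vb a + j) = vs a ! j"
      using assms jn by (simp_all add: relD[OF r1])
    have fr: "frame ks lv Tm N R (N1(5 := x, 6 := vb lv + j, 4 := y)) (R1(vb lv + j := z))" for x y z
    proof -
      have "vb a' + i \<noteq> vb lv + j" if "a' < lv" "i < n" for a' i
      proof -
        have "n * Suc a' \<le> n * lv" using that by (intro mult_le_mono2) auto
        then show ?thesis using that by (simp add: vb_def)
      qed
      moreover have "vb lv + j \<ge> tb Tm" by (simp add: vb_def tb_def)
      ultimately have "frame ks lv Tm N1 R1 (N1(5 := x, 6 := vb lv + j, 4 := y)) (R1(vb lv + j := z))"
        unfolding frame_def by auto
      then show ?thesis using P frame_trans by blast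
    qed
    have "exq n A (Seq (IAdd 5 (rV a) 4) (Seq (IAdd 6 (rV lv) 4) (RMove 6 5))) N1 R1 ([] @ ([] @ [])) (1 + (1 + 1))
       (\<lambda>N R. N 1 = 1 \<and> ?P (Suc j) (N(4 := Suc (N 4))) R)"
      apply (rule exq_seq[where Mid = "\<lambda>N R. N = N1(5 := vb a + j) \<and> R = R1"])
       apply (rule exq_IAdd) using P regs apply simp
      apply (rule exq_seq[where Mid = "\<lambda>N R. N = N1(5 := vb a + j, 6 := vb lv + j) \<and> R = R1"])
       apply (rule exq_IAdd) using P regs apply simp
      apply (rule exq_RMove) using P regs fr by (auto simp: less_Suc_eq)
    then show "exq n A (Seq (IAdd 5 (rV a) 4) (Seq (IAdd 6 (rV lv) 4) (RMove 6 5))) N1 R1 [] 3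
       (\<lambda>N R. N 1 = 1 \<and> ?P (Suc j) (N(4 := Suc (N 4))) R)" by (simp add: numeral_3_eq_3)
  qed auto
  moreover have "concat (map (\<lambda>_. []) [0..<n]) = ([] :: real list list)" by (simp add: concat_eq_Nil_conv)
  ultimately show ?thesis by (auto intro: exq_mono)
qed


text \<open>The frame condition in the conclusion is what lets several subexpressions run one after
  the other from the same environment. In loops the invariant additionally carries the partial sum
  or the partial fold.\<close>

theorem exec_compile:
  assumes "rel ks lv ix vs N R" "wfe e ks lv" "d + nt e \<le> Tm" "nv e \<le> Am" "lv \<le> Am"
  shows "exq n A (compile e d) N R (qs n as f e ix vs) (tm (n + length as) e)
     (\<lambda>N' R'. frame ks lv d N R N' R' \<and> R' (tb d) = ev n as f A e ix vs)"
  using assms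
proof (induction e arbitrary: ks lv ix vs N R d)
  case (Num m c)
  have "exq n A (compile (Num m c) d) N R ([] @ ([] @ [])) (1 + (1 + 1))
     (\<lambda>N' R'. frame ks lv d N R N' R' \<and> R' (tb d) = real m / real c)"
    unfolding compile.simps
    apply (rule exq_seq[where Mid = "\<lambda>N' R'. N' = N \<and> R' = R(tb d := real m)"])
    subgoal using Num(3) by (intro exq_RConst) (auto simp: relD[OF Num(1)])
    apply (rule exq_seq[where Mid = "\<lambda>N' R'. N' = N \<and> R' = R(tb d := real m, tb (Suc d) := real c)"])
    subgoal using Num(3) by (intro exq_RConst) (auto simp: relD[OF Num(1)])
    subgoal using Num(3) by (intro exq_RDiv)
      (auto simp: relD[OF Num(1)] intro!: frame_cell frame_refl, auto simp: tb_def)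
    done
  then show ?case by (simp add: numeral_3_eq_3)
next
  case (Val a i)
  have "exq n A (compile (Val a i) d) N R ([] @ []) (1 + 1)
     (\<lambda>N' R'. frame ks lv d N R N' R' \<and> R' (tb d) = vs a ! ix i)"
    unfolding compile.simps
    apply (rule exq_seq[where Mid = "\<lambda>N' R'. N' = N(5 := vb a + ix i) \<and> R' = R"])
    subgoal using Val by (intro exq_IAdd) (auto simp: relD[OF Val(1)])
    subgoal using Val by (intro exq_RMove) (auto simp: relD[OF Val(1)] intro!: frame_cell frame_reg frame_refl, auto simp: tb_def)
    done
  then show ?case by (simp add: numeral_2_eq_2)
next
  case (As c)
  have "exq n A (compile (As c) d) N R ([] @ []) (1 + 1)
     (\<lambda>N' R'. frame ks lv d N R N' R' \<and> R' (tb d) = as ! ix c)"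
    unfolding compile.simps
    apply (rule exq_seq[where Mid = "\<lambda>N' R'. N' = N(5 := n + ix c) \<and> R' = R"])
    subgoal using As by (intro exq_IAdd) (auto simp: relD[OF As(1)])
    subgoal using As by (intro exq_RMove) (auto simp: relD[OF As(1)] intro!: frame_cell frame_reg frame_refl, auto simp: tb_def)
    done
  then show ?case by (simp add: numeral_2_eq_2)
next
  case (Qry a i)
  let ?R = "write_block n (A (vs a)) (tb Tm) R"
  have fr: "frame ks lv Tm N R N ?R"
    using Qry by (auto simp: frame_def write_block_def tb_def vb_def)
  have "exq n A (compile (Qry a i) d) N R ([vs a] @ ([] @ [])) (1 + (1 + 1))
     (\<lambda>N' R'. frame ks lv d N R N' R' \<and> R' (tb d) = A (vs a) ! ix i)"
    unfolding compile.simps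
    apply (rule exq_seq[where Mid = "\<lambda>N' R'. N' = N \<and> R' = ?R"])
    subgoal using Qry by (intro exq_Query) (auto simp: relD[OF Qry(1)] read_block_def intro!: nth_equalityI)
    apply (rule exq_seq[where Mid = "\<lambda>N' R'. N' = N(5 := tb Tm + ix i) \<and> R' = ?R"])
    subgoal using Qry by (intro exq_IAdd) (auto simp: relD[OF Qry(1)])
    subgoal using Qry frame_weaken[OF fr, of ks lv d]
      by (intro exq_RMove) (auto simp: relD[OF Qry(1)] write_block_def intro!: frame_cell frame_reg, auto simp: tb_def)
    done
  then show ?case by (simp add: numeral_3_eq_3)
next
  case (Add e1 e2)
  show ?case unfolding compile.simps qs.simps tm.simps ev.simps
    apply (rule exq_binop[OF Add.prems(1), where g = "(+)"])
    subgoal using Add.prems(3) nt_pos[of e2] by simp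
    subgoal using Add.prems by (intro Add.IH(1)) auto
    subgoal using Add.prems by (intro Add.IH(2)) auto
    subgoal by (rule exq_RAdd)
    done
next
  case (Sub e1 e2)
  show ?case unfolding compile.simps qs.simps tm.simps ev.simps
    apply (rule exq_binop[OF Sub.prems(1), where g = "(-)"])
    subgoal using Sub.prems(3) nt_pos[of e2] by simp
    subgoal using Sub.prems by (intro Sub.IH(1)) auto
    subgoal using Sub.prems by (intro Sub.IH(2)) auto
    subgoal by (rule exq_RSub)
    done
next
  case (Mul e1 e2)
  show ?case unfolding compile.simps qs.simps tm.simps ev.simps
    apply (rule exq_binop[OF Mul.prems(1), where g = "(*)"])
    subgoal using Mul.prems(3) nt_pos[of e2] by simp
    subgoal using Mul.prems by (intro Mul.IH(1)) auto
    subgoal using Mul.prems by (intro Mul.IH(2)) auto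
    subgoal by (rule exq_RMul)
    done
next
  case (Div e1 e2)
  show ?case unfolding compile.simps qs.simps tm.simps ev.simps
    apply (rule exq_binop[OF Div.prems(1), where g = "(/)"])
    subgoal using Div.prems(3) nt_pos[of e2] by simp
    subgoal using Div.prems by (intro Div.IH(1)) auto
    subgoal using Div.prems by (intro Div.IH(2)) auto
    subgoal by (rule exq_RDiv)
    done
next
  case (Ifl e1 e2 e3 e4)
  let ?v = "\<lambda>e. ev n as f A e ix vs"
  let ?fr = "\<lambda>N' R'. frame ks lv d N R N' R'"
  have step: "exq n A (compile e (d + i)) N1 R1 (qs n as f e ix vs) (tm (n + length as) e)
     (\<lambda>N' R'. ?fr N' R' \<and> (\<forall>j<i. R' (tb (d + j)) = R1 (tb (d + j))) \<and> R' (tb (d + i)) = ?v e)"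
    if f1: "?fr N1 R1" and e: "wfe e ks lv" "d + i + nt e \<le> Tm" "nv e \<le> Am"
      and IH: "\<And>ks lv ix vs N R d. rel ks lv ix vs N R \<Longrightarrow> wfe e ks lv \<Longrightarrow> d + nt e \<le> Tm \<Longrightarrow> nv e \<le> Am \<Longrightarrow> lv \<le> Am \<Longrightarrow>
        exq n A (compile e d) N R (qs n as f e ix vs) (tm (n + length as) e)
         (\<lambda>N' R'. frame ks lv d N R N' R' \<and> R' (tb d) = ev n as f A e ix vs)" for e i N1 R1
    apply (rule exq_mono[OF IH[OF frame_rel[OF f1 Ifl.prems(1)] e Ifl.prems(5)]])
    subgoal for N2 R2 using frame_trans[OF f1 frame_weaken[of ks lv "d + i" N1 R1 N2 R2]]
      by (auto simp: frame_def tb_def)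
    by simp
  have "exq n A (compile (Ifl e1 e2 e3 e4) d) N R
     (qs n as f e1 ix vs @ (qs n as f e2 ix vs @ (qs n as f e3 ix vs @ (qs n as f e4 ix vs @ []))))
     (tm (n + length as) e1 + (tm (n + length as) e2 + (tm (n + length as) e3 + (tm (n + length as) e4 + Suc 1))))
     (\<lambda>N' R'. ?fr N' R' \<and> R' (tb d) = (if ?v e1 < ?v e2 then ?v e3 else ?v e4))"
    unfolding compile.simps
    apply (rule exq_seq[where Mid = "\<lambda>N' R'. ?fr N' R' \<and> R' (tb d) = ?v e1"])
    subgoal using step[where i = 0, OF frame_refl, OF _ _ _ Ifl.IH(1)] Ifl.prems by simp
    apply (rule exq_seq[where Mid = "\<lambda>N' R'. ?fr N' R' \<and> R' (tb d) = ?v e1 \<and> R' (tb (d + 1)) = ?v e2"])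
    subgoal for N1 R1 using step[where i = 1, OF _ _ _ _ Ifl.IH(2), of N1 R1] Ifl.prems
      by (auto elim!: exq_mono)
    apply (rule exq_seq[where Mid = "\<lambda>N' R'. ?fr N' R' \<and> R' (tb d) = ?v e1 \<and> R' (tb (d + 1)) = ?v e2 \<and>
       R' (tb (d + 2)) = ?v e3"])
    subgoal for N1 R1 N2 R2 using step[where i = 2, OF _ _ _ _ Ifl.IH(3), of N2 R2] Ifl.prems
      by (auto elim!: exq_mono simp: eval_nat_numeral less_Suc_eq)
    apply (rule exq_seq[where Mid = "\<lambda>N' R'. ?fr N' R' \<and> R' (tb d) = ?v e1 \<and> R' (tb (d + 1)) = ?v e2 \<and>
       R' (tb (d + 2)) = ?v e3 \<and> R' (tb (d + 3)) = ?v e4"])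
    subgoal for N1 R1 N2 R2 N3 R3 using step[where i = 3, OF _ _ _ _ Ifl.IH(4), of N3 R3] Ifl.prems
      by (auto elim!: exq_mono simp: eval_nat_numeral less_Suc_eq)
    subgoal for N1 R1 N2 R2 N3 R3 N4 R4
    proof -
      assume a: "?fr N4 R4 \<and> R4 (tb d) = ?v e1 \<and> R4 (tb (d + 1)) = ?v e2 \<and>
       R4 (tb (d + 2)) = ?v e3 \<and> R4 (tb (d + 3)) = ?v e4"
      then have r: "rel ks lv ix vs N4 R4" using frame_rel Ifl.prems(1) by blast
      have T: "N4 (rT d) = tb d" "N4 (rT (d + 1)) = tb (d + 1)" "N4 (rT (d + 2)) = tb (d + 2)" "N4 (rT (d + 3)) = tb (d + 3)"
        using Ifl.prems(3) by (simp_all add: relD[OF r])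
      show ?thesis using a T Ifl.prems(3)
        by (intro exq_RIf; intro exq_RMove) (auto intro!: frame_cell, auto simp: tb_def)
    qed
    done
  then show ?case
    by (simp only: append_Nil2 append_assoc qs.simps ev.simps) (elim exq_mono, simp_all del: compile.simps)
next
  case (Sum b x e)
  let ?m = "bval n (length as) f ix b"
  let ?P = "\<lambda>j N' R'. frame ks lv d N R N' R' \<and> N' (rX x) = j \<and>
     R' (tb d) = (\<Sum>j<j. ev n as f A e (ix(x := j)) vs)"
  note b = bval_le[OF Sum.prems(1), of b]
  have x: "x = length ks" "wfb ks b" "wfe e (ks @ [kind b]) lv" using Sum.prems by auto

  have loop: "exq n A (loop (rX x) (rB b) (Seq (compile e (Suc d)) (RAdd (rT d) (rT d) (rT (Suc d))))) N0 R0
     (concat (map (\<lambda>j. qs n as f e (ix(x := j)) vs) [0..<?m]))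
     ((n + length as) * (tm (n + length as) e + 1 + 2) + 2) (?P ?m)"
    if start: "frame ks lv d N R N0 R0 \<and> R0 (tb d) = 0" for N0 R0
  proof (rule exq_loop[where P = ?P and m = ?m and B = "n + length as"])
    show "?P 0 (N0(rX x := 0)) R0" using start x by (auto intro!: frame_reg)
    fix j N1 R1 assume P: "?P j N1 R1"
    then have r1: "rel ks lv ix vs N1 R1" using frame_rel Sum.prems(1) by blast
    show "N1 (rX x) = j \<and> N1 (rB b) = ?m" using P bval_le[OF r1 x(2)] by auto
    assume j: "j < ?m"
    have r2: "rel (ks @ [kind b]) lv (ix(x := j)) vs N1 R1"
      using rel_ext[OF r1, of j "kind b"] j b[OF x(2)] P x(1) by auto
    have "exq n A (Seq (compile e (Suc d)) (RAdd (rT d) (rT d) (rT (Suc d)))) N1 R1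
      (qs n as f e (ix(x := j)) vs @ []) (tm (n + length as) e + 1)
      (\<lambda>N R. N 1 = 1 \<and> ?P (Suc j) (N(rX x := Suc (N (rX x)))) R)"
    proof (rule exq_seq[OF Sum.IH[OF r2 x(3)]])
      fix N2 R2 assume f2: "frame (ks @ [kind b]) lv (Suc d) N1 R1 N2 R2 \<and>
         R2 (tb (Suc d)) = ev n as f A e (ix(x := j)) vs"
      then have r3: "rel (ks @ [kind b]) lv (ix(x := j)) vs N2 R2" using frame_rel r2 by blast
      have f: "frame ks lv d N R N2 R2"
        by (rule frame_trans[OF conjunct1[OF P] frame_weaken[OF conjunct1[OF f2]]]) auto
      have T: "N2 (rT d) = tb d" "N2 (rT (Suc d)) = tb (Suc d)" "N2 1 = 1"
        using Sum.prems by (simp_all add: relD[OF r3])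
      have "N2 (rX x) = N1 (rX x)" by (rule frame_keep[OF conjunct1[OF f2]]) (simp add: x(1))
      then have k: "R2 (tb d) = R1 (tb d)" "N2 (rX x) = j"
        using f2 P by (simp_all add: frame_def tb_def)
      show "exq n A (RAdd (rT d) (rT d) (rT (Suc d))) N2 R2 [] 1
        (\<lambda>N R. N 1 = 1 \<and> ?P (Suc j) (N(rX x := Suc (N (rX x)))) R)"
        using f f2 P Sum.prems(3) x(1) k
        by (intro exq_RAdd) (auto simp: T[simplified] T intro!: frame_cell frame_reg, auto simp: tb_def)
    qed (use Sum.prems in auto)
    then show "exq n A (Seq (compile e (Suc d)) (RAdd (rT d) (rT d) (rT (Suc d)))) N1 R1
      (qs n as f e (ix(x := j)) vs) (tm (n + length as) e + 1)
      (\<lambda>N R. N 1 = 1 \<and> ?P (Suc j) (N(rX x := Suc (N (rX x)))) R)" by simp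
  qed (use b[OF x(2)] in auto)
  have "exq n A (compile (Sum b x e) d) N R ([] @ concat (map (\<lambda>j. qs n as f e (ix(x := j)) vs) [0..<?m]))
     (1 + ((n + length as) * (tm (n + length as) e + 1 + 2) + 2)) (?P ?m)"
    unfolding compile.simps
    apply (rule exq_seq[where Mid = "\<lambda>N' R'. frame ks lv d N R N' R' \<and> R' (tb d) = 0"])
    subgoal using Sum.prems(3) by (intro exq_RConst)
      (auto simp: relD[OF Sum.prems(1)] intro!: frame_cell frame_refl, auto simp: tb_def)
    by (rule loop)
  then show ?case
    by (simp only: append_Nil append_Nil2 append_assoc qs.simps ev.simps) (elim exq_mono, simp_all del: compile.simps add: algebra_simps)
next
  case (Best b x e1 e2)
  let ?m = "bval n (length as) f ix b"
  let ?g = "\<lambda>j. ev n as f A e1 (ix(x := j)) vs" and ?h = "\<lambda>j. ev n as f A e2 (ix(x := j)) vs"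
  let ?Q = "\<lambda>j. qs n as f e1 (ix(x := j)) vs @ qs n as f e2 (ix(x := j)) vs"
  let ?P = "\<lambda>j N' R'. frame ks lv d N R N' R' \<and> N' (rX x) = j \<and>
     R' (tb (d + 1)) = fst (bfold ?g ?h j) \<and> R' (tb d) = snd (bfold ?g ?h j)"
  let ?c = "Seq (compile e1 (d + 2)) (Seq (compile e2 (d + 3))
       (RIf (rT (d + 1)) (rT (d + 2)) (Seq (mv (d + 1) (d + 2)) (mv d (d + 3))) (IConst 5 0)))"
  let ?t = "tm (n + length as) e1 + (tm (n + length as) e2 + Suc (1 + 1))"
  note b = bval_le[OF Best.prems(1), of b]
  have x: "x = length ks" "wfb ks b" "wfe e1 (ks @ [kind b]) lv" "wfe e2 (ks @ [kind b]) lv"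
    using Best.prems by auto
  have loop: "exq n A (loop (rX x) (rB b) ?c) N0 R0 (concat (map ?Q [0..<?m]))
     ((n + length as) * (?t + 2) + 2) (?P ?m)"
    if start: "frame ks lv d N R N0 R0 \<and> R0 (tb d) = 0 \<and> R0 (tb (d + 1)) = -1" for N0 R0
  proof (rule exq_loop[where P = ?P and m = ?m and B = "n + length as"])
    show "?P 0 (N0(rX x := 0)) R0" using start x by (auto intro!: frame_reg)
    fix j N1 R1 assume P: "?P j N1 R1"
    then have r1: "rel ks lv ix vs N1 R1" using frame_rel Best.prems(1) by blast
    show "N1 (rX x) = j \<and> N1 (rB b) = ?m" using P bval_le[OF r1 x(2)] by auto
    assume j: "j < ?m"
    have r2: "rel (ks @ [kind b]) lv (ix(x := j)) vs N1 R1"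
      using rel_ext[OF r1, of j "kind b"] j b[OF x(2)] P x(1) by auto
    have "exq n A ?c N1 R1 (qs n as f e1 (ix(x := j)) vs @ (qs n as f e2 (ix(x := j)) vs @ [])) ?t
      (\<lambda>N R. N 1 = 1 \<and> ?P (Suc j) (N(rX x := Suc (N (rX x)))) R)"
    proof (rule exq_seq[OF Best.IH(1)[OF r2 x(3)]])
      fix N2 R2 assume f2: "frame (ks @ [kind b]) lv (d + 2) N1 R1 N2 R2 \<and> R2 (tb (d + 2)) = ?g j"
      then have r3: "rel (ks @ [kind b]) lv (ix(x := j)) vs N2 R2" using frame_rel r2 by blast
      show "exq n A (Seq (compile e2 (d + 3))
         (RIf (rT (d + 1)) (rT (d + 2)) (Seq (mv (d + 1) (d + 2)) (mv d (d + 3))) (IConst 5 0))) N2 R2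
         (qs n as f e2 (ix(x := j)) vs @ []) (tm (n + length as) e2 + Suc (1 + 1))
         (\<lambda>N R. N 1 = 1 \<and> ?P (Suc j) (N(rX x := Suc (N (rX x)))) R)"
      proof (rule exq_seq[OF Best.IH(2)[OF r3 x(4)]])
        fix N3 R3 assume f3: "frame (ks @ [kind b]) lv (d + 3) N2 R2 N3 R3 \<and> R3 (tb (d + 3)) = ?h j"
        have f: "frame ks lv d N R N3 R3"
          by (rule frame_trans[OF frame_trans[OF conjunct1[OF P] frame_weaken[OF conjunct1[OF f2]]]
               frame_weaken[OF conjunct1[OF f3]]]) auto
        have r4: "rel (ks @ [kind b]) lv (ix(x := j)) vs N3 R3" using frame_rel r3 f3 by blast
        have T: "N3 (rT d) = tb d" "N3 (rT (Suc d)) = tb (Suc d)" "N3 (rT (d + 2)) = tb (d + 2)"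
            "N3 (rT (d + 3)) = tb (d + 3)" "N3 1 = 1"
          using Best.prems(3) by (simp_all add: relD[OF r4])
        have "N3 (rX x) = N2 (rX x)" by (rule frame_keep[OF conjunct1[OF f3]]) (simp add: x(1))
        moreover have "N2 (rX x) = N1 (rX x)" by (rule frame_keep[OF conjunct1[OF f2]]) (simp add: x(1))
        ultimately have k: "R3 (tb d) = snd (bfold ?g ?h j)" "R3 (tb (d + 1)) = fst (bfold ?g ?h j)" "N3 (rX x) = j"
           "R3 (tb (d + 2)) = ?g j" "R3 (tb (d + 3)) = ?h j"
          using f2 f3 P by (simp_all add: frame_def tb_def)
        have fr: "frame ks lv d N R (N3(rX x := y)) (R3(tb (Suc d) := z, tb d := w))" for y z w
          by (rule frame_reg[OF frame_cell[OF frame_cell[OF f]]])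
            (use Best.prems(3) x(1) in \<open>auto simp: tb_def\<close>)
        have fr': "frame ks lv d N R (N3(5 := 0, rX x := y)) R3" for y
          using f x(1) by (auto intro!: frame_reg)
        show "exq n A (RIf (rT (d + 1)) (rT (d + 2)) (Seq (mv (d + 1) (d + 2)) (mv d (d + 3))) (IConst 5 0)) N3 R3
           [] (Suc (1 + 1)) (\<lambda>N R. N 1 = 1 \<and> ?P (Suc j) (N(rX x := Suc (N (rX x)))) R)"
        proof (rule exq_RIf)
          assume lt: "R3 (N3 (rT (d + 1))) < R3 (N3 (rT (d + 2)))"
          have "exq n A (Seq (mv (d + 1) (d + 2)) (mv d (d + 3))) N3 R3 ([] @ []) (1 + 1)
             (\<lambda>N R. N 1 = 1 \<and> ?P (Suc j) (N(rX x := Suc (N (rX x)))) R)"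
            apply (rule exq_seq[where Mid = "\<lambda>N' R'. N' = N3 \<and> R' = R3(tb (Suc d) := ?g j)"])
            subgoal using T k by (intro exq_RMove) auto
            subgoal for N4 R4
            proof -
              assume e: "N4 = N3 \<and> R4 = R3(tb (Suc d) := ?g j)"
              have "fst (bfold ?g ?h j) < ?g j" using lt T k by simp
              then show ?thesis unfolding e[THEN conjunct1] e[THEN conjunct2]
                using fr k by (intro exq_RMove) (simp add: T T[simplified])
            qed
            done
          then show "exq n A (Seq (mv (d + 1) (d + 2)) (mv d (d + 3))) N3 R3 [] (1 + 1)
             (\<lambda>N R. N 1 = 1 \<and> ?P (Suc j) (N(rX x := Suc (N (rX x)))) R)" by simp
        next
          assume nlt: "\<not> R3 (N3 (rT (d + 1))) < R3 (N3 (rT (d + 2)))"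
          show "exq n A (IConst 5 0) N3 R3 [] (1 + 1)
             (\<lambda>N R. N 1 = 1 \<and> ?P (Suc j) (N(rX x := Suc (N (rX x)))) R)"
            apply (rule exq_mono[where t = 1 and Post = "\<lambda>N R. N 1 = 1 \<and> ?P (Suc j) (N(rX x := Suc (N (rX x)))) R"])
            subgoal
            proof -
              have "\<not> fst (bfold ?g ?h j) < ?g j" using nlt T k by simp
              then show ?thesis using fr' k by (intro exq_IConst) (simp add: T T[simplified])
            qed
            by auto
        qed
      qed (use Best.prems in auto)
    qed (use Best.prems in auto)
    then show "exq n A ?c N1 R1 (?Q j) ?t
      (\<lambda>N R. N 1 = 1 \<and> ?P (Suc j) (N(rX x := Suc (N (rX x)))) R)" by simp
  qed (use b[OF x(2)] in auto)
  have "exq n A (compile (Best b x e1 e2) d) N R ([] @ ([] @ ([] @ concat (map ?Q [0..<?m]))))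
     (1 + (1 + (1 + ((n + length as) * (?t + 2) + 2)))) (?P ?m)"
    unfolding compile.simps
    apply (rule exq_seq[where Mid = "\<lambda>N' R'. N' = N \<and> R' = R(tb d := 0)"])
    subgoal using Best.prems(3) by (intro exq_RConst) (auto simp: relD[OF Best.prems(1)])
    apply (rule exq_seq[where Mid = "\<lambda>N' R'. N' = N \<and> R' = R(tb d := 0, tb (d + 1) := 1)"])
    subgoal using Best.prems(3) by (intro exq_RConst) (auto simp: relD[OF Best.prems(1)])
    apply (rule exq_seq[where Mid = "\<lambda>N' R'. frame ks lv d N R N' R' \<and> R' (tb d) = 0 \<and> R' (tb (d + 1)) = -1"])
    subgoal using Best.prems(3)
      by (intro exq_RSub) (auto simp: relD[OF Best.prems(1)] intro!: frame_cell frame_refl, auto simp: tb_def)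
    by (rule loop)
  then show ?case
    by (simp only: append_Nil append_Nil2 append_assoc qs.simps ev.simps) (elim exq_mono, simp_all del: compile.simps add: algebra_simps)
next
  case (Upd a' a i c e)
  have a: "a' = lv" "a < lv" "lv < Am" "i < length ks" "ks ! i" "c < length ks" "\<not> ks ! c" "wfe e ks (Suc lv)"
    using Upd.prems by auto
  note r = Upd.prems(1)
  have ii: "ix i < n" "ix c < length as" using a relD[OF r] by blast+
  let ?w = "(vs a)[ix i := as ! ix c]"
  have ge: "tb d' \<le> vb lv + ix i" if "d' \<le> Tm" for d' using that by (auto simp: tb_def vb_def)
  have vneq: "vb b + j \<noteq> vb lv + i'" if "b < lv" "j < n" for b j i'
  proof -
    have "n * Suc b \<le> n * lv" using that by (intro mult_le_mono2) auto
    then show ?thesis using that by (simp add: vb_def)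
  qed
  have "exq n A (compile (Upd a' a i c e) d) N R ([] @ ([] @ ([] @ ([] @ qs n as f e ix (vs(a' := ?w))))))
     (((n + length as) * 5 + 2) + (1 + (1 + (1 + tm (n + length as) e))))
     (\<lambda>N' R'. frame ks lv d N R N' R' \<and> R' (tb d) = ev n as f A e ix (vs(a' := ?w)))"
    unfolding compile.simps
    apply (rule exq_seq[where Mid = "\<lambda>N' R'. frame ks lv Tm N R N' R' \<and> (\<forall>i<n. R' (vb lv + i) = vs a ! i)"])
    subgoal using exec_copy[OF r a(2,3)] a(1) by simp
    apply (rule exq_seq[where Mid = "\<lambda>N' R'. frame ks lv Tm N R N' R' \<and> (\<forall>i<n. R' (vb lv + i) = vs a ! i) \<and> N' 5 = vb lv + ix i"])
    subgoal for N1 R1 using a ii frame_rel[of ks lv Tm N R N1 R1, OF _ r]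
      by (intro exq_IAdd) (auto simp: relD intro!: frame_reg)
    apply (rule exq_seq[where Mid = "\<lambda>N' R'. frame ks lv Tm N R N' R' \<and> (\<forall>i<n. R' (vb lv + i) = vs a ! i) \<and>
       N' 5 = vb lv + ix i \<and> N' 6 = n + ix c"])
    subgoal for N1 R1 N2 R2 using a ii frame_rel[of ks lv Tm N R N2 R2, OF _ r]
      by (intro exq_IAdd) (auto simp: relD intro!: frame_reg)
    apply (rule exq_seq[where Mid = "\<lambda>N' R'. frame ks lv d N R N' R' \<and> rel ks (Suc lv) ix (vs(a' := ?w)) N' R'"])
    subgoal for N1 R1 N2 R2 N3 R3
    proof -
      assume f: "frame ks lv Tm N R N3 R3 \<and> (\<forall>i<n. R3 (vb lv + i) = vs a ! i) \<and>
         N3 5 = vb lv + ix i \<and> N3 6 = n + ix c"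
      then have r3: "rel ks lv ix vs N3 R3" using frame_rel r by blast
      have v: "R3 (N3 6) = as ! ix c" using f ii by (simp add: relD[OF r3])
      have f': "frame ks lv d N R N3 (R3(vb lv + ix i := z))" for z
      proof -
        have fw: "frame ks lv d N R N3 R3"
          using frame_weaken[of ks lv Tm N R N3 R3 ks lv d] f Upd.prems(3) by simp
        have "\<forall>j<tb d. j \<noteq> vb lv + ix i" using ge[of d] Upd.prems(3) by auto
        moreover have "\<forall>a<lv. \<forall>j<n. vb a + j \<noteq> vb lv + ix i" using vneq by blast
        ultimately show ?thesis using fw by (simp add: frame_def)
      qed
      have "rel ks (Suc lv) ix (vs(a' := ?w)) N3 (R3(vb lv + ix i := as ! ix c))"
        unfolding rel_def
      proof (intro conjI allI impI)
        fix b assume b: "b < Suc lv"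
        show "length ((vs(a' := ?w)) b) = n"
          using b a relD(13)[OF r3] by (cases "b = lv") auto
        fix j assume j: "j < n"
        show "(R3(vb lv + ix i := as ! ix c)) (vb b + j) = (vs(a' := ?w)) b ! j"
        proof (cases "b = lv")
          case True
          then show ?thesis using f j a relD(13)[OF r3, of a] by (auto simp: nth_list_update)
        next
          case False
          then have "b < lv" using b by simp
          then show ?thesis using vneq[of b j] relD(14)[OF r3, of b j] j a(1) False by simp
        qed
      next
        fix c' assume "c' < length as"
        then show "(R3(vb lv + ix i := as ! ix c)) (n + c') = as ! c'"
          by (simp add: relD[OF r3] vb_def)
      qed (simp_all add: relD[OF r3])
      then show ?thesis using f f' v by (intro exq_RMove) auto
    qed
    subgoal for N1 R1 N2 R2 N3 R3 N4 R4
    proof -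
      assume f: "frame ks lv d N R N4 R4 \<and> rel ks (Suc lv) ix (vs(a' := ?w)) N4 R4"
      show ?thesis
        apply (rule exq_mono[OF Upd.IH[of ks "Suc lv" ix "vs(a' := ?w)" N4 R4 d]])
        subgoal using f by blast
        subgoal using a by blast
        subgoal using Upd.prems(3) by simp
        subgoal using Upd.prems(4) by simp
        subgoal using a by simp
        subgoal for N5 R5 using f frame_trans[of ks lv d N R N4 R4] frame_weaken[of ks "Suc lv" d N4 R4 N5 R5 ks lv d]
          by (simp add: fun_upd_def)
        by simp
    qed
    done
  then show ?case
    by (simp only: append_Nil append_Nil2 append_assoc qs.simps ev.simps) (elim exq_mono, simp_all del: compile.simps add: algebra_simps)
qed

end

section \<open>Polynomial running time and complete programs\<close>

lemma tm_poly: "\<exists>C d. \<forall>B\<ge>1. tm B e \<le> C * B ^ d"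
proof (induction e)
  \<comment> \<open>One estimate serves all constructors: for \<open>B \<ge> 1\<close> the bound
    \<open>B * (h1 B + h2 B + 10)\<close> dominates each recursion of \<open>tm\<close>, the
    additive costs being at most 10 together.\<close>
  have bin: "\<exists>C d. \<forall>B\<ge>1. g B \<le> C * B ^ d"
    if h: "\<exists>C d. \<forall>B\<ge>1. h1 B \<le> C * B ^ d" "\<exists>C d. \<forall>B\<ge>1. h2 B \<le> C * B ^ d"
      and g: "\<And>B. 1 \<le> B \<Longrightarrow> g B \<le> B * (h1 B + h2 B + 10)" for g h1 h2 :: "nat \<Rightarrow> nat"
  proof -
    obtain C1 d1 C2 d2 where 1: "\<And>B. 1 \<le> B \<Longrightarrow> h1 B \<le> C1 * B ^ d1" "\<And>B. 1 \<le> B \<Longrightarrow> h2 B \<le> C2 * B ^ d2"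
      using h by blast
    have "g B \<le> (C1 + C2 + 10) * B ^ (d1 + d2 + 1)" if B: "1 \<le> B" for B
    proof -
      have p: "1 \<le> B ^ d" for d using B by simp
      have "B ^ d1 \<le> B ^ (d1 + d2)" "B ^ d2 \<le> B ^ (d1 + d2)" using B by (auto intro: power_increasing)
      then have "h1 B \<le> C1 * B ^ (d1 + d2)" "h2 B \<le> C2 * B ^ (d1 + d2)"
        using 1[OF B] by (meson le_trans mult_le_mono2)+
      then have "h1 B + h2 B + 10 \<le> (C1 + C2 + 10) * B ^ (d1 + d2)" using p[of "d1 + d2"] by (simp add: distrib_right)
      then have "B * (h1 B + h2 B + 10) \<le> B * ((C1 + C2 + 10) * B ^ (d1 + d2))" by (rule mult_le_mono2)
      then show ?thesis using g[OF B] by (simp add: algebra_simps)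
    qed
    then show ?thesis by blast
  qed
  have add: "a \<le> B * a" if "1 \<le> B" for a B :: nat using that by simp
  have zero: "\<exists>C d. \<forall>B\<ge>1. (\<lambda>B. 0 :: nat) B \<le> C * B ^ d" by (rule exI[of _ 0], rule exI[of _ 0]) simp
  have const: "\<exists>C d. \<forall>B\<ge>1. c \<le> C * B ^ d" for c :: nat
    by (rule exI[of _ c], rule exI[of _ 0]) simp
  { case Num show ?case unfolding tm.simps by (rule const)
  next case Val show ?case unfolding tm.simps by (rule const)
  next case As show ?case unfolding tm.simps by (rule const)
  next case Qry show ?case unfolding tm.simps by (rule const)
  next case (Add e1 e2)
    show ?case by (rule bin[OF Add]) (auto intro!: order_trans[OF _ add])
  next case (Sub e1 e2)
    show ?case by (rule bin[OF Sub]) (auto intro!: order_trans[OF _ add])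
  next case (Mul e1 e2)
    show ?case by (rule bin[OF Mul]) (auto intro!: order_trans[OF _ add])
  next case (Div e1 e2)
    show ?case by (rule bin[OF Div]) (auto intro!: order_trans[OF _ add])
  next case (Ifl e1 e2 e3 e4)
    show ?case
      by (rule bin[OF bin[OF Ifl(1,2), of "\<lambda>B. tm B e1 + tm B e2"] bin[OF Ifl(3,4), of "\<lambda>B. tm B e3 + tm B e4"]])
        (auto intro!: order_trans[OF _ add])
  next case (Sum b x e)
    show ?case by (rule bin[OF Sum zero]) (auto simp: algebra_simps)
  next case (Best b x e1 e2)
    show ?case by (rule bin[OF Best]) (auto simp: algebra_simps)
  next case (Upd a' a i c e)
    show ?case by (rule bin[OF Upd zero]) (auto simp: algebra_simps intro: order_trans[OF add])
  }
qed

text \<open>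
  The prologue sets up the registers: \<open>f\<close> is the residue of \<open>n\<close> modulo \<open>F\<close> in \<open>{1..F}\<close>.
\<close>

primrec setT :: "nat \<Rightarrow> nat \<Rightarrow> com" where
  "setT k 0 = IConst 4 0"
| "setT k (Suc t) = Seq (setT k t) (Seq (IConst 4 (k + t)) (IAdd (rT t) 0 4))"

primrec setV :: "nat \<Rightarrow> com" where
  "setV 0 = IAdd (rV 0) 7 0"
| "setV (Suc a) = Seq (setV a) (IAdd (rV (Suc a)) (rV a) 0)"

text \<open>Register 5 is still zero, so \<open>IAdd 3 0 5\<close> copies \<open>n\<close>. The loop
  subtracts only while the remainder exceeds \<open>F\<close>, which leaves a residue that is never
  zero: at least one coordinate is free.\<close>

definition prologue :: "nat \<Rightarrow> nat \<Rightarrow> nat \<Rightarrow> nat \<Rightarrow> com" where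
  "prologue k F Tm Am = Seq (IConst 1 1) (Seq (IConst 2 k)
     (Seq (IConst 4 F) (Seq (IAdd 3 0 5) (Seq (IWhile 4 3 (ISub 3 3 4))
     (Seq (IConst 4 (k + Tm)) (Seq (IAdd 7 0 4) (Seq (setT k Tm) (setV Am))))))))"

text \<open>The input is first copied to vector 0, because writing the output destroys its original
  place.\<close>

definition program :: "nat \<Rightarrow> nat \<Rightarrow> expr \<Rightarrow> com" where
  "program k F e = (let Tm = nt e; Am = Suc (nv e) in
     Seq (prologue k F Tm Am)
     (Seq (loop 4 0 (Seq (IAdd 5 (rV 0) 4) (RMove 5 4)))
      (loop (rX 0) 0 (Seq (compile e 0) (RMove (rX 0) (rT 0))))))"

definition free_count :: "nat \<Rightarrow> nat \<Rightarrow> nat" where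
  "free_count F n = (n - 1) mod F + 1"

lemma exq_mod:
  assumes "N 4 = F" "F \<ge> 1" "N 3 = m" "m \<ge> 1"
  shows "exq n A (IWhile 4 3 (ISub 3 3 4)) N R [] (2 * m)
    (\<lambda>N' R'. N' = N(3 := free_count F m) \<and> R' = R)"
  using assms
proof (induction m arbitrary: N rule: less_induct)
  case (less m)
  show ?case
  proof (cases "F < m")
    case False
    then have m: "free_count F m = m" using less.prems by (simp add: free_count_def)
    have "exec n A (IWhile 4 3 (ISub 3 3 4)) (N, R) 1 [] (N, R)"
      using False less.prems by (intro exec.IWhile_False) auto
    then show ?thesis unfolding exq_def m using less.prems by (metis fun_upd_triv mult_le_mono one_le_numeral nat_mult_1)
  next
    case True
    let ?N = "N(3 := N 3 - N 4)"
    have "exq n A (IWhile 4 3 (ISub 3 3 4)) ?N R [] (2 * (m - F))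
      (\<lambda>N' R'. N' = ?N(3 := free_count F (m - F)) \<and> R' = R)"
      using less.prems True by (intro less.IH) auto
    then obtain t where t: "exec n A (IWhile 4 3 (ISub 3 3 4)) (?N, R) t [] (?N(3 := free_count F (m - F)), R)"
        "t \<le> 2 * (m - F)" unfolding exq_def by blast
    have "exec n A (IWhile 4 3 (ISub 3 3 4)) (N, R) (Suc (1 + t)) ([] @ []) (?N(3 := free_count F (m - F)), R)"
      using True less.prems by (intro exec.IWhile_True[OF _ exec.ISub t(1)]) auto
    moreover have "free_count F (m - F) = free_count F m"
      using True le_mod_geq[of F "m - 1"] by (simp add: free_count_def diff_commute)
    moreover have "Suc (1 + t) \<le> 2 * m" using t(2) True less.prems by simp
    ultimately show ?thesis unfolding exq_def by fastforce
  qed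
qed

context machine begin

lemma exq_setT:
  assumes "N 0 = n" "T \<le> Tm"
  shows "exq n A (setT (length as) T) N R [] (3 * T + 1) (\<lambda>N' R'. R' = R \<and> (\<forall>t<T. N' (rT t) = tb t) \<and>
    (\<forall>r. r \<noteq> 4 \<longrightarrow> (\<forall>t. r \<noteq> rT t) \<longrightarrow> N' r = N r))"
  using assms(2)
proof (induction T)
  case 0
  show ?case unfolding setT.simps
    by (rule exq_mono[OF exq_IConst[where Post = "\<lambda>N' R'. N' = N(4 := 0) \<and> R' = R"]]) auto
next
  case (Suc T)
  let ?P = "\<lambda>T N' R'. R' = R \<and> (\<forall>t<T. N' (rT t) = tb t) \<and> (\<forall>r. r \<noteq> 4 \<longrightarrow> (\<forall>t. r \<noteq> rT t) \<longrightarrow> N' r = N r)"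
  have "exq n A (setT (length as) (Suc T)) N R ([] @ ([] @ [])) ((3 * T + 1) + (1 + 1)) (?P (Suc T))"
    unfolding setT.simps
    apply (rule exq_seq[OF Suc.IH])
    subgoal using Suc.prems by simp
    subgoal for N1 R1
      apply (rule exq_seq[where Mid = "\<lambda>N' R'. ?P T N' R' \<and> N' 4 = length as + T"])
      subgoal by (intro exq_IConst) auto
      subgoal for N2 R2 using assms(1) by (intro exq_IAdd) (auto simp: less_Suc_eq tb_def)
      done
    done
  then show ?case by (auto elim!: exq_mono simp del: setT.simps)
qed

lemma exq_setV:
  assumes "N 0 = n" "N 7 = tb Tm"
  shows "exq n A (setV T) N R [] (T + 1) (\<lambda>N' R'. R' = R \<and> (\<forall>t\<le>T. N' (rV t) = vb t) \<and>
    (\<forall>r. (\<forall>t. r \<noteq> rV t) \<longrightarrow> N' r = N r))"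
proof (induction T)
  case 0
  show ?case unfolding setV.simps
    by (rule exq_mono[OF exq_IAdd[where Post = "\<lambda>N' R'. N' = N(rV 0 := N 7 + N 0) \<and> R' = R"]])
      (auto simp: assms vb_def tb_def)
next
  case (Suc T)
  have "exq n A (setV (Suc T)) N R ([] @ []) ((T + 1) + 1) (\<lambda>N' R'. R' = R \<and> (\<forall>t\<le>Suc T. N' (rV t) = vb t) \<and>
    (\<forall>r. (\<forall>t. r \<noteq> rV t) \<longrightarrow> N' r = N r))"
    unfolding setV.simps
    apply (rule exq_seq[OF Suc.IH])
    subgoal for N1 R1 using assms by (intro exq_IAdd) (auto simp: le_Suc_eq vb_def)
    done
  then show ?case by (auto elim!: exq_mono simp del: setV.simps)
qed

end


theorem program_runs:
  fixes as :: "real list"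
  assumes n: "1 \<le> n" and F: "1 \<le> F" and v: "length v = n" and wf: "wfe e [True] 1"
  defines "f \<equiv> free_count F n" and "k \<equiv> length as"
  shows "\<exists>t. runs n as (program k F e) A v t
      (concat (map (\<lambda>i. qs n as f e (\<lambda>_. i) (\<lambda>_. v)) [0..<n]))
      (map (\<lambda>i. ev n as f A e (\<lambda>_. i) (\<lambda>_. v)) [0..<n]) \<and>
    t \<le> (n + k) * (tm (n + k) e + 10 + 5 * nt e + nv e) + 5 * nt e + nv e + 20"
proof -
  define Tm where "Tm = nt e"
  define Am where "Am = Suc (nv e)"
  interpret machine n as f A Tm Am .
  define N0 where "N0 = (\<lambda>_::nat. 0::nat)(0 := n)"
  define R0 where "R0 = (\<lambda>j. if j < length (v @ as) then (v @ as) ! j else 0)"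
  have R0: "R0 i = v ! i" if "i < n" for i using that v by (simp add: R0_def nth_append)
  have R0': "R0 (n + c) = as ! c" if "c < k" for c using that v by (simp add: R0_def nth_append k_def)
  let ?S = "\<lambda>N. N 0 = n \<and> N 1 = 1 \<and> N 2 = k \<and> N 3 = f \<and> N 7 = tb Tm \<and>
     (\<forall>t<Tm. N (rT t) = tb t) \<and> (\<forall>a\<le>Am. N (rV a) = vb a)"
  have fn: "f \<le> n"
  proof -
    have "(n - 1) mod F \<le> n - 1" by (rule mod_less_eq_dividend)
    then show ?thesis using n unfolding f_def free_count_def by linarith
  qed
  have pro: "exq n A (prologue k F Tm Am) N0 R0 ([] @ ([] @ ([] @ ([] @ ([] @ ([] @ ([] @ ([] @ []))))))))
      (1 + (1 + (1 + (1 + (2 * n + (1 + (1 + ((3 * Tm + 1) + (Am + 1))))))))) (\<lambda>N R. ?S N \<and> R = R0)"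
    unfolding prologue_def
    apply (rule exq_seq[where Mid = "\<lambda>N R. R = R0 \<and> N = N0(1 := 1)"])
    subgoal by (intro exq_IConst) simp
    apply (rule exq_seq[where Mid = "\<lambda>N R. R = R0 \<and> N = N0(1 := 1, 2 := k)"])
    subgoal by (intro exq_IConst) simp
    apply (rule exq_seq[where Mid = "\<lambda>N R. R = R0 \<and> N = N0(1 := 1, 2 := k, 4 := F)"])
    subgoal by (intro exq_IConst) simp
    apply (rule exq_seq[where Mid = "\<lambda>N R. R = R0 \<and> N = N0(1 := 1, 2 := k, 4 := F, 3 := n)"])
    subgoal by (intro exq_IAdd) (simp add: N0_def)
    apply (rule exq_seq[where Mid = "\<lambda>N R. R = R0 \<and> N = N0(1 := 1, 2 := k, 4 := F, 3 := f)"])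
    subgoal for N1 R1 N2 R2 N3 R3 N4 R4
      apply (rule exq_mono[OF exq_mod[of N4 F n]]) using n F by (auto simp: f_def)
    apply (rule exq_seq[where Mid = "\<lambda>N R. R = R0 \<and> N = N0(1 := 1, 2 := k, 4 := k + Tm, 3 := f)"])
    subgoal by (intro exq_IConst) (auto simp: fun_eq_iff)
    apply (rule exq_seq[where Mid = "\<lambda>N R. R = R0 \<and> N = N0(1 := 1, 2 := k, 4 := k + Tm, 3 := f, 7 := tb Tm)"])
    subgoal by (intro exq_IAdd) (auto simp: N0_def tb_def k_def)
    apply (rule exq_seq[where Mid = "\<lambda>N R. R = R0 \<and> N 0 = n \<and> N 1 = 1 \<and> N 2 = k \<and> N 3 = f \<and> N 7 = tb Tm \<and> (\<forall>t<Tm. N (rT t) = tb t)"])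
    subgoal for N1 R1 N2 R2 N3 R3 N4 R4 N5 R5 N6 R6 N7 R7
      apply (unfold k_def)
      apply (rule exq_mono[OF exq_setT[of N7 Tm]])
      by (auto simp: N0_def k_def)
    subgoal for N1 R1 N2 R2 N3 R3 N4 R4 N5 R5 N6 R6 N7 R7 N8 R8
      apply (rule exq_mono[OF exq_setV[of N8 Am]]) by auto
    done
  let ?c = "Seq (IAdd 5 (rV 0) 4) (RMove 5 4)"
  let ?P = "\<lambda>j N R. ?S N \<and> N 4 = j \<and> (\<forall>i. i < vb 0 \<longrightarrow> R i = R0 i) \<and> (\<forall>i<j. R (vb 0 + i) = v ! i)"
  have cp: "exq n A (loop 4 0 ?c) N R (concat (map (\<lambda>_. []) [0..<n])) (n * (2 + 2) + 2) (?P n)"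
    if start: "?S N \<and> R = R0" for N R
  proof (rule exq_loop[where P = ?P and m = n])
    show "?P 0 (N(4 := 0)) R" using start by simp
    fix j N1 R1 assume P: "?P j N1 R1"
    then show "N1 4 = j \<and> N1 0 = n" by simp
    assume j: "j < n"
    have v0: "R1 j = v ! j" using P j R0 by (simp add: vb_def)
    have "exq n A ?c N1 R1 ([] @ []) (1 + 1) (\<lambda>N R. N 1 = 1 \<and> ?P (Suc j) (N(4 := Suc (N 4))) R)"
      apply (rule exq_seq[where Mid = "\<lambda>N R. R = R1 \<and> N = N1(5 := vb 0 + j)"])
      subgoal using P by (intro exq_IAdd) auto
      subgoal using P v0 by (intro exq_RMove) (auto simp: less_Suc_eq)
      done
    then show "exq n A ?c N1 R1 [] 2 (\<lambda>N R. N 1 = 1 \<and> ?P (Suc j) (N(4 := Suc (N 4))) R)"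
      by (simp add: numeral_2_eq_2)
  qed simp
  let ?ix = "\<lambda>i::nat. (\<lambda>_::nat. i)" and ?vs = "\<lambda>_::nat. v"
  let ?d = "Seq (compile e 0) (RMove (rX 0) (rT 0))"
  let ?L = "\<lambda>j N R. ?S N \<and> N (rX 0) = j \<and> (\<forall>i. n \<le> i \<and> i < n + k \<longrightarrow> R i = R0 i) \<and> (\<forall>i<n. R (vb 0 + i) = v ! i) \<and>
     (\<forall>i<j. R i = ev n as f A e (?ix i) ?vs)"
  have main: "exq n A (loop (rX 0) 0 ?d) N R (concat (map (\<lambda>i. qs n as f e (?ix i) ?vs) [0..<n]))
      ((n + k) * (tm (n + k) e + 1 + 2) + 2) (?L n)" if start: "?P n N R" for N R
  proof (rule exq_loop[where P = ?L and m = n])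
    show "?L 0 (N(rX 0 := 0)) R" using start by (auto simp: vb_def k_def)
    fix j N1 R1 assume L: "?L j N1 R1"
    then show "N1 (rX 0) = j \<and> N1 0 = n" by simp
    assume j: "j < n"
    have r: "rel [True] 1 (?ix j) ?vs N1 R1"
      using L j v fn R0' unfolding rel_def by (simp add: k_def Am_def)
    have "exq n A ?d N1 R1 (qs n as f e (?ix j) ?vs @ []) (tm (n + k) e + 1)
       (\<lambda>N R. N 1 = 1 \<and> ?L (Suc j) (N(rX 0 := Suc (N (rX 0)))) R)"
    proof (rule exq_seq[OF exec_compile[OF r wf, folded k_def]])
      fix N2 R2 assume f: "frame [True] 1 0 N1 R1 N2 R2 \<and> R2 (tb 0) = ev n as f A e (?ix j) ?vs"
      have x: "N2 (rX 0) = N1 (rX 0)" using frame_keep[OF conjunct1[OF f]] by simp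
      have keep: "N2 r = N1 r" if "r = 0 \<or> r = 1 \<or> r = 2 \<or> r = 3 \<or> r = 7 \<or> (\<exists>t. r = rT t) \<or> (\<exists>t. r = rV t)" for r
        using f that unfolding frame_def by (elim conjE allE[of _ r]) auto
      have S: "?S N2" using L by (simp add: keep)
      have R2: "R2 i = R1 i" if "i < n + k" for i using f that by (simp add: frame_def tb_def k_def)
      have R2v: "R2 (vb 0 + i) = R1 (vb 0 + i)" if "i < n" for i using f that by (simp add: frame_def)
      have T0: "N2 (rT 0) = tb 0" using S nt_pos[of e] by (simp add: Tm_def)
      show "exq n A (RMove (rX 0) (rT 0)) N2 R2 [] 1
         (\<lambda>N R. N 1 = 1 \<and> ?L (Suc j) (N(rX 0 := Suc (N (rX 0)))) R)"
        using S L x f j R2 R2v by (intro exq_RMove) (auto simp: less_Suc_eq T0 vb_def k_def)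
    qed (auto simp: Tm_def Am_def)
    then show "exq n A ?d N1 R1 (qs n as f e (?ix j) ?vs) (tm (n + k) e + 1)
       (\<lambda>N R. N 1 = 1 \<and> ?L (Suc j) (N(rX 0 := Suc (N (rX 0)))) R)" by simp
  qed simp
  have "exq n A (program k F e) N0 R0 ([] @ ([] @ concat (map (\<lambda>i. qs n as f e (?ix i) ?vs) [0..<n])))
     ((1 + (1 + (1 + (1 + (2 * n + (1 + (1 + ((3 * Tm + 1) + (Am + 1)))))))))
      + ((n * (2 + 2) + 2) + ((n + k) * (tm (n + k) e + 1 + 2) + 2))) (?L n)"
    unfolding program_def Let_def Tm_def[symmetric] Am_def[symmetric]
    apply (rule exq_seq[OF pro[simplified append_Nil]])
    apply (rule exq_seq[where Mid = "?P n"])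
    subgoal for N R
    proof -
      assume "?S N \<and> R = R0"
      moreover have q: "concat (map (\<lambda>_. []) [0..<n]) = ([] :: real list list)" by (simp add: concat_eq_Nil_conv)
      ultimately show ?thesis using cp[of N R, unfolded q] by blast
    qed
    by (rule main)
  then obtain t N' R' where t: "exec n A (program k F e) (N0, R0) t (concat (map (\<lambda>i. qs n as f e (?ix i) ?vs) [0..<n])) (N', R')"
    "t \<le> (1 + (1 + (1 + (1 + (2 * n + (1 + (1 + ((3 * Tm + 1) + (Am + 1)))))))))
      + ((n * (2 + 2) + 2) + ((n + k) * (tm (n + k) e + 1 + 2) + 2))" "?L n N' R'"
    unfolding exq_def by auto
  have "init_state n as v = (N0, R0)" by (simp add: init_state_def N0_def R0_def)
  moreover have "map (\<lambda>i. ev n as f A e (?ix i) ?vs) [0..<n] = read_block n R' 0"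
    using t(3) by (simp add: read_block_def)
  moreover have "t \<le> (n + k) * (tm (n + k) e + 10 + 5 * nt e + nv e) + 5 * nt e + nv e + 20"
    using t(2) by (simp add: Tm_def Am_def algebra_simps)
  ultimately show ?thesis using t(1) unfolding runs_def by metis
qed


section \<open>Choosing the best of the available queries\<close>

text \<open>\<open>Bl y r\<close> are the queries at distance \<open>r\<close>,
  \<open>Below y\<close> the admissible lowered versions of \<open>y\<close>, \<open>P y\<close> is
  the level and \<open>pk y\<close> the chosen distance and query. The numbers in \<open>th\<close>
  and \<open>Gam\<close> spell out \<open>xm\<close>, which can only be defined inside:
  \<open>th\<close> is \<open>1 - xm / 24\<close>, and \<open>Gam\<close> is at least
  \<open>4 / xm\<close>.\<close>

locale scheme =
  fixes n k D Gam :: nat and V :: "real set" and rk :: "real \<Rightarrow> nat"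
    and A :: "real list \<Rightarrow> real list" and c th :: real
    and Bl :: "real list \<Rightarrow> nat \<Rightarrow> real list set"
    and Below :: "real list \<Rightarrow> real list set"
    and P :: "real list \<Rightarrow> nat" and pk :: "real list \<Rightarrow> nat \<times> real list"
  assumes n: "1 \<le> n" and D: "1 \<le> D" and k: "1 \<le> k"
    and V: "finite V"
    and rk1: "t \<in> V \<Longrightarrow> 0 < t \<Longrightarrow> 1 \<le> rk t \<and> rk t \<le> k"
    and rk2: "s \<in> V \<Longrightarrow> t \<in> V \<Longrightarrow> 0 < s \<Longrightarrow> s < t \<Longrightarrow> rk s < rk t"
    and c: "0 < c" "c \<le> 1"
    and gap: "s \<in> V \<Longrightarrow> t \<in> V \<Longrightarrow> 0 < s \<Longrightarrow> s < t \<Longrightarrow> c * n * s \<le> t - s"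
    and A0: "u \<in> valuations n V \<Longrightarrow> i < n \<Longrightarrow> 0 \<le> A u ! i"
    and th: "th = 1 - c * (c / 64) ^ k / 8 / 24"
    and Gam: "4 \<le> real Gam * (c * (c / 64) ^ k / 8)"
begin

text \<open>The share demanded of the high ranks at level \<open>p\<close>. A raise at level
  \<open>p\<close> is analysed with \<open>x = c * kap p / 8\<close>; the factor
  \<open>c / 64\<close> makes the share at every higher level at most \<open>x / 8\<close>. The
  constant \<open>xm\<close> is the smallest \<open>x\<close> that occurs.\<close>

definition kap :: "nat \<Rightarrow> real" where "kap p = (c / 64) ^ p"
definition xm :: real where "xm = c * kap k / 8"
definition vals :: "real list set" where "vals = valuations n V"
text \<open>Lexicographic in rank and level: \<open>k - p\<close> is less than \<open>k + 1\<close>,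
  so one more rank outweighs every change of level. The unit is 3, the shift caused by one
  raise.\<close>

definition Rr :: "nat \<Rightarrow> nat \<Rightarrow> nat" where "Rr p t = D + 3 * ((k + 1) * t + (k - p))"
definition Rm :: nat where "Rm = D + 3 * ((k + 1) * k + k)"

text \<open>
  Beyond distance \<open>D\<close> the weight of an agent depends only on the rank of its value, and higher
  ranks see farther. The factor \<open>Gam\<close> per rank makes a raised agent outweigh all the others.
\<close>

definition phi :: "nat \<Rightarrow> nat \<Rightarrow> real \<Rightarrow> real" where
  "phi p r t = (if t \<le> 0 then 0 else if r \<le> D then th ^ r
     else if r \<le> Rr p (rk t) then th ^ D * real Gam ^ rk t else 0)"

definition sc :: "nat \<Rightarrow> nat \<Rightarrow> real list \<Rightarrow> real list \<Rightarrow> real" where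
  "sc p r y u = (\<Sum>l<n. phi p r (y ! l) * y ! l * A u ! l)"

definition opt :: "real list \<Rightarrow> (nat \<times> real list) set" where
  "opt y = {(r, u). r \<le> Rm \<and> u \<in> Bl y r}"

definition good :: "nat \<Rightarrow> nat \<Rightarrow> real list \<Rightarrow> real list \<Rightarrow> bool" where
  "good p r y u \<longleftrightarrow> kap p * sc p r y u \<le>
     (\<Sum>l<n. if p \<le> rk (y ! l) then phi p r (y ! l) * y ! l * A u ! l else 0)"

text \<open>Any reference option will do in place of the best one, since a larger reference score
  only weakens the condition. After a raise, the option that was kept for the raised agent serves as
  reference.\<close>

definition valid :: "nat \<Rightarrow> real list \<Rightarrow> bool" where
  "valid p z \<longleftrightarrow> (\<exists>(r0, u0)\<in>opt z. 0 < sc p r0 z u0 \<and>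
     (\<forall>(r, u)\<in>opt z. good p r z u \<or> sc p r z u < (1 - kap p) * sc p r0 z u0))"

text \<open>Agents whose raise leaves all options in place. The inclusion of \<open>Below\<close> is
  there to keep the level from falling.\<close>

definition E :: "real list \<Rightarrow> nat set" where
  "E y = {l. l < n \<and> (\<forall>b\<in>V. y ! l < b \<longrightarrow> Bl (y[l := b]) = Bl y \<and> Below y \<subseteq> Below (y[l := b]))}"

text \<open>
  Beyond distance \<open>D\<close> twice the weight is paid out; this compensates for the choices at raised
  vectors being optimal only up to a constant factor there.
\<close>

definition xi :: "real list \<Rightarrow> nat \<Rightarrow> real" where
  "xi y i = (if fst (pk y) \<le> D then 1 else 2) * phi (P y) (fst (pk y)) (y ! i) * A (snd (pk y)) ! i"

definition T :: "real list \<Rightarrow> nat \<Rightarrow> real" where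
  "T v i = Min ((\<lambda>b. xi (v[i := b]) i) ` {b \<in> V. v ! i \<le> b})"

lemma kap_pos: "0 < kap p" using c by (simp add: kap_def)
lemma kap_le1: "kap p \<le> 1" using c unfolding kap_def by (intro power_le_one) auto
lemma kap_anti: "p \<le> q \<Longrightarrow> kap q \<le> kap p"
  using c unfolding kap_def by (intro power_decreasing) auto
lemma kap_Suc: "kap (Suc p) = c * kap p / 64" by (simp add: kap_def)

lemma xm: "0 < xm" "xm \<le> 1 / 8"
  using kap_pos[of k] kap_le1[of k] c mult_mono[of c 1 "kap k" 1] by (auto simp: xm_def)

lemma th': "th = 1 - xm / 24" by (simp add: th xm_def kap_def)
lemma th01: "0 < th" "th < 1" using xm by (auto simp: th')

text \<open>Going to a raised vector costs the kept option a factor \<open>th ^ 3\<close> and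
  strengthens the bound for the other agents by \<open>1 / th ^ 3\<close>. Bernoulli bounds the
  joint loss by \<open>x / 4\<close>, so a growth by \<open>1 + x\<close> still leaves
  \<open>1 + x / 2\<close>.\<close>

lemma th6: assumes "xm \<le> x" "x \<le> 1" shows "1 + x / 2 \<le> th ^ 6 * (1 + x)"
proof -
  have "1 - 6 * (xm / 24) \<le> (1 - xm / 24) ^ 6"
    using Bernoulli_inequality[of "- (xm / 24)" 6] xm by simp
  then have "1 - x / 4 \<le> th ^ 6" using assms by (simp add: th')
  then have "(1 - x / 4) * (1 + x) \<le> th ^ 6 * (1 + x)" using assms xm by (intro mult_right_mono) auto
  moreover {
  have "x * x \<le> x * 1" using assms xm by (intro mult_left_mono) auto
  moreover have "(1 - x / 4) * (1 + x) = 1 + 3 * x / 4 - x * x / 4" by (simp add: field_simps)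
  ultimately have "1 + x / 2 \<le> (1 - x / 4) * (1 + x)" by linarith }
  ultimately show ?thesis by linarith
qed

lemma th3: "1 / 2 \<le> th ^ 3"
  using Bernoulli_inequality[of "- (xm / 24)" 3] xm by (simp add: th')

lemma Gam': "4 \<le> real Gam * xm" using Gam by (simp add: xm_def kap_def)
lemma Gam4: "4 \<le> real Gam"
proof -
  have "real Gam * xm \<le> real Gam * 1" using xm by (intro mult_left_mono) auto
  then show ?thesis using Gam' by linarith
qed

lemma phi_nonneg: "0 \<le> phi p r t" using th01 by (simp add: phi_def)

lemma phi_mono: assumes "s \<in> V" "t \<in> V" "s \<le> t" shows "phi p r s \<le> phi p r t"
proof (cases "s = t \<or> s \<le> 0")
  case True
  moreover have "phi p r s = 0" if "s \<le> 0" using that by (simp add: phi_def)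
  ultimately show ?thesis using phi_nonneg[of p r t] by auto
next
  case False
  then have rk: "rk s < rk t" using rk2 assms by auto
  then have "real Gam ^ rk s \<le> real Gam ^ rk t" using Gam4 by (intro power_increasing) auto
  moreover have "Rr p (rk s) \<le> Rr p (rk t)" unfolding Rr_def using rk by (intro add_mono mult_mono) auto
  ultimately show ?thesis using False assms th01 by (auto simp: phi_def intro: mult_left_mono)
qed

lemma val_nth: "y \<in> vals \<Longrightarrow> l < n \<Longrightarrow> y ! l \<in> V"
  by (auto simp: vals_def valuations_def)
lemma val_upd: "y \<in> vals \<Longrightarrow> b \<in> V \<Longrightarrow> y[l := b] \<in> vals"
  by (auto simp: vals_def valuations_def dest: set_update_subset_insert[THEN subsetD])
lemma val_len: "y \<in> vals \<Longrightarrow> length y = n"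
  by (auto simp: vals_def valuations_def)

lemma term_nonneg: "u \<in> vals \<Longrightarrow> l < n \<Longrightarrow> 0 \<le> phi p r t * t * A u ! l"
  using phi_nonneg[of p r t] A0[of u l] by (cases "t \<le> 0") (auto simp: phi_def vals_def)

lemma sc_nonneg: "u \<in> vals \<Longrightarrow> 0 \<le> sc p r y u"
  unfolding sc_def using term_nonneg by (intro sum_nonneg) auto

lemma term_le_sc: "u \<in> vals \<Longrightarrow> l < n \<Longrightarrow> phi p r (y ! l) * y ! l * A u ! l \<le> sc p r y u"
  unfolding sc_def using term_nonneg by (intro member_le_sum) auto

lemma sc_upd: "length y = n \<Longrightarrow> j < n \<Longrightarrow> sc p r (y[j := b]) u =
    phi p r b * b * A u ! j + (\<Sum>l\<in>{..<n} - {j}. phi p r (y ! l) * y ! l * A u ! l)"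
  unfolding sc_def by (subst sum.remove[of _ j]) (auto intro!: sum.cong)

lemma sc_split: "j < n \<Longrightarrow> sc p r y u =
    phi p r (y ! j) * y ! j * A u ! j + (\<Sum>l\<in>{..<n} - {j}. phi p r (y ! l) * y ! l * A u ! l)"
  unfolding sc_def by (subst sum.remove[of _ j]) auto

text \<open>
  When \<open>y'\<close> arises from \<open>y\<close> by raising agent \<open>j\<close>, \<open>nested\<close> bounds what the other agents can
  contribute at \<open>y'\<close>, and \<open>visible\<close> keeps the option that was good for \<open>j\<close> at \<open>y\<close> available.
\<close>

definition nested :: "nat \<Rightarrow> real list \<Rightarrow> nat \<Rightarrow> real list \<Rightarrow> bool" where
  "nested p y p' y' \<longleftrightarrow> (\<forall>(r', u)\<in>opt y'. (\<forall>t\<in>V. phi p' r' t = 0) \<or>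
     (\<exists>r. (r, u) \<in> opt y \<and> (\<forall>t\<in>V. phi p' r' t \<le> phi p r t / th ^ 3)))"

definition visible :: "nat \<Rightarrow> real list \<Rightarrow> real \<Rightarrow> nat \<Rightarrow> real list \<Rightarrow> real \<Rightarrow> bool" where
  "visible p y q p' y' b \<longleftrightarrow> (\<forall>(r, u)\<in>opt y. 0 < phi p r q \<longrightarrow>
     (\<exists>r'. (r', u) \<in> opt y' \<and> th ^ 3 * phi p r q \<le> phi p' r' b \<and>
       ((\<forall>t\<in>V. th ^ 3 * phi p r t \<le> phi p' r' t) \<or> Gam * phi p r q \<le> phi p' r' b)))"

text \<open>The threshold \<open>x / c * m / n\<close> is chosen so that the gap
  \<open>c * n * (y ! j) \<le> b - y ! j\<close> turns the raise into a growth of at least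
  \<open>x * m\<close>. The others together supply at most \<open>m / th ^ 3\<close> at
  \<open>y'\<close>, so whatever scores close to the kept option has to draw on
  \<open>j\<close>.\<close>

lemma honor:
  assumes y: "y \<in> vals" and j: "j < n" and b: "b \<in> V" "0 < y ! j" "y ! j < b"
    and y': "y' = y[j := b]"
    and nested: "nested p y p' y'" and visible: "visible p y (y ! j) p' y' b"
    and ops: "\<And>r u. (r, u) \<in> opt y \<union> opt y' \<Longrightarrow> u \<in> vals"
    and o: "(r, u) \<in> opt y" and m: "m = sc p r y u" "0 < m" "\<And>r u. (r, u) \<in> opt y \<Longrightarrow> sc p r y u \<le> m"
    and x: "xm \<le> x" "x \<le> 1" and share: "x / c * m / n \<le> phi p r (y ! j) * y ! j * A u ! j"
  shows "\<exists>r1. (r1, u) \<in> opt y' \<and> (1 + x / 2) * m / th ^ 3 \<le> sc p' r1 y' u \<and>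
      th ^ 3 * phi p r (y ! j) * b * A u ! j \<le> sc p' r1 y' u"
    and "\<And>r' u'. (r', u') \<in> opt y' \<Longrightarrow> sc p' r' y' u' \<le> m / th ^ 3 + phi p' r' b * b * A u' ! j"
proof -
  let ?q = "y ! j"
  have qV: "?q \<in> V" using val_nth y j by blast
  have uv: "u \<in> vals" using ops o by blast
  have A: "0 \<le> A u ! j" using A0 uv j by (simp add: vals_def)
  have np: "0 < real n" using n by simp
  have sh: "0 < x / c * m / n" using x xm(1) c m(2) np by simp
  then have pos: "0 < phi p r ?q * ?q * A u ! j" using share by linarith
  have ph: "0 < phi p r ?q" using pos phi_nonneg[of p r ?q] by (cases "phi p r ?q = 0") auto
  have g: "c * n * ?q \<le> b - ?q" using gap qV b by blast
  have growth: "x * m \<le> phi p r ?q * (b - ?q) * A u ! j"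
  proof -
    have "x * m = c * n * (x / c * m / n)" using c np by simp
    also have "\<dots> \<le> c * n * (phi p r ?q * ?q * A u ! j)" using share c np by (intro mult_left_mono) auto
    also have "\<dots> = phi p r ?q * A u ! j * (c * n * ?q)" by (simp add: ac_simps)
    also have "\<dots> \<le> phi p r ?q * A u ! j * (b - ?q)" using g A ph by (intro mult_left_mono) auto
    finally show ?thesis by (simp add: ac_simps)
  qed
  obtain r1 where r1: "(r1, u) \<in> opt y'" "th ^ 3 * phi p r ?q \<le> phi p' r1 b"
      "(\<forall>t\<in>V. th ^ 3 * phi p r t \<le> phi p' r1 t) \<or> Gam * phi p r ?q \<le> phi p' r1 b"
    using visible o ph unfolding visible_def by fastforce
  have b0: "0 < b" using b by linarith
  have sc1: "sc p' r1 y' u = phi p' r1 b * b * A u ! j + (\<Sum>l\<in>{..<n} - {j}. phi p' r1 (y ! l) * y ! l * A u ! l)"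
    unfolding y' using sc_upd val_len y j by blast
  have rest: "0 \<le> (\<Sum>l\<in>{..<n} - {j}. phi p' r1 (y ! l) * y ! l * A u ! l)"
    using term_nonneg uv by (intro sum_nonneg) auto
  have "th ^ 3 * phi p r ?q * b * A u ! j \<le> phi p' r1 b * b * A u ! j"
    using r1(2) b0 A by (intro mult_right_mono) auto
  then have s2: "th ^ 3 * phi p r ?q * b * A u ! j \<le> sc p' r1 y' u" using sc1 rest by linarith
  have s1: "(1 + x / 2) * m / th ^ 3 \<le> sc p' r1 y' u"
    using r1(3)
  proof
    assume core: "\<forall>t\<in>V. th ^ 3 * phi p r t \<le> phi p' r1 t"
    have "(\<Sum>l\<in>{..<n} - {j}. th ^ 3 * (phi p r (y ! l) * y ! l * A u ! l)) \<le>
       (\<Sum>l\<in>{..<n} - {j}. phi p' r1 (y ! l) * y ! l * A u ! l)"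
    proof (rule sum_mono)
      fix l assume l: "l \<in> {..<n} - {j}"
      show "th ^ 3 * (phi p r (y ! l) * y ! l * A u ! l) \<le> phi p' r1 (y ! l) * y ! l * A u ! l"
      proof (cases "y ! l \<le> 0")
        case True then show ?thesis by (simp add: phi_def)
      next
        case False
        have "th ^ 3 * phi p r (y ! l) * (y ! l * A u ! l) \<le> phi p' r1 (y ! l) * (y ! l * A u ! l)"
          using core val_nth[OF y, of l] l False A0[of u l] uv
          by (intro mult_right_mono) (auto simp: vals_def)
        then show ?thesis by (simp add: mult.assoc)
      qed
    qed
    then have "th ^ 3 * (\<Sum>l\<in>{..<n} - {j}. phi p r (y ! l) * y ! l * A u ! l) + th ^ 3 * phi p r ?q * b * A u ! j
        \<le> sc p' r1 y' u"
      using sc1 \<open>th ^ 3 * phi p r ?q * b * A u ! j \<le> phi p' r1 b * b * A u ! j\<close> by (simp add: sum_distrib_left)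
    moreover have "th ^ 3 * (\<Sum>l\<in>{..<n} - {j}. phi p r (y ! l) * y ! l * A u ! l) + th ^ 3 * phi p r ?q * b * A u ! j
        = th ^ 3 * (m + phi p r ?q * (b - ?q) * A u ! j)"
      unfolding m(1) sc_split[OF j] by (simp add: algebra_simps)
    ultimately have "th ^ 3 * (m + phi p r ?q * (b - ?q) * A u ! j) \<le> sc p' r1 y' u" by simp
    moreover have "th ^ 3 * (m + x * m) \<le> th ^ 3 * (m + phi p r ?q * (b - ?q) * A u ! j)"
      using growth th01 by (intro mult_left_mono) auto
    moreover have "(1 + x / 2) * m / th ^ 3 \<le> th ^ 3 * (m + x * m)"
    proof -
      have "(1 + x / 2) * m \<le> th ^ 6 * (1 + x) * m" using th6[OF x] m(2) by (intro mult_right_mono) auto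
      also have "\<dots> = th ^ 3 * (m + x * m) * th ^ 3" by (simp add: algebra_simps power_def numeral_eq_Suc)
      finally show ?thesis using th01 by (simp add: divide_le_eq)
    qed
    ultimately show ?thesis by linarith
  next
    \<comment> \<open>Here nothing is known about the weights of the other agents at
      \<open>r1\<close>. One factor \<open>Gam\<close> on the growth of \<open>j\<close> alone
      already gives \<open>4 * m\<close>, and \<open>th ^ 3 \<ge> 1 / 2\<close> makes that
      enough.\<close>
    assume far: "real Gam * phi p r ?q \<le> phi p' r1 b"
    have "real Gam * (x * m) \<le> real Gam * (phi p r ?q * (b - ?q) * A u ! j)"
      using growth by (intro mult_left_mono) auto
    also have "\<dots> \<le> real Gam * (phi p r ?q * b * A u ! j)"
      using ph A b by (intro mult_left_mono mult_right_mono) auto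
    also have "\<dots> = real Gam * phi p r ?q * (b * A u ! j)" by (simp add: ac_simps)
    also have "\<dots> \<le> phi p' r1 b * (b * A u ! j)" using far b0 A by (intro mult_right_mono) auto
    also have "\<dots> \<le> sc p' r1 y' u" using sc1 rest by (simp add: mult.assoc)
    finally have "real Gam * (x * m) \<le> sc p' r1 y' u" .
    moreover have "4 * m \<le> real Gam * (x * m)"
    proof -
      have "4 * m \<le> real Gam * xm * m" using Gam' m(2) by (intro mult_right_mono) auto
      also have "\<dots> \<le> real Gam * x * m" using x m(2) by (intro mult_right_mono mult_left_mono) auto
      finally show ?thesis by (simp add: mult.assoc)
    qed
    moreover have "(1 + x / 2) * m / th ^ 3 \<le> 4 * m"
    proof -
      have "(1 + x / 2) * m \<le> 2 * m" using x m(2) by (intro mult_right_mono) auto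
      also have "\<dots> = 4 * m * (1 / 2)" by simp
      also have "\<dots> \<le> 4 * m * th ^ 3" using th3 m(2) by (intro mult_left_mono) auto
      finally show ?thesis using th01 by (simp add: divide_le_eq)
    qed
    ultimately show ?thesis by linarith
  qed
  show "\<exists>r1. (r1, u) \<in> opt y' \<and> (1 + x / 2) * m / th ^ 3 \<le> sc p' r1 y' u \<and>
      th ^ 3 * phi p r (y ! j) * b * A u ! j \<le> sc p' r1 y' u"
    using r1(1) s1 s2 by blast
  fix r' u' assume o': "(r', u') \<in> opt y'"
  have uv': "u' \<in> vals" using ops o' by blast
  have sc': "sc p' r' y' u' = phi p' r' b * b * A u' ! j + (\<Sum>l\<in>{..<n} - {j}. phi p' r' (y ! l) * y ! l * A u' ! l)"
    unfolding y' using sc_upd val_len y j by blast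
  have "(\<Sum>l\<in>{..<n} - {j}. phi p' r' (y ! l) * y ! l * A u' ! l) \<le> m / th ^ 3"
  proof (cases "\<forall>t\<in>V. phi p' r' t = 0")
    case True
    then have "(\<Sum>l\<in>{..<n} - {j}. phi p' r' (y ! l) * y ! l * A u' ! l) = 0"
      using val_nth[OF y] by (intro sum.neutral) auto
    then show ?thesis using m(2) th01 by simp
  next
    case False
    then obtain r2 where r2: "(r2, u') \<in> opt y" "\<forall>t\<in>V. phi p' r' t \<le> phi p r2 t / th ^ 3"
      using nested o' unfolding nested_def by fastforce
    have "(\<Sum>l\<in>{..<n} - {j}. phi p' r' (y ! l) * y ! l * A u' ! l) \<le>
       (\<Sum>l\<in>{..<n} - {j}. phi p r2 (y ! l) * y ! l * A u' ! l / th ^ 3)"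
    proof (rule sum_mono)
      fix l assume l: "l \<in> {..<n} - {j}"
      show "phi p' r' (y ! l) * y ! l * A u' ! l \<le> phi p r2 (y ! l) * y ! l * A u' ! l / th ^ 3"
      proof (cases "y ! l \<le> 0")
        case True then show ?thesis by (simp add: phi_def)
      next
        case F: False
        have "phi p' r' (y ! l) * (y ! l * A u' ! l) \<le> phi p r2 (y ! l) / th ^ 3 * (y ! l * A u' ! l)"
          using r2 val_nth[OF y, of l] l F A0[of u' l] uv'
          by (intro mult_right_mono) (auto simp: vals_def)
        then show ?thesis by (simp add: mult.assoc)
      qed
    qed
    also have "\<dots> = (\<Sum>l\<in>{..<n} - {j}. phi p r2 (y ! l) * y ! l * A u' ! l) / th ^ 3"
      by (simp add: sum_divide_distrib)
    also have "\<dots> \<le> sc p r2 y u' / th ^ 3"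
      unfolding sc_split[OF j, of p r2 y u'] using th01 term_nonneg[OF uv' j, of p r2 "y ! j"]
      by (intro divide_right_mono) auto
    also have "\<dots> \<le> m / th ^ 3" using m(3)[OF r2(1)] th01 by (intro divide_right_mono) auto
    finally show ?thesis .
  qed
  then show "sc p' r' y' u' \<le> m / th ^ 3 + phi p' r' b * b * A u' ! j" unfolding sc' by linarith
qed

end


section \<open>Optimal choices and the level\<close>

locale choice = scheme +
  assumes Bl_vals: "Bl y r \<subseteq> valuations n V"
    and own: "y \<in> valuations n V \<Longrightarrow> y \<in> Bl y 1"
    and Bl_step: "y \<in> valuations n V \<Longrightarrow> j < n \<Longrightarrow> b \<in> V \<Longrightarrow> y ! j < b \<Longrightarrow>
      Bl (y[j := b]) r \<subseteq> Bl y (r + 3) \<and> Bl y r \<subseteq> Bl (y[j := b]) (r + 3)"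
    and Below_self: "y \<in> valuations n V \<Longrightarrow> y \<in> Below y"
    and Below: "y \<in> valuations n V \<Longrightarrow> z \<in> Below y \<Longrightarrow> z \<in> valuations n V \<and> Bl z = Bl y \<and>
      (\<forall>l<n. z ! l \<le> y ! l \<and> (z ! l \<noteq> y ! l \<longrightarrow> l \<in> E y))"
    and P1: "1 \<le> P y" "P y \<le> k"
    and P_ge: "y \<in> valuations n V \<Longrightarrow> 1 \<le> p \<Longrightarrow> p \<le> k \<Longrightarrow> z \<in> Below y \<Longrightarrow> valid p z \<Longrightarrow> p \<le> P y"
    and P_valid: "y \<in> valuations n V \<Longrightarrow> P y \<noteq> 1 \<Longrightarrow> \<exists>z\<in>Below y. valid (P y) z"
    and pk: "y \<in> valuations n V \<Longrightarrow> pk y \<in> opt y"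
    and pk_max: "y \<in> valuations n V \<Longrightarrow> (r, u) \<in> opt y \<Longrightarrow>
      sc (P y) r y u \<le> sc (P y) (fst (pk y)) y (snd (pk y))"
begin

lemma opt_vals: "(r, u) \<in> opt y \<Longrightarrow> u \<in> vals"
  using Bl_vals by (auto simp: opt_def vals_def)

lemma Rr_Rm: "t \<le> k \<Longrightarrow> Rr p t \<le> Rm"
  unfolding Rr_def Rm_def by (intro add_mono mult_mono) auto

lemma D_Rr: "1 \<le> t \<Longrightarrow> D + 3 \<le> Rr p t"
proof -
  assume "1 \<le> t"
  then have "1 * 1 \<le> (k + 1) * t" by (intro mult_mono) auto
  then show ?thesis unfolding Rr_def by simp
qed

text \<open>An option at the raised vector is an option at \<open>y\<close> three steps further out.
  Up to \<open>D\<close> the discount \<open>th ^ 3\<close> pays for these steps, and crossing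
  \<open>D\<close> does no harm because the factor \<open>Gam ^ rk s\<close> is at least 1. Beyond
  \<open>D\<close> the higher level has a cutoff shorter by at least three.\<close>

lemma nested_step:
  assumes y: "y \<in> vals" "j < n" "b \<in> V" "y ! j < b" and p: "p < p'" "p' \<le> k"
  shows "nested p y p' (y[j := b])"
  unfolding nested_def
proof (clarify)
  fix r' u assume o: "(r', u) \<in> opt (y[j := b])" and nz: "\<not> (\<exists>r. (r, u) \<in> opt y \<and> (\<forall>t\<in>V. phi p' r' t \<le> phi p r t / th ^ 3))"
  fix t assume t: "t \<in> V"
  have u: "u \<in> Bl y (r' + 3)" using o Bl_step[of y j b r'] y unfolding opt_def vals_def by blast
  have le: "phi p' r' s \<le> phi p (r' + 3) s / th ^ 3" if s: "s \<in> V" for s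
  proof (cases "s \<le> 0 \<or> phi p' r' s = 0")
    case True
    then have "phi p' r' s = 0" by (auto simp: phi_def)
    then show ?thesis using phi_nonneg[of p "r' + 3" s] th01 by simp
  next
    case False
    then have s0: "0 < s" and rs: "1 \<le> rk s" "rk s \<le> k" using rk1 s by auto
    show ?thesis
    proof (cases "r' \<le> D")
      case core: True
      have lo: "th ^ (r' + 3) \<le> phi p (r' + 3) s"
      proof (cases "r' + 3 \<le> D")
        case True then show ?thesis using s0 by (simp add: phi_def)
      next
        case False
        have "th ^ (r' + 3) \<le> th ^ D * 1" using False th01 by (simp add: power_decreasing)
        also have "\<dots> \<le> th ^ D * real Gam ^ rk s" using Gam4 th01 by (intro mult_left_mono) auto
        finally show ?thesis using False s0 core D_Rr[OF rs(1), of p] by (simp add: phi_def)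
      qed
      have "phi p' r' s = th ^ (r' + 3) / th ^ 3" using core s0 th01 by (simp add: phi_def power_add)
      also have "\<dots> \<le> phi p (r' + 3) s / th ^ 3" using lo th01 by (intro divide_right_mono) auto
      finally show ?thesis .
    next
      case far: False
      then have r': "r' \<le> Rr p' (rk s)" using False by (simp add: phi_def split: if_splits)
      have "Rr p' (rk s) + 3 \<le> Rr p (rk s)" using p by (simp add: Rr_def)
      then have "phi p (r' + 3) s = phi p' r' s" using far r' s0 by (simp add: phi_def)
      moreover have "phi p' r' s * th ^ 3 \<le> phi p' r' s * 1"
        using th01 phi_nonneg[of p' r' s] by (intro mult_left_mono) (auto intro: power_le_one)
      ultimately have "phi p' r' s * th ^ 3 \<le> phi p (r' + 3) s" by linarith
      then show ?thesis unfolding pos_le_divide_eq[OF zero_less_power[OF th01(1)]] .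
    qed
  qed
  show "phi p' r' t = 0"
  proof (rule ccontr)
    assume t': "phi p' r' t \<noteq> 0"
    then have t0: "0 < t" by (auto simp: phi_def split: if_splits)
    then have "rk t \<le> k" "1 \<le> rk t" using rk1 t by auto
    then have "r' + 3 \<le> Rm"
      using t' t0 D_Rr[of "rk t" p] Rr_Rm[of "rk t" p] p by (auto simp: phi_def Rr_def split: if_splits)
    then show False using nz u le by (auto simp: opt_def)
  qed
qed

text \<open>The level may move either way here. Beyond \<open>D\<close> the higher rank of
  \<open>b\<close> extends the cutoff by enough to cover both the change of level and the shift by
  three, and it brings the factor \<open>Gam\<close>. Up to \<open>D\<close> the option is kept
  three steps further out with at least \<open>th ^ 3\<close> of all its weights.\<close>

lemma visible_step:
  assumes y: "y \<in> vals" "j < n" "b \<in> V" "0 < y ! j" "y ! j < b" and p: "1 \<le> p" "p \<le> k" "1 \<le> p'" "p' \<le> k"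
  shows "visible p y (y ! j) p' (y[j := b]) b"
  unfolding visible_def
proof (clarify)
  fix r u assume o: "(r, u) \<in> opt y" and ph: "0 < phi p r (y ! j)"
  let ?q = "y ! j"
  have u: "u \<in> Bl (y[j := b]) (r + 3)" using o Bl_step[of y j b r] y unfolding opt_def vals_def by blast
  have qb: "1 \<le> rk ?q" "rk ?q < rk b" "rk b \<le> k" "0 < b"
    using rk1 rk2 val_nth[OF y(1,2)] y by auto
  have "(k + 1) * Suc (rk ?q) \<le> (k + 1) * rk b" using qb by (intro mult_left_mono) auto
  then have R: "Rr p (rk ?q) + 3 \<le> Rr p' (rk b)"
    using p by (simp add: Rr_def)
  show "\<exists>r'. (r', u) \<in> opt (y[j := b]) \<and> th ^ 3 * phi p r ?q \<le> phi p' r' b \<and>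
      ((\<forall>t\<in>V. th ^ 3 * phi p r t \<le> phi p' r' t) \<or> real Gam * phi p r ?q \<le> phi p' r' b)"
  proof (cases "r \<le> D")
    case core: True
    have le: "th ^ 3 * phi p r t \<le> phi p' (r + 3) t" if t: "t \<in> V" for t
    proof (cases "t \<le> 0")
      case True then show ?thesis by (simp add: phi_def)
    next
      case False
      then have "1 \<le> rk t" using rk1 t by auto
      note DR = D_Rr[OF this, of p']
      show ?thesis
      proof (cases "r + 3 \<le> D")
        case True then show ?thesis using False by (simp add: phi_def power_add)
      next
        case F: False
        have "th ^ 3 * th ^ r \<le> th ^ D * 1" using F th01 by (simp add: power_decreasing power_add[symmetric])
        also have "\<dots> \<le> th ^ D * real Gam ^ rk t" using Gam4 th01 by (intro mult_left_mono) auto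
        finally show ?thesis using False F core DR by (simp add: phi_def)
      qed
    qed
    have qV: "?q \<in> V" using val_nth y by blast
    have "phi p' (r + 3) ?q \<le> phi p' (r + 3) b" using phi_mono qV y by auto
    then have "th ^ 3 * phi p r ?q \<le> phi p' (r + 3) b" using le[OF qV] by linarith
    moreover have "r + 3 \<le> Rm" using core D_Rr[of 1 p] Rr_Rm[of 1 p] k by simp
    ultimately show ?thesis using u le by (intro exI[of _ "r + 3"]) (auto simp: opt_def)
  next
    case far: False
    then have r: "r \<le> Rr p (rk ?q)" using ph y by (simp add: phi_def split: if_splits)
    have e: "phi p r ?q = th ^ D * real Gam ^ rk ?q" "phi p' (r + 3) b = th ^ D * real Gam ^ rk b"
      using far r R y qb by (auto simp: phi_def)
    have "real Gam ^ Suc (rk ?q) \<le> real Gam ^ rk b" using qb Gam4 by (intro power_increasing) auto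
    then have G: "real Gam * phi p r ?q \<le> phi p' (r + 3) b"
      unfolding e using th01 by (simp add: mult.left_commute)
    have "th ^ 3 * phi p r ?q \<le> 1 * phi p r ?q" using th01 ph by (intro mult_right_mono power_le_one) auto
    also have "\<dots> \<le> real Gam * phi p r ?q" using Gam4 ph by (intro mult_right_mono) auto
    finally have "th ^ 3 * phi p r ?q \<le> phi p' (r + 3) b" using G by linarith
    moreover have "r + 3 \<le> Rm" using r R Rr_Rm[OF qb(3), of p'] by simp
    ultimately show ?thesis using u G by (intro exI[of _ "r + 3"]) (auto simp: opt_def)
  qed
qed

lemma phi_same: "p \<le> p' \<Longrightarrow> phi p' r t \<le> phi p r t"
  using th01 Gam4 by (auto simp: phi_def Rr_def)

lemma opt_same: "Bl y' = Bl y \<Longrightarrow> opt y' = opt y"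
  by (simp add: opt_def)

text \<open>With equal balls each option is its own counterpart, so it suffices that the level does
  not fall.\<close>

lemma nested_same:
  assumes "Bl y' = Bl y" "p \<le> p'" shows "nested p y p' y'"
  unfolding nested_def opt_same[OF assms(1)]
proof (clarify)
  fix r u assume o: "(r, u) \<in> opt y" and nz: "\<not> (\<exists>r'. (r', u) \<in> opt y \<and> (\<forall>t\<in>V. phi p' r t \<le> phi p r' t / th ^ 3))"
  have "phi p' r t \<le> phi p r t / th ^ 3" for t
  proof -
    have "phi p r t * th ^ 3 \<le> phi p r t * 1"
      using th01 phi_nonneg[of p r t] by (intro mult_left_mono) (auto intro: power_le_one)
    then have "phi p r t \<le> phi p r t / th ^ 3" using th01 by (simp add: le_divide_eq)
    then show ?thesis using phi_same[OF assms(2), of r t] by linarith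
  qed
  then show "phi p' r t = 0" if "t \<in> V" for t using nz o by blast
qed

lemma visible_same:
  assumes "Bl y' = Bl y" "q \<in> V" "b \<in> V" "0 < q" "q < b" "1 \<le> p" "p \<le> k" "1 \<le> p'" "p' \<le> k"
  shows "visible p y q p' y' b"
  unfolding visible_def opt_same[OF assms(1)]
proof (clarify)
  fix r u assume o: "(r, u) \<in> opt y" and ph: "0 < phi p r q"
  have qb: "1 \<le> rk q" "rk q < rk b" "rk b \<le> k" "0 < b" using rk1 rk2 assms by auto
  have t3: "th ^ 3 * x \<le> x" if "0 \<le> x" for x :: real
    using mult_right_mono[OF power_le_one[of th 3], of x] th01 that by simp
  show "\<exists>r'. (r', u) \<in> opt y \<and> th ^ 3 * phi p r q \<le> phi p' r' b \<and>
      ((\<forall>t\<in>V. th ^ 3 * phi p r t \<le> phi p' r' t) \<or> real Gam * phi p r q \<le> phi p' r' b)"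
  proof (cases "r \<le> D")
    case True
    then have "phi p' r t = phi p r t" for t by (simp add: phi_def)
    moreover have "th ^ 3 * phi p r q \<le> phi p r b"
      using t3[OF phi_nonneg, of p r q] phi_mono[OF assms(2,3), of p r] assms(5) by linarith
    ultimately show ?thesis using o t3[OF phi_nonneg]
      by (intro exI[of _ r]) auto
  next
    case far: False
    have "(k + 1) * Suc (rk q) \<le> (k + 1) * rk b" using qb by (intro mult_left_mono) auto
    then have R: "Rr p (rk q) \<le> Rr p' (rk b)" using assms by (simp add: Rr_def)
    have r: "r \<le> Rr p (rk q)" using far ph assms by (simp add: phi_def split: if_splits)
    have e: "phi p r q = th ^ D * real Gam ^ rk q" "phi p' r b = th ^ D * real Gam ^ rk b"
      using far r R assms qb by (auto simp: phi_def)
    have "real Gam ^ Suc (rk q) \<le> real Gam ^ rk b" using qb Gam4 by (intro power_increasing) auto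
    then have G: "real Gam * phi p r q \<le> phi p' r b"
      unfolding e using th01 by (simp add: mult.left_commute)
    moreover have "1 * phi p r q \<le> real Gam * phi p r q" using Gam4 ph by (intro mult_right_mono) auto
    moreover have "th ^ 3 * phi p r q \<le> phi p r q" using t3 ph by simp
    ultimately have "th ^ 3 * phi p r q \<le> phi p' r b" by linarith
    then show ?thesis using o G by blast
  qed
qed


text \<open>A witness for the level of \<open>y\<close> remains one for \<open>y'\<close>; admitting
  witnesses in \<open>Below\<close> serves this purpose.\<close>

lemma P_same:
  assumes y: "y \<in> vals" "y' \<in> vals" and sub: "Below y \<subseteq> Below y'"
  shows "P y \<le> P y'"
proof (cases "P y = 1")
  case True then show ?thesis using P1 by simp
next
  case False
  then obtain z where "z \<in> Below y" "valid (P y) z" using P_valid y by (auto simp: vals_def)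
  then show ?thesis using P_ge[of y' "P y" z] y sub P1 by (auto simp: vals_def)
qed

lemma pk_opt: "y \<in> vals \<Longrightarrow> (fst (pk y), snd (pk y)) \<in> opt y"
  using pk by (simp add: vals_def)

lemma phi_le_xi: "i < n \<Longrightarrow> y \<in> vals \<Longrightarrow> phi (P y) (fst (pk y)) (y ! i) * A (snd (pk y)) ! i \<le> xi y i"
proof -
  assume a: "i < n" "y \<in> vals"
  have "0 \<le> phi (P y) (fst (pk y)) (y ! i) * A (snd (pk y)) ! i"
    using A0[of "snd (pk y)" i] opt_vals[OF pk_opt[OF a(2)]] phi_nonneg a by (auto simp: vals_def)
  then have "1 * (phi (P y) (fst (pk y)) (y ! i) * A (snd (pk y)) ! i) \<le>
      (if fst (pk y) \<le> D then 1 else 2) * (phi (P y) (fst (pk y)) (y ! i) * A (snd (pk y)) ! i)"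
    by (intro mult_right_mono) auto
  then show ?thesis by (simp only: xi_def mult.assoc mult_1_left)
qed

lemma xi_nonneg: "y \<in> vals \<Longrightarrow> i < n \<Longrightarrow> 0 \<le> xi y i"
  using A0[of "snd (pk y)" i] opt_vals[OF pk_opt] phi_nonneg by (auto simp: vals_def xi_def)

lemma T_ge:
  assumes "y \<in> vals" "i < n" "\<And>b. b \<in> V \<Longrightarrow> y ! i \<le> b \<Longrightarrow> s \<le> xi (y[i := b]) i"
  shows "s \<le> T y i"
proof -
  have "y ! i \<in> V" using val_nth assms by blast
  then show ?thesis unfolding T_def using V assms(3) by (subst Min_ge_iff) auto
qed

lemma T_nonneg: "y \<in> vals \<Longrightarrow> i < n \<Longrightarrow> 0 \<le> T y i"
  using val_upd xi_nonneg by (intro T_ge) auto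

text \<open>The pick at the raised vector exceeds what the others can supply by the factor
  \<open>1 + x / 2\<close>, hence at least the share \<open>x / 3\<close> of its score comes from
  \<open>j\<close>. That score is at least half of what the old amount is worth at the new value,
  which gives \<open>x / 6\<close>.\<close>

lemma honored_amount:
  assumes y: "y \<in> vals" and j: "j < n" and b: "b \<in> V" "0 < y ! j" "y ! j < b"
    and m: "m = sc (P y) (fst (pk y)) y (snd (pk y))" "0 < m"
    and x: "xm \<le> x" "x \<le> 1"
    and share: "x / c * m / n \<le> phi (P y) (fst (pk y)) (y ! j) * y ! j * A (snd (pk y)) ! j"
    and nested: "nested (P y) y (P (y[j := b])) (y[j := b])"
    and visible: "visible (P y) y (y ! j) (P (y[j := b])) (y[j := b]) b"
  shows "x / 6 * (phi (P y) (fst (pk y)) (y ! j) * A (snd (pk y)) ! j) \<le> xi (y[j := b]) j"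
proof -
  let ?y = "y[j := b]"
  have y'v: "?y \<in> vals" using val_upd y b by blast
  have yj: "?y ! j = b" using j val_len[OF y] by simp
  have max: "sc (P y) r y u \<le> m" if "(r, u) \<in> opt y" for r u
    using pk_max that y unfolding m vals_def by blast
  note h = honor[OF y j b refl nested visible _ pk_opt[OF y] m max x share]
  let ?s = "sc (P ?y) (fst (pk ?y)) ?y (snd (pk ?y))"
  let ?w = "phi (P ?y) (fst (pk ?y)) b * A (snd (pk ?y)) ! j"
  let ?v = "phi (P y) (fst (pk y)) (y ! j) * A (snd (pk y)) ! j"
  obtain r1 where r1: "(r1, snd (pk y)) \<in> opt ?y" "(1 + x / 2) * m / th ^ 3 \<le> sc (P ?y) r1 ?y (snd (pk y))"
      "th ^ 3 * phi (P y) (fst (pk y)) (y ! j) * b * A (snd (pk y)) ! j \<le> sc (P ?y) r1 ?y (snd (pk y))"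
    using h(1) opt_vals by blast
  have "sc (P ?y) r1 ?y (snd (pk y)) \<le> ?s" using pk_max r1(1) y'v by (simp add: vals_def)
  then have s: "(1 + x / 2) * (m / th ^ 3) \<le> ?s" "th ^ 3 * (b * ?v) \<le> ?s"
    using r1(2,3) by (simp_all add: ac_simps)
  have up: "?s \<le> m / th ^ 3 + b * ?w"
    using h(2)[OF _ _ pk_opt[OF y'v]] opt_vals by (auto simp: ac_simps)
  have v0: "0 \<le> ?v" using phi_nonneg A0[of "snd (pk y)" j] opt_vals[OF pk_opt[OF y]] j by (auto simp: vals_def)
  have x0: "0 < x" using x xm by linarith
  have "m / th ^ 3 \<le> ?s / (1 + x / 2)" 
    using s(1) x0 pos_le_divide_eq[of "1 + x / 2" "m / th ^ 3" ?s] by (simp add: mult.commute del: times_divide_eq_left times_divide_eq_right divide_divide_eq_left)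
  moreover have "?s * (x / 3) \<le> ?s - ?s / (1 + x / 2)"
  proof -
    have s0: "0 \<le> ?s" using sc_nonneg opt_vals[OF pk_opt[OF y'v]] by blast
    have "x / 3 \<le> 1 - 1 / (1 + x / 2)" using x0 x by (simp add: field_simps)
    then have "?s * (x / 3) \<le> ?s * (1 - 1 / (1 + x / 2))" using s0 by (intro mult_left_mono) auto
    then show ?thesis by (simp add: algebra_simps)
  qed
  ultimately have "?s * (x / 3) \<le> b * ?w" using up by linarith
  moreover have "b * (x / 6 * ?v) \<le> ?s * (x / 3)"
  proof -
    have "1 / 2 * (b * ?v) \<le> th ^ 3 * (b * ?v)" using th3 b v0 by (intro mult_right_mono) auto
    then have "1 / 2 * (b * ?v) \<le> ?s" using s(2) by linarith
    then have "1 / 2 * (b * ?v) * (x / 3) \<le> ?s * (x / 3)" using x0 by (intro mult_right_mono) auto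
    then show ?thesis by (simp add: ac_simps)
  qed
  ultimately have "b * (x / 6 * ?v) \<le> b * ?w" by linarith
  then have "x / 6 * ?v \<le> ?w" using b by simp
  then show ?thesis using phi_le_xi[OF j y'v] yj by simp
qed

lemma nested_raise:
  assumes y: "y \<in> vals" and j: "j < n" and b: "b \<in> V" "0 < y ! j" "y ! j < b"
    and cases: "j \<in> E y \<or> P y < P (y[j := b])"
  shows "nested (P y) y (P (y[j := b])) (y[j := b])"
    and "visible (P y) y (y ! j) (P (y[j := b])) (y[j := b]) b"
proof -
  have y': "y[j := b] \<in> vals" using val_upd y b by blast
  have e: "Bl (y[j := b]) = Bl y \<and> P y \<le> P (y[j := b])" if "j \<in> E y"
    using that b P_same[OF y y'] by (auto simp: E_def)
  show "nested (P y) y (P (y[j := b])) (y[j := b])"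
    using cases e nested_same nested_step[OF y j b(1,3)] P1 by blast
  show "visible (P y) y (y ! j) (P (y[j := b])) (y[j := b]) b"
    using cases e visible_same val_nth[OF y j] b visible_step[OF y j b] P1 by blast
qed

text \<open>Agents whose raise is under control carry a share \<open>kap / 4\<close> of the optimal
  score. Those among them with an individual share of order \<open>1 / n\<close> carry at least half
  of that, and each keeps a fraction \<open>x / 6\<close> under every raise.\<close>

theorem constant_fraction:
  assumes v: "v \<in> vals"
  shows "xm / 6 * (kap k / 16) * (\<Sum>i<n. if 0 < v ! i then v ! i * A v ! i else 0) \<le> (\<Sum>i<n. v ! i * T v i)"
proof -
  let ?p = "P v" and ?r = "fst (pk v)" and ?u = "snd (pk v)"
  define m where "m = sc ?p ?r v ?u"
  define s where "s l = phi ?p ?r (v ! l) * v ! l * A ?u ! l" for l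
  let ?W = "\<Sum>i<n. if 0 < v ! i then v ! i * A v ! i else 0"
  have uv: "?u \<in> vals" using opt_vals pk_opt v by blast
  have s0: "0 \<le> s l" if "l < n" for l using term_nonneg uv that by (simp add: s_def)
  have ms: "m = (\<Sum>l<n. s l)" by (simp add: m_def sc_def s_def)
  have max: "sc ?p r v u \<le> m" if "(r, u) \<in> opt v" for r u
    using pk_max that v unfolding m_def vals_def by blast
  have T0: "0 \<le> v ! i * T v i" if i: "i < n" for i
  proof (cases "v ! i \<le> 0")
    case True
    have "xi v i = 0" using True by (simp add: xi_def phi_def)
    then have t0: "T v i \<le> 0" unfolding T_def using V val_nth[OF v i] by (intro Min_le) (auto intro: image_eqI[of _ _ "v ! i"])
    then show ?thesis using True by (simp add: mult_nonpos_nonpos)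
  next
    case False
    have "0 \<le> T v i" using T_nonneg v i by blast
    then show ?thesis using False by simp
  qed
  have mW: "th * ?W \<le> m"
  proof -
    have "(1, v) \<in> opt v" using own v D by (auto simp: opt_def Rm_def vals_def)
    then have "sc ?p 1 v v \<le> m" by (rule max)
    moreover have "sc ?p 1 v v = th * ?W"
      unfolding sc_def sum_distrib_left using D by (intro sum.cong) (auto simp: phi_def)
    ultimately show ?thesis by simp
  qed
  have k0: "0 < kap ?p" "kap ?p \<le> 1" using kap_pos kap_le1 by auto
  show ?thesis
  proof (cases "0 < m")
    case False
    have "0 \<le> ?W" using A0[of v] v by (intro sum_nonneg) (auto simp: vals_def)
    then have "?W = 0" using mW False th01 by (smt (verit) mult_nonneg_nonneg mult_pos_pos)
    moreover have "0 \<le> (\<Sum>i<n. v ! i * T v i)" using T0 by (intro sum_nonneg) auto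
    ultimately show ?thesis by simp
  next
    case m: True
    have "\<exists>z\<in>Below v. valid ?p z"
    \<comment> \<open>Level 1 is a default and needs no witness by assumption. It is valid at
      \<open>v\<close> itself once the optimum is positive, since every positive value has rank at
      least 1.\<close>
    proof (cases "?p = 1")
      case True
      have good: "good 1 r v u" if "(r, u) \<in> opt v" for r u
      proof -
        have "(\<Sum>l<n. if 1 \<le> rk (v ! l) then phi 1 r (v ! l) * v ! l * A u ! l else 0) = sc 1 r v u"
          unfolding sc_def
        proof (rule sum.cong)
          fix l assume "l \<in> {..<n}"
          then have "v ! l \<in> V" using val_nth v by blast
          then show "(if 1 \<le> rk (v ! l) then phi 1 r (v ! l) * v ! l * A u ! l else 0) = phi 1 r (v ! l) * v ! l * A u ! l"
            using rk1[of "v ! l"] by (cases "0 < v ! l") (auto simp: phi_def)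
        qed simp
        moreover have "kap 1 * sc 1 r v u \<le> 1 * sc 1 r v u"
          using kap_le1 sc_nonneg opt_vals[OF that] by (intro mult_right_mono) auto
        ultimately show ?thesis unfolding good_def by linarith
      qed
      then have "valid 1 v" unfolding valid_def
        using pk_opt[OF v] m True unfolding m_def by (intro bexI[of _ "pk v"]) (auto split: prod.splits)
      then show ?thesis using True Below_self v by (auto simp: vals_def)
    next
      case False then show ?thesis using P_valid v by (simp add: vals_def)
    qed
    then obtain z where z: "z \<in> Below v" "valid ?p z" by blast
    have zv: "z \<in> vals" "Bl z = Bl v" and zl: "\<And>l. l < n \<Longrightarrow> z ! l \<le> v ! l" "\<And>l. l < n \<Longrightarrow> z ! l \<noteq> v ! l \<Longrightarrow> l \<in> E v"
      using Below z v by (auto simp: vals_def)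
    have tz: "phi ?p r (z ! l) * z ! l * A u ! l \<le> phi ?p r (v ! l) * v ! l * A u ! l" if "l < n" "u \<in> vals" for l r u
    proof (cases "z ! l \<le> 0")
      case True
      then have "phi ?p r (z ! l) = 0" by (simp add: phi_def)
      then show ?thesis using term_nonneg[OF that(2,1), of ?p r "v ! l"] by simp
    next
      case False
      have "phi ?p r (z ! l) \<le> phi ?p r (v ! l)" using phi_mono val_nth zv v that zl by blast
      then have "phi ?p r (z ! l) * z ! l \<le> phi ?p r (v ! l) * v ! l"
        using False zl(1)[OF that(1)] phi_nonneg by (intro mult_mono) auto
      then show ?thesis using A0[of u l] that by (intro mult_right_mono) (auto simp: vals_def)
    qed
    \<comment> \<open>A raise of such an agent either changes no option, or lifts a value that is
      already at the level and thereby pushes the level up.\<close>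
    define Rel where "Rel = {l. l < n \<and> 0 < v ! l \<and> (l \<in> E v \<or> ?p \<le> rk (v ! l))}"
    have RelS: "kap ?p * m / 4 \<le> (\<Sum>l\<in>Rel. s l)"
    proof (rule ccontr)
      \<comment> \<open>Then the stable agents carry little, so lowering them to \<open>z\<close>
        costs the pick less than \<open>kap ?p / 4\<close> of its score. It is still near-optimal at
        \<open>z\<close>, hence good there, and everyone who makes it good belongs to
        \<open>Rel\<close>: unchanged agents by their rank, lowered ones by stability.\<close>
      assume neg: "\<not> ?thesis"
      let ?E = "E v \<inter> {..<n}" and ?N = "{..<n} - E v"
      have sE: "(\<Sum>l\<in>?E. s l) \<le> (\<Sum>l\<in>Rel. s l)"
      proof -
        have "(\<Sum>l\<in>?E. s l) = (\<Sum>l\<in>?E \<inter> {l. 0 < v ! l}. s l)"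
          by (rule sum.mono_neutral_right) (auto simp: s_def phi_def)
        also have "\<dots> \<le> (\<Sum>l\<in>Rel. s l)" using s0 by (intro sum_mono2) (auto simp: Rel_def)
        finally show ?thesis .
      qed
      have sp: "m = (\<Sum>l\<in>?E. s l) + (\<Sum>l\<in>?N. s l)"
        unfolding ms by (subst sum.subset_diff[of ?E]) (auto intro: sum.cong simp: Diff_Int_distrib2 Int_commute)
      obtain r0 u0 where r0: "(r0, u0) \<in> opt z" "0 < sc ?p r0 z u0"
          "\<And>r u. (r, u) \<in> opt z \<Longrightarrow> good ?p r z u \<or> sc ?p r z u < (1 - kap ?p) * sc ?p r0 z u0"
        using z(2) unfolding valid_def by fastforce
      have o: "opt z = opt v" using opt_same zv(2) by blast
      have "sc ?p r0 z u0 \<le> sc ?p r0 v u0" unfolding sc_def using tz opt_vals[OF r0(1)] by (intro sum_mono) auto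
      also have "\<dots> \<le> m" using max r0(1) o by blast
      finally have z0: "sc ?p r0 z u0 \<le> m" .
      have zN: "phi ?p ?r (z ! l) * z ! l * A ?u ! l = s l" if "l \<in> ?N" for l
      proof -
        have "z ! l = v ! l" using zl(2)[of l] that by blast
        then show ?thesis by (simp only: s_def)
      qed
      have zE: "0 \<le> phi ?p ?r (z ! l) * z ! l * A ?u ! l" if "l \<in> ?E" for l using term_nonneg uv that by auto
      have big: "(1 - kap ?p / 4) * m < sc ?p ?r z ?u"
      proof -
        have "sc ?p ?r z ?u = (\<Sum>l\<in>?E. phi ?p ?r (z ! l) * z ! l * A ?u ! l) + (\<Sum>l\<in>?N. phi ?p ?r (z ! l) * z ! l * A ?u ! l)"
          unfolding sc_def by (subst sum.subset_diff[of ?E]) (auto intro: sum.cong simp: Diff_Int_distrib2 Int_commute)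
        moreover have "0 \<le> (\<Sum>l\<in>?E. phi ?p ?r (z ! l) * z ! l * A ?u ! l)" by (rule sum_nonneg) (rule zE)
        moreover have "(\<Sum>l\<in>?N. phi ?p ?r (z ! l) * z ! l * A ?u ! l) = (\<Sum>l\<in>?N. s l)"
          by (rule sum.cong[OF refl]) (rule zN)
        ultimately have "(\<Sum>l\<in>?N. s l) \<le> sc ?p ?r z ?u" by linarith
        then show ?thesis using sp sE neg by (simp add: algebra_simps)
      qed
      have "(1 - kap ?p) * sc ?p r0 z u0 \<le> (1 - kap ?p / 4) * m"
        using z0 k0 r0(2) m by (intro mult_mono) auto
      then have g: "good ?p ?r z ?u" using r0(3)[of ?r ?u] o pk_opt[OF v] big by fastforce
      have "kap ?p * ((1 - kap ?p / 4) * m) \<le> kap ?p * sc ?p ?r z ?u" using big k0 by (intro mult_left_mono) auto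
      also have "\<dots> \<le> (\<Sum>l<n. if ?p \<le> rk (z ! l) then phi ?p ?r (z ! l) * z ! l * A ?u ! l else 0)"
        using g by (simp add: good_def)
      also have "\<dots> \<le> (\<Sum>l<n. if l \<in> Rel then s l else 0)"
      proof (rule sum_mono)
        fix l assume l: "l \<in> {..<n}"
        show "(if ?p \<le> rk (z ! l) then phi ?p ?r (z ! l) * z ! l * A ?u ! l else 0) \<le> (if l \<in> Rel then s l else 0)"
        proof (cases "?p \<le> rk (z ! l) \<and> 0 < z ! l")
          case True
          then have "l \<in> Rel" using l zl[of l] by (cases "z ! l = v ! l") (auto simp: Rel_def)
          then show ?thesis using tz[of l ?u ?r] l uv True by (simp add: s_def)
        next
          case False
          then have "(if ?p \<le> rk (z ! l) then phi ?p ?r (z ! l) * z ! l * A ?u ! l else 0) = 0"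
            by (auto simp: phi_def)
          then show ?thesis using s0 l by auto
        qed
      qed
      also have "\<dots> = (\<Sum>l\<in>Rel. s l)" by (rule sum.inter_restrict[symmetric, THEN trans]) (auto intro: sum.cong simp: Rel_def)
      finally have "kap ?p * ((1 - kap ?p / 4) * m) \<le> (\<Sum>l\<in>Rel. s l)" .
      moreover have "kap ?p * m / 4 \<le> kap ?p * ((1 - kap ?p / 4) * m)"
        using k0 m by (simp add: mult.left_commute)
      ultimately show False using neg by linarith
    qed
    \<comment> \<open>With this \<open>x\<close> the agents below the threshold
      \<open>x / c * m / n\<close> carry at most \<open>kap ?p * m / 8\<close> together, half of
      what \<open>Rel\<close> has.\<close>
    define x where "x = c * kap ?p / 8"
    have x: "xm \<le> x" "x \<le> 1"
      using kap_anti[OF P1(2)] c k0 mult_mono[of c 1 "kap ?p" 1] by (auto simp: x_def xm_def)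
    define Nt where "Nt = {l \<in> Rel. x / c * m / n \<le> s l}"
    have xc: "x / c = kap ?p / 8" using c by (simp add: x_def)
    have NtS: "kap k * m / 8 \<le> (\<Sum>l\<in>Nt. s l)"
    proof -
      have "(\<Sum>l\<in>Rel. s l) \<le> (\<Sum>l\<in>Nt. s l) + (\<Sum>l\<in>Rel - Nt. s l)"
        by (subst sum.subset_diff[of Nt Rel]) (auto simp: Nt_def Rel_def)
      moreover have "(\<Sum>l\<in>Rel - Nt. s l) \<le> kap ?p * m / 8"
        unfolding times_divide_eq_left[symmetric] xc[symmetric]
      proof (rule order_trans)
        show "(\<Sum>l\<in>Rel - Nt. s l) \<le> (\<Sum>l\<in>Rel - Nt. x / c * m / n)"
        by (rule sum_mono) (auto simp: Nt_def)
        show "(\<Sum>l\<in>Rel - Nt. x / c * m / n) \<le> x / c * m"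
        proof -
        have "card (Rel - Nt) \<le> card {..<n}" by (rule card_mono) (auto simp: Rel_def)
        then have "real (card (Rel - Nt)) * (x / c * m / n) \<le> real n * (x / c * m / n)"
          using x xm c m by (intro mult_right_mono) auto
        then show ?thesis using n by simp
        qed
      qed
      ultimately have "kap ?p * m / 8 \<le> (\<Sum>l\<in>Nt. s l)" using RelS by linarith
      moreover have "kap k * m \<le> kap ?p * m" using kap_anti[OF P1(2)] m by (intro mult_right_mono) auto
      ultimately show ?thesis by linarith
    qed
    have Tl: "x / 6 * (phi ?p ?r (v ! l) * A ?u ! l) \<le> T v l" if l: "l \<in> Nt" for l
    proof (rule T_ge[OF v])
      have ln: "l < n" "0 < v ! l" and lr: "l \<in> E v \<or> ?p \<le> rk (v ! l)" and sl: "x / c * m / n \<le> s l"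
        using l by (auto simp: Nt_def Rel_def)
      show "l < n" by fact
      fix b assume b: "b \<in> V" "v ! l \<le> b"
      have w0: "0 \<le> phi ?p ?r (v ! l) * A ?u ! l"
        using phi_nonneg A0[of ?u l] uv ln by (auto simp: vals_def)
      show "x / 6 * (phi ?p ?r (v ! l) * A ?u ! l) \<le> xi (v[l := b]) l"
      proof (cases "b = v ! l")
        case True
        have "x / 6 * (phi ?p ?r (v ! l) * A ?u ! l) \<le> 1 * (phi ?p ?r (v ! l) * A ?u ! l)"
          using w0 x by (intro mult_right_mono) auto
        then show ?thesis using phi_le_xi[OF ln(1) v] True by simp
      next
        case False
        then have b': "v ! l < b" using b by simp
        let ?y = "v[l := b]"
        have yv: "?y \<in> vals" using val_upd v b by blast
        have "l \<in> E v \<or> ?p < P ?y"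
        proof (cases "l \<in> E v")
          case F: False
          then have pr: "?p \<le> rk (v ! l)" using lr by blast
          let ?b = "rk b"
          have vV: "v ! l \<in> V" using val_nth v ln by blast
          have rb: "rk (v ! l) < ?b" "1 \<le> ?b" "?b \<le> k" "?p < ?b"
            using rk2[OF vV b(1) ln(2) b'] rk1[OF b(1)] ln b' pr by auto
          have kb: "kap ?b \<le> x / 8"
          proof -
            have "kap ?b \<le> kap (Suc ?p)" using rb by (intro kap_anti) auto
            then show ?thesis by (simp add: kap_Suc x_def)
          qed
          note h = honor[OF v ln(1) b(1) ln(2) b' refl nested_step[OF v ln(1) b(1) b' rb(4,3)]
             visible_step[OF v ln(1) b(1) ln(2) b' P1 rb(2,3)] _ pk_opt[OF v] m_def m max x]
          have sl': "x / c * m / n \<le> phi ?p ?r (v ! l) * v ! l * A ?u ! l" using sl by (simp add: s_def)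
          obtain r1 where r1: "(r1, ?u) \<in> opt ?y" "(1 + x / 2) * m / th ^ 3 \<le> sc ?b r1 ?y ?u"
            using h(1)[OF _ _ sl'] opt_vals by blast
          have M0: "0 < m / th ^ 3" using m th01 by simp
          have x0: "0 < x" using x xm by linarith
          have r1p: "0 < sc ?b r1 ?y ?u"
          proof -
            have "0 < (1 + x / 2) * m / th ^ 3" using m th01 x0 by (intro divide_pos_pos mult_pos_pos) auto
            then show ?thesis using r1(2) by linarith
          qed
          have "valid ?b ?y" unfolding valid_def
          proof (intro bexI[of _ "(r1, ?u)"], clarify, intro conjI ballI, goal_cases)
            case 1 show ?case by (fact r1p)
          next
            case (2 ru)
            obtain r' u' where ru: "ru = (r', u')" by fastforce
            show ?case
            proof (cases "sc ?b r' ?y u' < (1 - kap ?b) * sc ?b r1 ?y ?u")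
              case False
              let ?S = "sc ?b r' ?y u'"
              have kb0: "0 < kap ?b" "kap ?b \<le> 1" using kap_pos kap_le1 by auto
              have u'v: "u' \<in> vals" using 2 ru opt_vals by blast
              have "(1 - kap ?b) * ((1 + x / 2) * (m / th ^ 3)) \<le> (1 - kap ?b) * sc ?b r1 ?y ?u"
                by (intro mult_left_mono) (use r1(2) kb0 in auto)
              then have S1: "(1 - kap ?b) * ((1 + x / 2) * (m / th ^ 3)) \<le> ?S" using False by linarith
              have S2: "?S \<le> m / th ^ 3 + phi ?b r' b * b * A u' ! l"
                using h(2)[OF _ _ sl'] opt_vals 2 ru by blast
              have "m / th ^ 3 \<le> (1 - kap ?b) * ?S"
              proof -
                \<comment> \<open>One factor \<open>1 - kap ?b\<close> accounts for options that are
                  only near-optimal, the other for the share that \<open>l\<close> has to carry; the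
                  growth \<open>1 + x / 2\<close> pays for both.\<close>
                have "1 \<le> (1 - x / 8) * (1 - x / 8) * (1 + x / 2)"
                proof -
                  have "(1 - x / 4) * (1 + x / 2) \<le> (1 - x / 8) * (1 - x / 8) * (1 + x / 2)"
                    using x0 by (intro mult_right_mono) (auto simp: algebra_simps)
                  moreover have "x * x \<le> x * 1" using x x0 by (intro mult_left_mono) auto
                  then have "1 \<le> (1 - x / 4) * (1 + x / 2)" using x0 by (simp add: algebra_simps)
                  ultimately show ?thesis by linarith
                qed
                also have "\<dots> \<le> (1 - kap ?b) * (1 - kap ?b) * (1 + x / 2)"
                  using kb x x0 by (intro mult_right_mono mult_mono) auto
                finally have "1 * (m / th ^ 3) \<le> (1 - kap ?b) * (1 - kap ?b) * (1 + x / 2) * (m / th ^ 3)"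
                  using M0 by (intro mult_right_mono) auto
                also have "\<dots> \<le> (1 - kap ?b) * ?S" using mult_left_mono[OF S1, of "1 - kap ?b"] kb0 by (simp add: mult.assoc)
                finally show ?thesis by simp
              qed
              then have "kap ?b * ?S \<le> phi ?b r' b * b * A u' ! l" using S2 by (simp add: algebra_simps)
              also have "\<dots> \<le> (\<Sum>i<n. if ?b \<le> rk (?y ! i) then phi ?b r' (?y ! i) * ?y ! i * A u' ! i else 0)"
                using member_le_sum[of l "{..<n}" "\<lambda>i. if ?b \<le> rk (?y ! i) then phi ?b r' (?y ! i) * ?y ! i * A u' ! i else 0"]
                  ln val_len[OF v] term_nonneg[OF u'v] by auto
              finally show ?thesis unfolding ru good_def by simp
            qed (simp add: ru)
          qed (fact r1(1))
          then have "?b \<le> P ?y" using P_ge[of ?y ?b ?y] Below_self yv rb by (simp add: vals_def)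
          then show ?thesis using rb by simp
        qed simp
        note nr = nested_raise[OF v ln(1) b(1) ln(2) b' this]
        show ?thesis
          using honored_amount[OF v ln(1) b(1) ln(2) b' m_def m x _ nr] sl by (simp add: s_def)
      qed
    qed
    have "xm / 6 * (kap k * m / 8) \<le> x / 6 * (\<Sum>l\<in>Nt. s l)"
      using x xm NtS kap_pos[of k] m by (intro mult_mono) (auto intro: sum_nonneg s0 simp: Nt_def Rel_def)
    also have "\<dots> = (\<Sum>l\<in>Nt. v ! l * (x / 6 * (phi ?p ?r (v ! l) * A ?u ! l)))"
      unfolding sum_distrib_left s_def by (simp add: ac_simps)
    also have "\<dots> \<le> (\<Sum>l\<in>Nt. v ! l * T v l)"
      using Tl by (intro sum_mono mult_left_mono) (auto simp: Nt_def Rel_def)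
    also have "\<dots> \<le> (\<Sum>l<n. v ! l * T v l)"
      using T0 by (intro sum_mono2) (auto simp: Nt_def Rel_def)
    finally have fin: "xm / 6 * (kap k * m / 8) \<le> (\<Sum>l<n. v ! l * T v l)" .
    have "1 / 2 \<le> th"
      using xm by (simp add: th')
    then have "1 / 2 * ?W \<le> m" using mW A0[of v] v
      by (intro order_trans[OF mult_right_mono mW]) (auto intro!: sum_nonneg simp: vals_def)
    then have "xm / 6 * (kap k / 8) * (1 / 2 * ?W) \<le> xm / 6 * (kap k / 8) * m"
      using xm kap_pos[of k] by (intro mult_left_mono) auto
    moreover have "xm / 6 * (kap k / 8) * m = xm / 6 * (kap k * m / 8)"
      "xm / 6 * (kap k / 16) * ?W = xm / 6 * (kap k / 8) * (1 / 2 * ?W)" by simp_all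
    ultimately show ?thesis using fin by linarith
  qed
qed

lemma own_score: "y \<in> vals \<Longrightarrow> \<forall>t\<in>V. 0 < t \<Longrightarrow> sc p 0 y u = (\<Sum>l<n. y ! l * A u ! l)"
  unfolding sc_def by (intro sum.cong) (fastforce simp: phi_def dest: val_nth)+

text \<open>If the distance does not restrict the queries, then the same query at distance 0 has at
  least twice the weight. A pick beyond \<open>D\<close> can then be optimal only if its score
  vanishes.\<close>

lemma far_pick:
  assumes y: "y \<in> vals" and pos: "\<forall>t\<in>V. 0 < t" and small: "2 * th ^ D * real Gam ^ k \<le> 1"
    and all: "\<And>r. Bl y r = Bl y 0" and far: "D < fst (pk y)"
  shows "sc (P y) (fst (pk y)) y (snd (pk y)) \<le> 0"
proof -
  let ?u = "snd (pk y)"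
  have u: "?u \<in> vals" using opt_vals pk_opt y by blast
  have "?u \<in> Bl y (fst (pk y))" using pk_opt[OF y] by (auto simp: opt_def split: prod.splits)
  then have "(0, ?u) \<in> opt y" using all[of "fst (pk y)"] by (simp add: opt_def)
  then have "sc (P y) 0 y ?u \<le> sc (P y) (fst (pk y)) y ?u"
    by (rule pk_max[OF y[unfolded vals_def]])
  moreover have "2 * sc (P y) (fst (pk y)) y ?u \<le> sc (P y) 0 y ?u"
    unfolding sc_def sum_distrib_left
  proof (rule sum_mono)
    fix l assume l: "l \<in> {..<n}"
    have yV: "y ! l \<in> V" using val_nth y l by blast
    then have y0: "0 < y ! l" "rk (y ! l) \<le> k" using pos rk1 by auto
    have "real Gam ^ rk (y ! l) \<le> real Gam ^ k" using y0 Gam4 by (intro power_increasing) auto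
    then have "th ^ D * real Gam ^ rk (y ! l) \<le> th ^ D * real Gam ^ k" using th01 by (intro mult_left_mono) auto
    moreover have "0 \<le> th ^ D * real Gam ^ k" using th01 by simp
    ultimately have "phi (P y) (fst (pk y)) (y ! l) \<le> th ^ D * real Gam ^ k" using far y0 by (simp add: phi_def)
    moreover have "phi (P y) 0 (y ! l) = 1" using y0 by (simp add: phi_def)
    ultimately have "2 * phi (P y) (fst (pk y)) (y ! l) \<le> phi (P y) 0 (y ! l)" using small by linarith
    then have "2 * phi (P y) (fst (pk y)) (y ! l) * (y ! l * A ?u ! l) \<le> phi (P y) 0 (y ! l) * (y ! l * A ?u ! l)"
      using y0 A0[of ?u l] u l by (intro mult_right_mono) (auto simp: vals_def)
    then show "2 * (phi (P y) (fst (pk y)) (y ! l) * y ! l * A ?u ! l) \<le> phi (P y) 0 (y ! l) * y ! l * A ?u ! l"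
      by (simp add: mult.assoc)
  qed
  ultimately show ?thesis by linarith
qed

text \<open>A raise at \<open>w\<close> changes no option. Among options up to \<open>D\<close> the
  score is affine in the raised value, with the discounted amount as slope, so the maximiser at a
  larger value has at least the slope of the old one. The second alternative of \<open>alt\<close>
  is for \<open>n = 1\<close>, where a ratio above \<open>n\<close> need not reach 2.\<close>

theorem full_welfare:
  assumes w: "w \<in> vals" and pos: "\<forall>t\<in>V. 0 < t" and small: "2 * th ^ D * real Gam ^ k \<le> 1"
    and E: "\<And>l. l < n \<Longrightarrow> l \<in> E w" and own0: "w \<in> Bl w 0"
    and alt: "(\<forall>s\<in>V. \<forall>t\<in>V. s < t \<longrightarrow> 2 * s \<le> t) \<or> (\<forall>r. Bl w r = Bl w 0)"
  shows "(\<Sum>i<n. w ! i * A w ! i) \<le> (\<Sum>i<n. w ! i * T w i)"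
proof -
  let ?r = "fst (pk w)" and ?u = "snd (pk w)"
  define m where "m = sc (P w) ?r w ?u"
  define s where "s l = phi (P w) ?r (w ! l) * A ?u ! l" for l
  have uv: "?u \<in> vals" using opt_vals pk_opt w by blast
  have max: "sc (P w) r w u \<le> m" if "(r, u) \<in> opt w" for r u
    using pk_max that w unfolding m_def vals_def by blast
  have ms: "m = (\<Sum>l<n. w ! l * s l)" unfolding m_def sc_def s_def by (simp add: ac_simps)
  have w0: "0 < w ! l" "w ! l \<in> V" if "l < n" for l using pos val_nth w that by auto
  have s0: "0 \<le> s l" if "l < n" for l
    using phi_nonneg A0[of ?u l] uv that by (auto simp: s_def vals_def)
  have mW: "(\<Sum>i<n. w ! i * A w ! i) \<le> m"
    using max[of 0 w] own0 own_score[OF w pos] by (simp add: opt_def)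
  have T0: "0 \<le> (\<Sum>i<n. w ! i * T w i)"
    using T_nonneg w w0 by (intro sum_nonneg mult_nonneg_nonneg) (auto intro: less_imp_le)
  have rest: "sc p' r' (w[l := b]) u' \<le> m + phi p' r' b * b * A u' ! l"
    if l: "l < n" and p': "P w \<le> p'" and o: "(r', u') \<in> opt w" for l b p' r' u'
  proof -
    have u': "u' \<in> vals" using opt_vals o by blast
    have "(\<Sum>i\<in>{..<n} - {l}. phi p' r' (w ! i) * w ! i * A u' ! i) \<le> (\<Sum>i\<in>{..<n} - {l}. phi (P w) r' (w ! i) * w ! i * A u' ! i)"
      using phi_same[OF p'] w0 A0[of u'] u' by (intro sum_mono mult_right_mono) (auto simp: vals_def intro: less_imp_le)
    also have "\<dots> \<le> sc (P w) r' w u'" unfolding sc_split[OF l] using term_nonneg[OF u' l] by simp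
    also have "\<dots> \<le> m" by (rule max[OF o])
    finally show ?thesis using sc_upd[OF val_len[OF w] l] by simp
  qed
  have same: "Bl (w[l := b]) = Bl w" "opt (w[l := b]) = opt w" "P w \<le> P (w[l := b])" if "l < n" "b \<in> V" "w ! l < b" for l b
  proof -
    have e: "Bl (w[l := b]) = Bl w \<and> Below w \<subseteq> Below (w[l := b])"
      using E[OF that(1)] that(2,3) unfolding E_def by blast
    then show "Bl (w[l := b]) = Bl w" by blast
    then show "opt (w[l := b]) = opt w" by (rule opt_same)
    show "P w \<le> P (w[l := b])" using P_same[OF w val_upd[OF w that(2)]] e by blast
  qed
  show ?thesis
  proof (cases "?r \<le> D")
    case core: True
    have "s l \<le> T w l" if l: "l < n" for l
    proof (rule T_ge[OF w l])
      fix b assume b: "b \<in> V" "w ! l \<le> b"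
      show "s l \<le> xi (w[l := b]) l"
      proof (cases "b = w ! l")
        case True then show ?thesis using phi_le_xi[OF l w] by (simp add: s_def)
      next
        case False
        let ?y = "w[l := b]"
        have b': "w ! l < b" using False b by simp
        note same = same[OF l b(1) b']
        have yv: "?y \<in> vals" using val_upd w b by blast
        have yl: "?y ! l = b" using l val_len[OF w] by simp
        let ?r' = "fst (pk ?y)" and ?u' = "snd (pk ?y)"
        have o': "(?r', ?u') \<in> opt w" using pk_opt[OF yv] same by simp
        have u': "?u' \<in> vals" using o' opt_vals by blast
        have b0: "0 < b" using b' w0[OF l] by simp
        have lo: "m + (b - w ! l) * s l \<le> sc (P ?y) ?r' ?y ?u'"
        proof -
          have "sc (P ?y) ?r ?y ?u \<le> sc (P ?y) ?r' ?y ?u'"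
            using pk_max yv pk_opt[OF w] same by (auto simp: vals_def)
          moreover have ph: "phi (P ?y) ?r t = phi (P w) ?r t" for t using core by (simp add: phi_def)
          have "phi (P w) ?r b = phi (P w) ?r (w ! l)" using core b0 w0[OF l] by (simp add: phi_def)
          then have "sc (P ?y) ?r ?y ?u = m + (b - w ! l) * s l"
            unfolding m_def s_def sc_split[OF l, of "P w"] sc_upd[OF val_len[OF w] l] ph
            by (simp add: algebra_simps)
          ultimately show ?thesis by simp
        qed
        have up: "sc (P ?y) ?r' ?y ?u' \<le> m + phi (P ?y) ?r' b * b * A ?u' ! l"
          by (rule rest[OF l same(3) o'])
        show ?thesis
        proof (cases "?r' \<le> D")
          case c': True
          have "sc (P ?y) ?r' ?y ?u' = sc (P w) ?r' w ?u' + (b - w ! l) * (phi (P ?y) ?r' b * A ?u' ! l)"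
          proof -
            have ph: "phi (P ?y) ?r' t = phi (P w) ?r' t" for t using c' by (simp add: phi_def)
            have "phi (P w) ?r' b = phi (P w) ?r' (w ! l)" using c' b0 w0[OF l] by (simp add: phi_def)
            then show ?thesis
              unfolding sc_split[OF l, of "P w"] sc_upd[OF val_len[OF w] l] ph
              by (simp add: algebra_simps)
          qed
          then have "(b - w ! l) * s l \<le> (b - w ! l) * (phi (P ?y) ?r' b * A ?u' ! l)"
            using lo max[OF o'] by linarith
          then have "s l \<le> phi (P ?y) ?r' b * A ?u' ! l" using b' by simp
          then show ?thesis using phi_le_xi[OF l yv] yl by simp
        next
          case f': False
          from alt show ?thesis
          proof
            assume "\<forall>s\<in>V. \<forall>t\<in>V. s < t \<longrightarrow> 2 * s \<le> t"
            \<comment> \<open>The pick at the raised vector lies beyond \<open>D\<close>. Doubling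
              gives \<open>b - w ! l \<ge> b / 2\<close>, and the factor 2 in \<open>xi\<close>
              makes up for the lost half.\<close>
            then have "2 * (w ! l) \<le> b" using w0[OF l] b b' by blast
            then have "b / 2 * s l \<le> (b - w ! l) * s l" using s0[OF l] by (intro mult_right_mono) auto
            then have "b / 2 * s l \<le> phi (P ?y) ?r' b * b * A ?u' ! l" using lo up by linarith
            then have "b * s l \<le> b * (2 * phi (P ?y) ?r' b * A ?u' ! l)" by (simp add: ac_simps)
            then show ?thesis using f' b0 yl by (simp add: xi_def)
          next
            assume all: "\<forall>r. Bl w r = Bl w 0"
            then have "Bl ?y r = Bl ?y 0" for r unfolding same(1) by (rule spec)
            then have "sc (P ?y) ?r' ?y ?u' \<le> 0" using far_pick[OF yv pos small] f' by simp
            moreover have "0 \<le> m" unfolding m_def using sc_nonneg uv by blast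
            ultimately have "(b - w ! l) * s l \<le> 0" using lo by linarith
            then have "s l \<le> 0" using b' by (simp add: mult_le_0_iff)
            then show ?thesis using xi_nonneg[OF yv l] by linarith
          qed
        qed
      qed
    qed
    then have "m \<le> (\<Sum>i<n. w ! i * T w i)"
      unfolding ms using w0 by (intro sum_mono mult_left_mono) (auto intro: less_imp_le)
    then show ?thesis using mW by simp
  next
    case far: False
    show ?thesis
    proof (cases "m \<le> 0")
      case True then show ?thesis using mW T0 by simp
    next
      case False
      then have m: "0 < m" by simp
      have np: "0 < real n" using n by simp
      \<comment> \<open>The pick at \<open>w\<close> itself lies beyond \<open>D\<close>. Agents
        below a share of \<open>1 / (2 * n)\<close> lose at most half of \<open>m\<close>, and the
        remaining ones are paid at least twice, which restores \<open>m\<close>.\<close>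
      define Nt where "Nt = {l. l < n \<and> m / (2 * n) \<le> w ! l * s l}"
      have fin: "finite Nt" by (simp add: Nt_def)
      have NtS: "m / 2 \<le> (\<Sum>l\<in>Nt. w ! l * s l)"
      proof -
        have "m = (\<Sum>l\<in>Nt. w ! l * s l) + (\<Sum>l\<in>{..<n} - Nt. w ! l * s l)"
          unfolding ms by (subst sum.subset_diff[of Nt]) (auto simp: Nt_def)
        moreover have "(\<Sum>l\<in>{..<n} - Nt. w ! l * s l) \<le> m / 2"
        proof (rule order_trans)
          show "(\<Sum>l\<in>{..<n} - Nt. w ! l * s l) \<le> (\<Sum>l\<in>{..<n} - Nt. m / (2 * n))"
            by (rule sum_mono) (auto simp: Nt_def)
          have "card ({..<n} - Nt) \<le> card {..<n}" by (rule card_mono) auto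
          then have "real (card ({..<n} - Nt)) * (m / (2 * n)) \<le> real n * (m / (2 * n))"
            using m by (intro mult_right_mono) auto
          then show "(\<Sum>l\<in>{..<n} - Nt. m / (2 * n)) \<le> m / 2" using np by simp
        qed
        ultimately show ?thesis by linarith
      qed
      have Gc: "32 \<le> real Gam * c"
      proof -
        have "real Gam * xm \<le> real Gam * (c / 8)"
          using c kap_le1[of k] unfolding xm_def by (intro mult_left_mono) auto
        then show ?thesis using Gam' by simp
      qed
      have "2 * s l \<le> T w l" if "l \<in> Nt" for l
      proof (rule T_ge[OF w])
        show l: "l < n" using that by (simp add: Nt_def)
        fix b assume b: "b \<in> V" "w ! l \<le> b"
        show "2 * s l \<le> xi (w[l := b]) l"
        proof (cases "b = w ! l")
          case True then show ?thesis using far by (simp add: xi_def s_def)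
        next
          case False
          let ?y = "w[l := b]"
          have b': "w ! l < b" using False b by simp
          note same = same[OF l b(1) b']
          have yv: "?y \<in> vals" using val_upd w b by blast
          have yl: "?y ! l = b" using l val_len[OF w] by simp
          let ?r' = "fst (pk ?y)" and ?u' = "snd (pk ?y)"
          have o': "(?r', ?u') \<in> opt w" using pk_opt[OF yv] same by simp
          have b0: "0 < b" using b' w0[OF l] by simp
          have sh: "m / (2 * n) \<le> w ! l * s l" using that by (simp add: Nt_def)
          have "0 < m / (2 * n)" using m np by simp
          then have "0 < w ! l * s l" using sh by linarith
          then have sl: "0 < s l" using w0[OF l] by (simp add: zero_less_mult_iff)
          then have "phi (P w) ?r (w ! l) \<noteq> 0" by (auto simp: s_def)
          then have r: "?r \<le> Rr (P w) (rk (w ! l))" using far w0[OF l] by (simp add: phi_def split: if_splits)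
          have qb: "rk (w ! l) < rk b" using rk2 w0[OF l] b b' by blast
          have "(k + 1) * Suc (rk (w ! l)) \<le> (k + 1) * rk b" using qb by (intro mult_left_mono) auto
          then have R: "Rr (P w) (rk (w ! l)) \<le> Rr (P ?y) (rk b)" using P1(1)[of w] P1(2)[of ?y] by (simp add: Rr_def)
          have "real Gam ^ Suc (rk (w ! l)) \<le> real Gam ^ rk b" using qb Gam4 by (intro power_increasing) auto
          then have "th ^ D * real Gam ^ Suc (rk (w ! l)) \<le> th ^ D * real Gam ^ rk b"
            using th01 by (intro mult_left_mono) auto
          then have G: "real Gam * phi (P w) ?r (w ! l) \<le> phi (P ?y) ?r b"
            using far r R b0 w0[OF l] by (simp add: phi_def mult.left_commute)
          have "real Gam * phi (P w) ?r (w ! l) * (b * A ?u ! l) \<le> phi (P ?y) ?r b * (b * A ?u ! l)"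
            using G b0 A0[of ?u l] uv l by (intro mult_right_mono) (auto simp: vals_def)
          also have "\<dots> \<le> sc (P ?y) ?r ?y ?u"
            using term_le_sc[OF uv l, of "P ?y" ?r ?y] yl by (simp add: mult.assoc)
          also have "\<dots> \<le> sc (P ?y) ?r' ?y ?u'"
            using pk_max yv pk_opt[OF w] same by (auto simp: vals_def)
          also have "\<dots> \<le> m + phi (P ?y) ?r' b * b * A ?u' ! l" by (rule rest[OF l same(3) o'])
          finally have 1: "b * (real Gam * s l) \<le> m + b * (phi (P ?y) ?r' b * A ?u' ! l)"
            by (simp add: s_def ac_simps)
          have "c * m = c * n * 2 * (m / (2 * n))" using np by simp
          also have "\<dots> \<le> c * n * 2 * (w ! l * s l)" using sh c np by (intro mult_left_mono) auto
          also have "\<dots> = 2 * s l * (c * n * w ! l)" by simp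
          also have "\<dots> \<le> 2 * s l * b"
            using gap[OF w0(2)[OF l] b(1) w0(1)[OF l] b'] w0[OF l] sl by (intro mult_left_mono) auto
          finally have 2: "c * m \<le> 2 * (b * s l)" by (simp only: mult.assoc mult.commute[of b])
          have "32 * (b * s l) \<le> real Gam * c * (b * s l)" using Gc b0 sl by (intro mult_right_mono) auto
          also have "\<dots> = c * (b * (real Gam * s l))" by simp
          also have "\<dots> \<le> c * (m + b * (phi (P ?y) ?r' b * A ?u' ! l))" using 1 c by (intro mult_left_mono) auto
          also have "\<dots> \<le> 2 * (b * s l) + 1 * (b * (phi (P ?y) ?r' b * A ?u' ! l))"
          proof -
            have "0 \<le> phi (P ?y) ?r' b * A ?u' ! l"
              using phi_nonneg A0[of ?u' l] opt_vals[OF o'] l by (auto simp: vals_def)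
            then have "c * (b * (phi (P ?y) ?r' b * A ?u' ! l)) \<le> 1 * (b * (phi (P ?y) ?r' b * A ?u' ! l))"
              using c b0 by (intro mult_right_mono) auto
            then show ?thesis using 2 unfolding distrib_left[of c] by linarith
          qed
          finally have "2 * (b * s l) \<le> b * (phi (P ?y) ?r' b * A ?u' ! l)"
            using mult_pos_pos[OF b0 sl] by linarith
          then have "b * (2 * s l) \<le> b * (phi (P ?y) ?r' b * A ?u' ! l)" by (simp add: mult.left_commute)
          then have "2 * s l \<le> phi (P ?y) ?r' b * A ?u' ! l" using b0 by simp
          then show ?thesis using phi_le_xi[OF l yv] yl by simp
        qed
      qed
      then have "(\<Sum>l\<in>Nt. w ! l * (2 * s l)) \<le> (\<Sum>l\<in>Nt. w ! l * T w l)"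
        using w0 by (intro sum_mono mult_left_mono) (auto simp: Nt_def intro: less_imp_le)
      also have "\<dots> \<le> (\<Sum>l<n. w ! l * T w l)"
        using T_nonneg w w0 by (intro sum_mono2 mult_nonneg_nonneg) (auto simp: Nt_def intro: less_imp_le)
      also have "(\<Sum>l\<in>Nt. w ! l * (2 * s l)) = 2 * (\<Sum>l\<in>Nt. w ! l * s l)"
        by (simp add: sum_distrib_left ac_simps)
      finally show ?thesis using NtS mW by linarith
    qed
  qed
qed

end


section \<open>A code with unique parents\<close>

text \<open>
  The coordinates below \<open>f\<close> are free. A vector that arises from a center by raising one of the
  other coordinates is attributed to that center.
\<close>

locale unique_parents =
  fixes n f :: nat and V :: "real set" and center :: "real list \<Rightarrow> bool"
  assumes center_cong: "y \<in> valuations n V \<Longrightarrow> z \<in> valuations n V \<Longrightarrow>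
      (\<And>l. f \<le> l \<Longrightarrow> l < n \<Longrightarrow> y ! l = z ! l) \<Longrightarrow> center y = center z"
    and parent_unique: "y \<in> valuations n V \<Longrightarrow> f \<le> i \<Longrightarrow> i < n \<Longrightarrow> f \<le> j \<Longrightarrow> j < n \<Longrightarrow> s \<in> V \<Longrightarrow> t \<in> V \<Longrightarrow>
      s < y ! i \<Longrightarrow> t < y ! j \<Longrightarrow> center (y[i := s]) \<Longrightarrow> center (y[j := t]) \<Longrightarrow> i = j \<and> s = t"
    and center_orphan: "y \<in> valuations n V \<Longrightarrow> f \<le> i \<Longrightarrow> i < n \<Longrightarrow> s \<in> V \<Longrightarrow> s < y ! i \<Longrightarrow>
      center (y[i := s]) \<Longrightarrow> \<not> center y"
begin

abbreviation vals :: "real list set" where "vals \<equiv> valuations n V"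

definition parent :: "real list \<Rightarrow> real list \<Rightarrow> bool" where
  "parent y w \<longleftrightarrow> (\<exists>i s. f \<le> i \<and> i < n \<and> s \<in> V \<and> s < y ! i \<and> w = y[i := s] \<and> center w)"

definition base :: "real list \<Rightarrow> real list" where
  "base y = (if \<exists>w. parent y w then SOME w. parent y w else y)"

text \<open>Free coordinates are not counted, so raising one changes no ball.\<close>

definition dist :: "real list \<Rightarrow> real list \<Rightarrow> nat" where
  "dist u w = card {l. f \<le> l \<and> l < n \<and> u ! l \<noteq> w ! l}"

definition Bl :: "real list \<Rightarrow> nat \<Rightarrow> real list set" where
  "Bl y r = {u \<in> vals. dist (base y) u \<le> r}"

text \<open>On coordinates that are not free only the one raised from a center can be lowered, and
  not below its value in the center. This keeps the base, up to free coordinates.\<close>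

definition Below :: "real list \<Rightarrow> real list set" where
  "Below y = {z \<in> vals. \<forall>l<n. z ! l \<le> y ! l \<and> (f \<le> l \<longrightarrow> base y ! l \<le> z ! l)}"

definition stable :: "real list \<Rightarrow> nat \<Rightarrow> bool" where
  "stable y l \<longleftrightarrow> (\<forall>b\<in>V. y ! l < b \<longrightarrow> Bl (y[l := b]) = Bl y \<and> Below y \<subseteq> Below (y[l := b]))"

lemma vals_upd: "y \<in> vals \<Longrightarrow> b \<in> V \<Longrightarrow> y[l := b] \<in> vals"
  by (auto simp: valuations_def dest: set_update_subset_insert[THEN subsetD])
lemma vals_nth: "y \<in> vals \<Longrightarrow> l < n \<Longrightarrow> y ! l \<in> V"
  by (auto simp: valuations_def)
lemma vals_len: "y \<in> vals \<Longrightarrow> length y = n"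
  by (simp add: valuations_def)

lemma upd_nth: "y \<in> vals \<Longrightarrow> l < n \<Longrightarrow> y[i := s] ! l = (if l = i then s else y ! l)"
  by (simp add: vals_len nth_list_update)

lemma parent_eq: "y \<in> vals \<Longrightarrow> parent y w \<Longrightarrow> base y = w"
proof -
  assume y: "y \<in> vals" and w: "parent y w"
  have "w' = w" if "parent y w'" for w'
    using that w parent_unique[OF y] unfolding parent_def by metis
  then show ?thesis using w unfolding base_def by (metis (mono_tags, lifting) someI)
qed

lemma base_cases:
  assumes "y \<in> vals"
  obtains (orphan) "base y = y" "\<And>w. \<not> parent y w"
    | (child) i s where "f \<le> i" "i < n" "s \<in> V" "s < y ! i" "base y = y[i := s]" "center (y[i := s])"
proof (cases "\<exists>w. parent y w")
  case True
  then obtain w where w: "parent y w" by blast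
  then show ?thesis using child parent_eq[OF assms w] unfolding parent_def by blast
qed (use orphan base_def in auto)

lemma center_base: "y \<in> vals \<Longrightarrow> center y \<Longrightarrow> base y = y"
proof -
  assume y: "y \<in> vals" "center y"
  from y(1) show ?thesis
  proof (cases rule: base_cases)
    case (child i s) then show ?thesis using center_orphan[OF y(1), of i s] y by blast
  qed
qed

lemma parentI: "f \<le> i \<Longrightarrow> i < n \<Longrightarrow> s \<in> V \<Longrightarrow> s < y ! i \<Longrightarrow> center (y[i := s]) \<Longrightarrow> parent y (y[i := s])"
  unfolding parent_def by blast

lemma base_le: "y \<in> vals \<Longrightarrow> l < n \<Longrightarrow> base y ! l \<le> y ! l"
  by (rule base_cases[of y]) (auto simp: upd_nth)

lemma dist_triangle: "dist u w \<le> dist u x + dist x w"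
proof -
  have "{l. f \<le> l \<and> l < n \<and> u ! l \<noteq> w ! l} \<subseteq> {l. f \<le> l \<and> l < n \<and> u ! l \<noteq> x ! l} \<union> {l. f \<le> l \<and> l < n \<and> x ! l \<noteq> w ! l}"
    by auto
  then have "dist u w \<le> card ({l. f \<le> l \<and> l < n \<and> u ! l \<noteq> x ! l} \<union> {l. f \<le> l \<and> l < n \<and> x ! l \<noteq> w ! l})"
    unfolding dist_def by (intro card_mono) auto
  also have "\<dots> \<le> dist u x + dist x w" unfolding dist_def by (rule card_Un_le)
  finally show ?thesis .
qed

lemma dist_commute: "dist u w = dist w u"
  unfolding dist_def by (simp add: eq_commute)

lemma dist_upd: "dist y (y[i := s]) \<le> 1"
proof -
  have "{l. f \<le> l \<and> l < n \<and> y ! l \<noteq> y[i := s] ! l} \<subseteq> {i}" by (auto, metis nth_list_update_neq)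
  then have "dist y (y[i := s]) \<le> card {i}" unfolding dist_def by (intro card_mono) auto
  then show ?thesis by simp
qed

lemma dist_base: assumes y: "y \<in> vals" shows "dist (base y) y \<le> 1"
  using y
proof (cases rule: base_cases)
  case orphan then show ?thesis by (simp add: dist_def)
next
  case (child i s) then show ?thesis using dist_upd[of y i s] dist_commute[of y "y[i := s]"] by simp
qed

lemma own: "y \<in> vals \<Longrightarrow> y \<in> Bl y 1"
  using dist_base by (simp add: Bl_def)

text \<open>Both bases are within 1 of their vectors and the vectors within 1 of each other; the
  triangle inequality gives 3.\<close>

lemma Bl_step:
  assumes y: "y \<in> vals" "b \<in> V"
  shows "Bl (y[j := b]) r \<subseteq> Bl y (r + 3) \<and> Bl y r \<subseteq> Bl (y[j := b]) (r + 3)"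
proof -
  let ?y = "y[j := b]"
  have y': "?y \<in> vals" using vals_upd y by blast
  have d: "dist (base y) (base ?y) \<le> 3"
    using dist_base[OF y(1)] dist_base[OF y'] dist_upd[of y j b] dist_commute[of ?y "base ?y"]
      dist_triangle[of "base y" "base ?y" y] dist_triangle[of y "base ?y" ?y] by linarith
  show ?thesis
  proof (intro conjI subsetI)
    fix u assume "u \<in> Bl ?y r"
    then show "u \<in> Bl y (r + 3)" using d dist_triangle[of "base y" u "base ?y"] by (auto simp: Bl_def)
  next
    fix u assume "u \<in> Bl y r"
    then show "u \<in> Bl ?y (r + 3)" using d dist_triangle[of "base ?y" u "base y"] dist_commute[of "base y" "base ?y"]
      by (auto simp: Bl_def)
  qed
qed

lemma Below_self: "y \<in> vals \<Longrightarrow> y \<in> Below y"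
  using base_le by (simp add: Below_def)

definition agree :: "real list \<Rightarrow> real list \<Rightarrow> bool" where
  "agree y z \<longleftrightarrow> (\<forall>l. f \<le> l \<and> l < n \<longrightarrow> y ! l = z ! l)"

lemma agree_center: "y \<in> vals \<Longrightarrow> z \<in> vals \<Longrightarrow> agree y z \<Longrightarrow> center y = center z"
  by (rule center_cong) (auto simp: agree_def)

lemma agree_dist: "agree y z \<Longrightarrow> dist y u = dist z u"
  unfolding dist_def agree_def by (intro arg_cong[of _ _ card]) auto

lemma agree_parent:
  assumes "y \<in> vals" "z \<in> vals" "agree y z" "parent y w"
  shows "\<exists>w'. parent z w' \<and> agree w w'"
proof -
  obtain i s where i: "f \<le> i" "i < n" "s \<in> V" "s < y ! i" "w = y[i := s]" "center w"
    using assms(4) unfolding parent_def by blast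
  have a: "agree (y[i := s]) (z[i := s])"
    using assms(1-3) by (simp add: agree_def upd_nth)
  then have "center (z[i := s])" using agree_center[OF _ _ a] vals_upd assms i by blast
  moreover have "s < z ! i" using i assms(3) by (simp add: agree_def)
  ultimately show ?thesis using parentI[of i s z] i a by blast
qed

lemma agree_base:
  assumes "y \<in> vals" "z \<in> vals" "agree y z"
  shows "agree (base y) (base z)"
proof (cases "\<exists>w. parent y w")
  case True
  then obtain w w' where w: "parent y w" "parent z w'" "agree w w'" using agree_parent assms by blast
  then show ?thesis using parent_eq assms by simp
next
  case False
  have "agree z y" using assms(3) by (simp add: agree_def)
  then have "\<not> (\<exists>w. parent z w)" using False agree_parent assms by blast
  then show ?thesis using False assms(3) by (simp add: base_def)
qed

lemma agree_Bl: "agree (base y) (base z) \<Longrightarrow> Bl y = Bl z"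
  unfolding Bl_def using agree_dist[of "base y" "base z"] by presburger

text \<open>If \<open>y\<close> was raised from a center at \<open>i\<close>, then setting
  coordinate \<open>i\<close> of \<open>z\<close> to the value in that center yields a center again.
  So \<open>z\<close> is either a center itself or another child, with the same base up to free
  coordinates.\<close>

lemma Below_base:
  assumes y: "y \<in> vals" and z: "z \<in> Below y"
  shows "agree (base z) (base y)"
proof -
  have zv: "z \<in> vals" and zl: "\<And>l. l < n \<Longrightarrow> z ! l \<le> y ! l" "\<And>l. l < n \<Longrightarrow> f \<le> l \<Longrightarrow> base y ! l \<le> z ! l"
    using z by (auto simp: Below_def)
  show ?thesis using y
  proof (cases rule: base_cases)
    case orphan
    then have "agree z y" using zl unfolding agree_def by (metis antisym)
    then show ?thesis by (rule agree_base[OF zv y])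
  next
    case (child i s)
    let ?w = "y[i := s]"
    have wv: "?w \<in> vals" using vals_upd y child by blast
    have zi: "agree (z[i := s]) ?w"
      unfolding agree_def
    proof (intro allI impI)
      fix l assume l: "f \<le> l \<and> l < n"
      show "z[i := s] ! l = ?w ! l"
      proof (cases "l = i")
        case True then show ?thesis using l y zv by (simp add: upd_nth)
      next
        case False
        then have "y ! l \<le> z ! l" using zl(2)[of l] l child(5) by simp
        then show ?thesis using zl(1)[of l] l False by simp
      qed
    qed
    have si: "s \<le> z ! i" using zl(2)[of i] child vals_len[OF y] by simp
    have cz: "center (z[i := s])" using agree_center[OF vals_upd[OF zv child(3)] wv zi] child by simp
    show ?thesis
    proof (cases "s = z ! i")
      case True
      then have "z[i := s] = z" by simp
      then have "base z = z[i := s]" using cz center_base[OF zv] by simp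
      then show ?thesis using zi child by simp
    next
      case False
      then have "parent z (z[i := s])" using parentI[of i s z] child si cz by simp
      then show ?thesis using parent_eq[OF zv] zi child by simp
    qed
  qed
qed

lemma stable_free: assumes y: "y \<in> vals" and l: "l < f" shows "stable y l"
  unfolding stable_def
proof (intro ballI impI)
  fix b assume b: "b \<in> V" "y ! l < b"
  have a: "agree (base y) (base (y[l := b]))"
    using l by (intro agree_base[OF y vals_upd[OF y b(1)]]) (simp add: agree_def)
  have "Below y \<subseteq> Below (y[l := b])"
  proof
    fix z assume z: "z \<in> Below y"
    have "z ! i \<le> y[l := b] ! i" if "i < n" for i
    proof -
      have "z ! i \<le> y ! i" using z that by (simp add: Below_def)
      then show ?thesis using b upd_nth[OF y that] by auto
    qed
    then show "z \<in> Below (y[l := b])" using z a by (auto simp: Below_def agree_def)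
  qed
  then show "Bl (y[l := b]) = Bl y \<and> Below y \<subseteq> Below (y[l := b])" using agree_Bl[OF a] by simp
qed

text \<open>A further raise of a coordinate already raised from a center leaves the parent
  unchanged. The case \<open>s = y ! l\<close> covers a center itself, which becomes the parent of
  the raised vector.\<close>

lemma stable_raised:
  assumes y: "y \<in> vals" and l: "f \<le> l" "l < n" and s: "s \<in> V" "s \<le> y ! l" "base y = y[l := s]" "center (y[l := s])"
  shows "stable y l"
  unfolding stable_def
proof (intro ballI impI)
  fix b assume b: "b \<in> V" "y ! l < b"
  let ?y = "y[l := b]"
  have yv: "?y \<in> vals" using vals_upd y b by blast
  have "parent ?y (?y[l := s])" using parentI[of l s ?y] l s b vals_len[OF y] by simp
  then have e: "base ?y = base y" using parent_eq[OF yv] s by simp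
  have "Below y \<subseteq> Below ?y"
  proof
    fix z assume z: "z \<in> Below y"
    have "z ! i \<le> y[l := b] ! i" if "i < n" for i
    proof -
      have "z ! i \<le> y ! i" using z that by (simp add: Below_def)
      then show ?thesis using b upd_nth[OF y that] by auto
    qed
    then show "z \<in> Below ?y" using z e by (auto simp: Below_def)
  qed
  moreover have "Bl ?y = Bl y" using e by (simp add: Bl_def fun_eq_iff)
  ultimately show "Bl ?y = Bl y \<and> Below y \<subseteq> Below ?y" by blast
qed

lemma Below:
  assumes y: "y \<in> vals" and z: "z \<in> Below y"
  shows "z \<in> vals \<and> Bl z = Bl y \<and> (\<forall>l<n. z ! l \<le> y ! l \<and> (z ! l \<noteq> y ! l \<longrightarrow> stable y l))"
proof -
  have "stable y l" if l: "l < n" "z ! l \<noteq> y ! l" for l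
  proof (cases "l < f")
    case True then show ?thesis by (rule stable_free[OF y])
  next
    case False
    then have zl: "base y ! l \<le> z ! l" "z ! l < y ! l" using z l by (auto simp: Below_def less_le)
    from y show ?thesis
    proof (cases rule: base_cases)
      case orphan then show ?thesis using zl by simp
    next
      case (child i s)
      then have "i = l" using zl by (cases "i = l") auto
      then show ?thesis using stable_raised[OF y, of l s] child by simp
    qed
  qed
  then show ?thesis using z agree_Bl[OF Below_base[OF y z]] by (simp add: Below_def)
qed

lemma center_stable:
  assumes "w \<in> vals" "center w" "l < n" shows "stable w l"
proof (cases "l < f")
  case True then show ?thesis by (rule stable_free[OF assms(1)])
next
  case False
  then show ?thesis using stable_raised[of w l "w ! l"] assms center_base vals_nth by simp
qed

lemma center_own: "w \<in> vals \<Longrightarrow> center w \<Longrightarrow> w \<in> Bl w 0"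
  by (simp add: Bl_def center_base dist_def)

lemma Bl_all_free: "n \<le> f \<Longrightarrow> Bl y r = vals"
proof -
  assume "n \<le> f"
  then have "dist u w = card ({} :: nat set)" for u w unfolding dist_def by (intro arg_cong[of _ _ card]) auto
  then show ?thesis by (simp add: Bl_def)
qed

end


section \<open>Character sums over valuation vectors\<close>

lemma sum_prod_lists:
  fixes g :: "nat \<Rightarrow> 'a \<Rightarrow> 'b::comm_ring_1"
  assumes "finite V"
  shows "(\<Sum>y\<in>{y. length y = n \<and> set y \<subseteq> V}. \<Prod>l<n. g l (y ! l)) = (\<Prod>l<n. \<Sum>t\<in>V. g l t)"
proof (induction n arbitrary: g)
  case 0
  have "{y :: 'a list. length y = 0 \<and> set y \<subseteq> V} = {[]}" by auto
  then show ?case by simp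
next
  case (Suc n)
  let ?L = "{y. length y = n \<and> set y \<subseteq> V}"
  have e: "{y. length y = Suc n \<and> set y \<subseteq> V} = (\<lambda>(t, y). t # y) ` (V \<times> ?L)"
    by (auto simp: length_Suc_conv image_iff)
  have "(\<Sum>y\<in>{y. length y = Suc n \<and> set y \<subseteq> V}. \<Prod>l<Suc n. g l (y ! l)) =
     (\<Sum>(t, y)\<in>V \<times> ?L. g 0 t * (\<Prod>l<n. g (Suc l) (y ! l)))"
    unfolding e by (subst sum.reindex) (auto simp: inj_on_def prod.lessThan_Suc_shift simp del: prod.lessThan_Suc intro!: sum.cong)
  also have "\<dots> = (\<Sum>t\<in>V. g 0 t) * (\<Sum>y\<in>?L. \<Prod>l<n. g (Suc l) (y ! l))"
    by (simp add: sum.cartesian_product[symmetric] sum_product)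
  also have "\<dots> = (\<Prod>l<Suc n. \<Sum>t\<in>V. g l t)"
    by (subst Suc.IH) (simp add: prod.lessThan_Suc_shift del: prod.lessThan_Suc)
  finally show ?case .
qed

definition unity :: "nat \<Rightarrow> complex" where "unity m = cis (2 * pi / m)"

lemma unity_power: "1 \<le> m \<Longrightarrow> unity m ^ m = 1"
  by (simp add: unity_def DeMoivre)

lemma unity_eq_1: assumes "1 \<le> m" shows "unity m ^ s = 1 \<longleftrightarrow> m dvd s"
proof
  assume a: "unity m ^ s = 1"
  have "unity m ^ s = unity m ^ (m * (s div m) + s mod m)" by simp
  also have "\<dots> = unity m ^ (s mod m)"
    unfolding power_add power_mult unity_power[OF assms] by simp
  finally have "cis (2 * pi * real (s mod m) / real m) = cis (2 * pi * real 0 / real m)"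
    using a by (simp add: unity_def DeMoivre mult.commute)
  moreover have "inj_on (\<lambda>k. cis (2 * pi * real k / real m)) {..<m}"
    using bij_betw_roots_unity[of m] assms by (simp add: bij_betw_def)
  ultimately have "s mod m = 0" using assms
    by (intro inj_onD[of "\<lambda>k. cis (2 * pi * real k / real m)" "{..<m}" "s mod m" 0]) simp_all
  then show "m dvd s" by auto
next
  assume "m dvd s"
  then obtain c where "s = m * c" by (elim dvdE)
  then show "unity m ^ s = 1" by (simp only: power_mult unity_power[OF assms] power_one)
qed

lemma unity_sum: assumes "1 \<le> m" shows "(\<Sum>a<m. (unity m ^ s) ^ a) = (if m dvd s then of_nat m else 0)"
proof (cases "m dvd s")
  case True
  then have "unity m ^ s = 1" using unity_eq_1 assms by blast
  then show ?thesis using True by simp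
next
  case False
  then have "unity m ^ s \<noteq> 1" using unity_eq_1 assms by blast
  moreover have "(unity m ^ s) ^ m = 1"
    by (metis unity_power[OF assms] power_mult mult.commute power_one)
  ultimately show ?thesis using False by (simp add: geometric_sum)
qed

text \<open>The factors other than \<open>k\<close> cancel, since multiplication by \<open>k\<close> permutes the residues.\<close>

lemma prod_geometric:
  fixes z :: "nat \<Rightarrow> complex"
  assumes p: "1 \<le> p" "coprime k p" and per: "\<And>i. z (i mod p) = z i" and pow: "\<And>i. z i ^ k = z (k * i)"
  shows "(\<Prod>i\<in>{1..<p}. \<Sum>x<k. z i ^ x) = of_nat (k ^ card {i\<in>{1..<p}. z i = 1})"
proof -
  define I where "I = {i\<in>{1..<p}. z i \<noteq> 1}"
  define J where "J = {i\<in>{1..<p}. z i = 1}"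
  define h where "h i = k * i mod p" for i
  have IJ: "{1..<p} = I \<union> J" "I \<inter> J = {}" "finite I" "finite J" by (auto simp: I_def J_def)
  have inj: "inj_on h {1..<p}"
  proof
    fix i j assume ij: "i \<in> {1..<p}" "j \<in> {1..<p}" "h i = h j"
    then have "[k * i = k * j] (mod p)" by (simp add: h_def cong_def)
    then have "[i = j] (mod p)" using cong_mult_lcancel_nat[of k p] p(2) by blast
    then show "i = j" using ij by (simp add: cong_def)
  qed
  have hp: "h i \<in> {1..<p}" if "i \<in> {1..<p}" for i
  proof -
    have "\<not> p dvd k * i"
      using that p(2) by (auto simp: coprime_dvd_mult_right_iff coprime_commute dest: dvd_imp_le)
    then have "0 < h i" by (simp add: h_def dvd_eq_mod_eq_0)
    then show ?thesis using p(1) by (simp add: h_def Suc_le_eq)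
  qed
  have zh: "z (h i) = z i ^ k" for i unfolding h_def per pow ..
  have "h ` J \<subseteq> J" using hp zh by (auto simp: J_def)
  then have "h ` J = J" using inj IJ by (intro endo_inj_surj) (auto intro: inj_on_subset)
  moreover have "h ` {1..<p} = {1..<p}" using inj hp by (intro endo_inj_surj) auto
  ultimately have hI: "h ` I = I"
    using inj inj_on_image_set_diff[of h "{1..<p}" "{1..<p}" J] IJ
    by (metis Diff_cancel Diff_subset Un_Diff Diff_triv sup_bot.right_neutral sup_ge2)
  have injI: "inj_on h I" using inj IJ(1) by (metis Un_upper1 inj_on_subset)
  have "(\<Prod>i\<in>I. \<Sum>x<k. z i ^ x) = (\<Prod>i\<in>I. (z (h i) - 1) / (z i - 1))"
    using zh by (intro prod.cong) (auto simp: I_def geometric_sum)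
  also have "\<dots> = (\<Prod>i\<in>I. z (h i) - 1) / (\<Prod>i\<in>I. z i - 1)" by (rule prod_dividef)
  also have "(\<Prod>i\<in>I. z (h i) - 1) = (\<Prod>i\<in>h ` I. z i - 1)" using injI by (simp add: prod.reindex)
  also have "(\<Prod>i\<in>h ` I. z i - 1) / (\<Prod>i\<in>I. z i - 1) = 1"
    unfolding hI using IJ(3) by (simp add: prod_zero_iff) (auto simp: I_def)
  finally have 1: "(\<Prod>i\<in>I. \<Sum>x<k. z i ^ x) = 1" .
  have "(\<Prod>i\<in>J. \<Sum>x<k. z i ^ x) = (\<Prod>i\<in>J. of_nat k)" by (intro prod.cong) (auto simp: J_def)
  also have "\<dots> = of_nat (k ^ card J)" by simp
  finally show ?thesis
    unfolding IJ(1) J_def[symmetric] prod.union_disjoint[OF IJ(3,4,2)] 1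
    unfolding IJ(1)[symmetric] J_def[symmetric] by simp
qed


section \<open>Centers from two congruences\<close>

locale ranked =
  fixes n f k :: nat and V :: "real set" and lev :: "real \<Rightarrow> nat" and center :: "real list \<Rightarrow> bool"
  assumes f: "1 \<le> f" "f \<le> n" and cong1: "fact k dvd n - f"
    and lev: "bij_betw lev V {..<k}" and lev_less: "s \<in> V \<Longrightarrow> t \<in> V \<Longrightarrow> s < t \<Longrightarrow> lev s < lev t"
    and center: "y \<in> valuations n V \<Longrightarrow> center y \<longleftrightarrow> (k - 1) dvd (\<Sum>l\<in>{f..<n}. lev (y ! l)) \<and>
      (n - f + 1) dvd (\<Sum>l\<in>{f..<n}. (l - f + 1) * lev (y ! l))"
begin

abbreviation "p \<equiv> n - f + 1"

lemma lev_k: "t \<in> V \<Longrightarrow> lev t < k"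
  using lev by (auto simp: bij_betw_def)

text \<open>\<open>p\<close> exceeds a multiple of \<open>k!\<close> by one, so it shares no divisor
  with a number up to \<open>k\<close>.\<close>

lemma coprime_p: "1 \<le> d \<Longrightarrow> d \<le> k \<Longrightarrow> coprime d p"
proof -
  assume d: "1 \<le> d" "d \<le> k"
  then have "d dvd fact k" by (simp add: dvd_fact)
  then have "d dvd n - f" using cong1 by (rule dvd_trans)
  show ?thesis
  proof (rule coprimeI)
    fix x assume x: "x dvd d" "x dvd p"
    then have "x dvd n - f" using \<open>d dvd n - f\<close> dvd_trans by blast
    then show "is_unit x" using x(2) dvd_add_right_iff by blast
  qed
qed

text \<open>Both sums vanish at a center. At a vector raised from it they therefore reveal the rank
  difference modulo \<open>k - 1\<close>, and position times difference modulo
  \<open>p\<close>.\<close>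

lemma lowered:
  assumes y: "y \<in> valuations n V" and i: "f \<le> i" "i < n" and s: "s \<in> V" "s < y ! i" and c: "center (y[i := s])"
  shows "[(\<Sum>l\<in>{f..<n}. lev (y ! l)) = lev (y ! i) - lev s] (mod (k - 1))"
    "[(\<Sum>l\<in>{f..<n}. (l - f + 1) * lev (y ! l)) = (i - f + 1) * (lev (y ! i) - lev s)] (mod p)"
    "1 \<le> lev (y ! i) - lev s" "lev (y ! i) - lev s \<le> k - 1"
proof -
  have yi: "y ! i \<in> V" using y i by (auto simp: valuations_def)
  have ls: "lev s < lev (y ! i)" using lev_less s yi by blast
  show "1 \<le> lev (y ! i) - lev s" using ls by simp
  show "lev (y ! i) - lev s \<le> k - 1" using lev_k[OF yi] by simp
  have yv: "y[i := s] \<in> valuations n V"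
    using y s by (auto simp: valuations_def dest: set_update_subset_insert[THEN subsetD])
  have len: "length y = n" using y by (simp add: valuations_def)
  have e: "(\<Sum>l\<in>{f..<n}. g l * lev (y ! l)) = (\<Sum>l\<in>{f..<n}. g l * lev (y[i := s] ! l)) + g i * (lev (y ! i) - lev s)"
    for g :: "nat \<Rightarrow> nat"
  proof -
    have "(\<Sum>l\<in>{f..<n} - {i}. g l * lev (y[i := s] ! l)) = (\<Sum>l\<in>{f..<n} - {i}. g l * lev (y ! l))"
      by (intro sum.cong) auto
    moreover have "g i * lev (y ! i) = g i * lev s + g i * (lev (y ! i) - lev s)"
      using ls by (simp add: diff_mult_distrib2)
    ultimately show ?thesis using i len by (simp add: sum.remove[of "{f..<n}" i])
  qed
  have d: "(k - 1) dvd (\<Sum>l\<in>{f..<n}. lev (y[i := s] ! l))"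
     "p dvd (\<Sum>l\<in>{f..<n}. (l - f + 1) * lev (y[i := s] ! l))" using c center[OF yv] by auto
  have z: "[a + b = b] (mod m)" if "m dvd a" for a b m :: nat
    using that cong_add_rcancel_0_nat[of a b m] by (simp add: cong_0_iff)
  show "[(\<Sum>l\<in>{f..<n}. lev (y ! l)) = lev (y ! i) - lev s] (mod (k - 1))"
    using z[OF d(1)] e[of "\<lambda>_. 1"] by simp
  show "[(\<Sum>l\<in>{f..<n}. (l - f + 1) * lev (y ! l)) = (i - f + 1) * (lev (y ! i) - lev s)] (mod p)"
    unfolding e[of "\<lambda>l. l - f + 1"] by (rule z[OF d(2)])
qed

text \<open>The first congruence determines the rank difference; as it is coprime to
  \<open>p\<close>, it can be cancelled from the second, which then determines the position. A
  center cannot arise from another one by a raise, because position times difference is not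
  divisible by \<open>p\<close>.\<close>

sublocale unique_parents n f V center
proof
  fix y z assume yz: "y \<in> valuations n V" "z \<in> valuations n V" and e: "\<And>l. f \<le> l \<Longrightarrow> l < n \<Longrightarrow> y ! l = z ! l"
  show "center y = center z" unfolding center[OF yz(1)] center[OF yz(2)] using e by simp
next
  fix y i j s t
  assume a: "y \<in> valuations n V" "f \<le> i" "i < n" "f \<le> j" "j < n" "s \<in> V" "t \<in> V" "s < y ! i" "t < y ! j"
    "center (y[i := s])" "center (y[j := t])"
  note l1 = lowered[OF a(1-3,6,8,10)] and l2 = lowered[OF a(1,4,5,7,9,11)]
  let ?d = "lev (y ! i) - lev s" and ?e = "lev (y ! j) - lev t"
  have "[?d = ?e] (mod (k - 1))" by (rule cong_trans[OF cong_sym[OF l1(1)] l2(1)])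
  \<comment> \<open>The differences range over \<open>1, ..., k - 1\<close>. Shifted by one they lie
    below the modulus, where congruence means equality.\<close>
  then have "[?d - 1 + 1 = ?e - 1 + 1] (mod (k - 1))"
    unfolding le_add_diff_inverse2[OF l1(3)] le_add_diff_inverse2[OF l2(3)] .
  then have "[?d - 1 = ?e - 1] (mod (k - 1))" by (simp only: cong_add_rcancel_nat)
  moreover have "?d - 1 < k - 1" "?e - 1 < k - 1" using l1(3,4) l2(3,4) by auto
  ultimately have "?d - 1 = ?e - 1" by (simp only: cong_less_modulus_unique_nat)
  then have de: "?d = ?e" using l1(3) l2(3) by linarith
  have "[(i - f + 1) * ?d = (j - f + 1) * ?d] (mod p)" 
    using cong_trans[OF cong_sym[OF l1(2)] l2(2)] unfolding de .
  then have "[i - f + 1 = j - f + 1] (mod p)"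
    by (rule cong_mult_rcancel_nat[OF coprime_p, THEN iffD1, rotated 2]) (use l1(3,4) in linarith)+
  moreover have "i - f + 1 < p" "j - f + 1 < p" using a(2-5) by linarith+
  ultimately have "i - f + 1 = j - f + 1" by (simp only: cong_less_modulus_unique_nat)
  then have ij: "i = j" using a(2,4) by linarith
  have "lev s = lev t" using l1(3) l2(3) de unfolding ij by linarith
  moreover have "inj_on lev V" using lev by (simp add: bij_betw_def)
  ultimately have "s = t" using a(6,7) by (meson inj_onD)
  then show "i = j \<and> s = t" using ij by simp
next
  fix y i s
  assume a: "y \<in> valuations n V" "f \<le> i" "i < n" "s \<in> V" "s < y ! i" "center (y[i := s])"
  note l = lowered[OF a]
  show "\<not> center y"
  proof
    assume "center y"
    then have "p dvd (\<Sum>l\<in>{f..<n}. (l - f + 1) * lev (y ! l))" using center[OF a(1)] by simp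
    then have "p dvd (i - f + 1) * (lev (y ! i) - lev s)" using l(2) cong_dvd_iff by blast
    moreover have "coprime p (lev (y ! i) - lev s)"
      unfolding coprime_commute[of p] by (rule coprime_p) (use l(3,4) in linarith)+
    ultimately have "p dvd i - f + 1" by (simp only: coprime_dvd_mult_left_iff)
    then show False using a dvd_imp_le[of p "i - f + 1"] by simp
  qed
qed

text \<open>Both divisibilities are expanded into sums over roots of unity. Every pair of characters
  contributes a nonnegative integer, and the trivial pair alone contributes
  \<open>k ^ n\<close>.\<close>

theorem count_centers:
  assumes k: "2 \<le> k"
  shows "k ^ n \<le> (k - 1) * p * card {y \<in> valuations n V. center y}"
proof -
  let ?q = "k - 1" and ?L = "valuations n V"
  define w where "w = unity ?q"
  define z where "z = unity p"
  let ?S1 = "\<lambda>y. \<Sum>l\<in>{f..<n}. lev (y ! l)" and ?S2 = "\<lambda>y. \<Sum>l\<in>{f..<n}. (l - f + 1) * lev (y ! l)"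
  have q1: "1 \<le> ?q" "1 \<le> p" using k by auto
  have fV: "finite V" using lev bij_betw_finite by blast
  have fL: "finite ?L" using finite_lists_length_eq[OF fV, of n] unfolding valuations_def by (simp add: conj_commute)
  let ?c = "\<lambda>a b. card {i\<in>{1..<p}. w ^ a * z ^ (b * i) = 1}"
  have inner: "(\<Sum>y\<in>?L. (w ^ ?S1 y) ^ a * (z ^ ?S2 y) ^ b) = of_nat (k ^ f * k ^ ?c a b)" for a b
  proof -
    define g where "g l t = (if l < f then 1 else (w ^ a * z ^ (b * (l - f + 1))) ^ lev t)" for l t
    have "(w ^ ?S1 y) ^ a * (z ^ ?S2 y) ^ b = (\<Prod>l<n. g l (y ! l))" for y
    proof -
      have "(w ^ ?S1 y) ^ a * (z ^ ?S2 y) ^ b = (\<Prod>l\<in>{f..<n}. (w ^ lev (y ! l)) ^ a * (z ^ ((l - f + 1) * lev (y ! l))) ^ b)"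
        by (simp add: power_sum prod_power_distrib prod.distrib)
      also have "\<dots> = (\<Prod>l\<in>{f..<n}. g l (y ! l))"
      proof (rule prod.cong)
        fix l assume l: "l \<in> {f..<n}"
        let ?e = "l - f + 1" and ?x = "lev (y ! l)"
        have 1: "(w ^ ?x) ^ a = (w ^ a) ^ ?x" unfolding power_mult[symmetric] mult.commute[of ?x a] ..
        have "?e * ?x * b = b * ?e * ?x" by (rule trans[OF mult.commute mult.assoc[symmetric]])
        then have 2: "(z ^ (?e * ?x)) ^ b = (z ^ (b * ?e)) ^ ?x" unfolding power_mult[symmetric] by (rule arg_cong)
        have "g l (y ! l) = (w ^ a * z ^ (b * ?e)) ^ ?x" using l by (simp add: g_def)
        then show "(w ^ ?x) ^ a * (z ^ (?e * ?x)) ^ b = g l (y ! l)" unfolding 1 2 power_mult_distrib by (rule sym)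
      qed simp
      also have "\<dots> = (\<Prod>l<n. g l (y ! l))"
        by (intro prod.mono_neutral_left) (auto simp: g_def)
      finally show ?thesis .
    qed
    then have "(\<Sum>y\<in>?L. (w ^ ?S1 y) ^ a * (z ^ ?S2 y) ^ b) = (\<Sum>y\<in>?L. \<Prod>l<n. g l (y ! l))" by simp
    also have "\<dots> = (\<Prod>l<n. \<Sum>t\<in>V. g l t)"
      unfolding valuations_def by (rule sum_prod_lists[OF fV])
    also have "\<dots> = (\<Prod>l\<in>{..<f} \<union> {f..<n}. \<Sum>t\<in>V. g l t)"
      using f by (intro prod.cong) auto
    also have "\<dots> = (\<Prod>l<f. \<Sum>t\<in>V. g l t) * (\<Prod>l\<in>{f..<n}. \<Sum>t\<in>V. g l t)"
      by (rule prod.union_disjoint) auto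
    also have "(\<Prod>l<f. \<Sum>t\<in>V. g l t) = of_nat (k ^ f)"
      using bij_betw_same_card[OF lev] by (simp add: g_def)
    also have "(\<Prod>l\<in>{f..<n}. \<Sum>t\<in>V. g l t) = (\<Prod>l\<in>{f..<n}. \<Sum>x<k. (w ^ a * z ^ (b * (l - f + 1))) ^ x)"
    proof (rule prod.cong)
      fix l assume "l \<in> {f..<n}"
      then show "(\<Sum>t\<in>V. g l t) = (\<Sum>x<k. (w ^ a * z ^ (b * (l - f + 1))) ^ x)"
        using sum.reindex_bij_betw[OF lev, of "\<lambda>x. (w ^ a * z ^ (b * (l - f + 1))) ^ x"] by (simp add: g_def)
    qed simp
    also have "\<dots> = (\<Prod>i\<in>{1..<p}. \<Sum>x<k. (w ^ a * z ^ (b * i)) ^ x)"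
      using f by (intro prod.reindex_bij_witness[of _ "\<lambda>i. i + f - 1" "\<lambda>l. l - f + 1"]) auto
    also have "\<dots> = of_nat (k ^ ?c a b)"
    proof (rule prod_geometric[OF q1(2) coprime_p])
      have zp: "z ^ p = 1" unfolding z_def by (rule unity_power[OF q1(2)])
      have zm: "z ^ (p * j) = 1" for j unfolding power_mult zp by simp
      fix i
      have "b * i = b * (i mod p + p * (i div p))" by (simp only: mod_mult_div_eq)
      then have "b * i = b * (i mod p) + p * (b * (i div p))" unfolding distrib_left mult.left_commute[of b p] .
      then have "z ^ (b * i) = z ^ (b * (i mod p))" by (simp only: power_add zm mult_1_right)
      then show "w ^ a * z ^ (b * (i mod p)) = w ^ a * z ^ (b * i)" by simp
      have wq: "w ^ ?q = 1" unfolding w_def by (rule unity_power[OF q1(1)])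
      \<comment> \<open>The reason for the modulus \<open>k - 1\<close>: since
        \<open>w ^ k = w\<close>, taking \<open>k\<close>-th powers only permutes the factors of the
        product.\<close>
      have "w ^ k = w ^ Suc ?q" using k by simp
      then have "w ^ k = w" by (simp only: power_Suc wq mult_1_right)
      then have wk: "(w ^ a) ^ k = w ^ a" by (simp only: power_mult[symmetric] mult.commute[of a k]) (simp only: power_mult)
      have "b * i * k = b * (k * i)" by (simp only: ac_simps)
      then have "(z ^ (b * i)) ^ k = z ^ (b * (k * i))" unfolding power_mult[symmetric] by (rule arg_cong)
      then show "(w ^ a * z ^ (b * i)) ^ k = w ^ a * z ^ (b * (k * i))"
        unfolding power_mult_distrib wk by (rule arg_cong)
    qed (use k in auto)
    finally show ?thesis by simp
  qed
  have "of_nat (?q * p * card {y \<in> ?L. center y}) = (\<Sum>y\<in>?L. if center y then of_nat (?q * p) else (0::complex))"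
    using fL by (simp add: sum.If_cases Int_def)
  also have "\<dots> = (\<Sum>y\<in>?L. (\<Sum>a<?q. (w ^ ?S1 y) ^ a) * (\<Sum>b<p. (z ^ ?S2 y) ^ b))"
    by (intro sum.cong) (simp_all add: w_def z_def unity_sum[OF q1(1)] unity_sum[OF q1(2)] center del: One_nat_def)
  also have "\<dots> = (\<Sum>y\<in>?L. \<Sum>a<?q. \<Sum>b<p. (w ^ ?S1 y) ^ a * (z ^ ?S2 y) ^ b)"
    by (simp only: sum_product)
  also have "\<dots> = (\<Sum>a<?q. \<Sum>b<p. \<Sum>y\<in>?L. (w ^ ?S1 y) ^ a * (z ^ ?S2 y) ^ b)"
    by (subst sum.swap, intro sum.cong refl, subst sum.swap, rule refl)
  also have "\<dots> = of_nat (\<Sum>a<?q. \<Sum>b<p. k ^ f * k ^ ?c a b)" unfolding inner by simp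
  finally have e: "?q * p * card {y \<in> ?L. center y} = (\<Sum>a<?q. \<Sum>b<p. k ^ f * k ^ ?c a b)"
    by (simp only: of_nat_eq_iff)
  have "{i\<in>{1..<p}. w ^ 0 * z ^ (0 * i) = 1} = {1..<p}" by auto
  then have "?c 0 0 = n - f" by simp
  then have "k ^ n = k ^ f * k ^ ?c 0 0" using f by (simp add: power_add[symmetric])
  also have "\<dots> \<le> (\<Sum>b<p. k ^ f * k ^ ?c 0 b)" using q1 by (intro member_le_sum) auto
  also have "\<dots> \<le> (\<Sum>a<?q. \<Sum>b<p. k ^ f * k ^ ?c a b)"
    using q1 by (intro member_le_sum[of 0 "{..<?q}" "\<lambda>a. \<Sum>b<p. k ^ f * k ^ ?c a b"]) auto
  finally show ?thesis using e by simp
qed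

end


section \<open>Exhaustive search as an expression\<close>

text \<open>The first maximiser, in accordance with the strict comparison in
  \<open>bfold\<close>.\<close>

definition bidx :: "(nat \<Rightarrow> real) \<Rightarrow> nat \<Rightarrow> nat" where
  "bidx key m = (LEAST j. j < m \<and> (\<forall>i<m. key i \<le> key j))"

lemma bfold_first_max:
  assumes "\<forall>j<Suc m. 0 \<le> key j"
  shows "\<exists>j<Suc m. (\<forall>i<Suc m. key i \<le> key j) \<and> (\<forall>i<j. key i < key j) \<and> bfold key pay (Suc m) = (key j, pay j)"
  using assms
proof (induction m)
  case 0
  then show ?case by simp
next
  case (Suc m)
  then obtain j where j: "j < Suc m" "\<forall>i<Suc m. key i \<le> key j" "\<forall>i<j. key i < key j" "bfold key pay (Suc m) = (key j, pay j)"
    by auto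
  show ?case
  proof (cases "key j < key (Suc m)")
    case True
    then show ?thesis using j
      by (intro exI[of _ "Suc m"]) (auto simp: less_Suc_eq simp del: bfold.simps(2) simp add: bfold.simps(2)[of _ _ "Suc m"] intro: le_less_trans less_imp_le)
  next
    case False
    then show ?thesis using j
      by (intro exI[of _ j]) (auto simp: less_Suc_eq simp del: bfold.simps(2) simp add: bfold.simps(2)[of _ _ "Suc m"])
  qed
qed

lemma bfold_bidx:
  assumes "0 < m" "\<And>j. j < m \<Longrightarrow> 0 \<le> key j"
  shows "bidx key m < m" "\<And>i. i < m \<Longrightarrow> key i \<le> key (bidx key m)" "snd (bfold key pay m) = pay (bidx key m)"
proof -
  obtain m' where m: "m = Suc m'" using assms(1) gr0_implies_Suc by blast
  obtain j where j: "j < m" "\<forall>i<m. key i \<le> key j" "\<forall>i<j. key i < key j" "bfold key pay m = (key j, pay j)"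
    using bfold_first_max[of m' key pay] assms(2) unfolding m by blast
  have "bidx key m = j" unfolding bidx_def
  proof (rule Least_equality)
    fix i assume i: "i < m \<and> (\<forall>l<m. key l \<le> key i)"
    then have "key j \<le> key i" using j(1) by blast
    then show "j \<le> i" using j(3) by (meson not_le)
  qed (use j in blast)
  then show "bidx key m < m" "\<And>i. i < m \<Longrightarrow> key i \<le> key (bidx key m)" "snd (bfold key pay m) = pay (bidx key m)"
    using j by auto
qed

lemma bfold_cong: "(\<And>j. j < m \<Longrightarrow> key j = key' j) \<Longrightarrow> (\<And>j. j < m \<Longrightarrow> pay j = pay' j) \<Longrightarrow>
    bfold key pay m = bfold key' pay' m"
  by (induction m) auto

text \<open>Each entry \<open>m\<close> of the list is one step of the search, overwriting one of
  the first \<open>m\<close> coordinates by some value. Expressions evaluate to reals, so the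
  optimal value and the way to an optimal vector need separate recursions: \<open>srS\<close>
  follows the step from which \<open>mxS\<close> promises most.\<close>

primrec mxS :: "real list \<Rightarrow> nat list \<Rightarrow> (real list \<Rightarrow> real) \<Rightarrow> real list \<Rightarrow> real" where
  "mxS as [] G = (\<lambda>y. G y)"
| "mxS as (m # ms) G = (\<lambda>y.
     let g = (\<lambda>i c. mxS as ms G (y[i := as ! c])); h = (\<lambda>i. snd (bfold (g i) (g i) (length as)))
     in snd (bfold h h m))"

primrec srS :: "real list \<Rightarrow> nat list \<Rightarrow> (real list \<Rightarrow> real) \<Rightarrow> real list \<Rightarrow> real list" where
  "srS as [] G = (\<lambda>y. y)"
| "srS as (m # ms) G = (\<lambda>y.
     let g = (\<lambda>i c. mxS as ms G (y[i := as ! c])); h = (\<lambda>i. snd (bfold (g i) (g i) (length as)));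
         i = bidx h m
     in srS as ms G (y[i := as ! bidx (g i) (length as)]))"

primrec reach :: "real list \<Rightarrow> nat list \<Rightarrow> real list \<Rightarrow> real list set" where
  "reach as [] = (\<lambda>y. {y})"
| "reach as (m # ms) = (\<lambda>y. \<Union>i<m. \<Union>c<length as. reach as ms (y[i := as ! c]))"

lemma reach_vals: "y \<in> valuations n (set as) \<Longrightarrow> reach as ms y \<subseteq> valuations n (set as)"
proof (induction ms arbitrary: y)
  case (Cons m ms)
  have "y[i := as ! c] \<in> valuations n (set as)" if "c < length as" for i c
    using Cons.prems that by (auto simp: valuations_def dest: set_update_subset_insert[THEN subsetD])
  then show ?case using Cons.IH by auto
qed simp

lemma search:
  assumes as: "as \<noteq> []" and ms: "0 \<notin> set ms" and G: "\<And>u. u \<in> reach as ms y \<Longrightarrow> 0 \<le> G u"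
  shows "srS as ms G y \<in> reach as ms y" "G (srS as ms G y) = mxS as ms G y"
    "\<And>u. u \<in> reach as ms y \<Longrightarrow> G u \<le> mxS as ms G y" "0 \<le> mxS as ms G y"
  using ms G
proof (induction ms arbitrary: y)
  case Nil
  { case 1 then show ?case by simp next case 2 then show ?case by simp
  next case 3 then show ?case by simp next case 4 then show ?case by simp }
next
  case (Cons m ms)
  let ?k = "length as"
  have k: "0 < ?k" using as by simp
  have main: "srS as (m # ms) G y \<in> reach as (m # ms) y \<and> G (srS as (m # ms) G y) = mxS as (m # ms) G y \<and>
      (\<forall>u \<in> reach as (m # ms) y. G u \<le> mxS as (m # ms) G y) \<and> 0 \<le> mxS as (m # ms) G y"
    if prem: "0 \<notin> set (m # ms)" "\<And>u. u \<in> reach as (m # ms) y \<Longrightarrow> 0 \<le> G u" for y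
  proof -
  define g where "g i c = mxS as ms G (y[i := as ! c])" for i c
  define h where "h i = snd (bfold (g i) (g i) (length as))" for i
    have m: "0 < m" and ms: "0 \<notin> set ms" using prem(1) by auto
    have pos: "0 \<le> G u" if "i < m" "c < ?k" "u \<in> reach as ms (y[i := as ! c])" for i c u
      using prem(2) that by auto
    have g0: "0 \<le> g i c" if "i < m" "c < ?k" for i c
      unfolding g_def by (rule Cons.IH(4)[OF ms pos[OF that]])
    have hb: "bidx (g i) ?k < ?k" "\<And>c. c < ?k \<Longrightarrow> g i c \<le> h i" "h i = g i (bidx (g i) ?k)" if "i < m" for i
      using bfold_bidx(1,2)[OF k g0[OF that]] bfold_bidx(3)[OF k g0[OF that]] unfolding h_def by auto
    have h0: "0 \<le> h i" if "i < m" for i using hb[OF that] g0[OF that] by simp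
    let ?i = "bidx h m"
    let ?c = "bidx (g ?i) ?k"
    have i: "?i < m" "\<And>i. i < m \<Longrightarrow> h i \<le> h ?i" "snd (bfold h h m) = h ?i"
      using bfold_bidx(1,2)[OF m h0] bfold_bidx(3)[OF m h0] by auto
    have mx: "mxS as (m # ms) G y = h ?i" using i(3) by (simp add: Let_def g_def[abs_def] h_def[abs_def])
    have sr: "srS as (m # ms) G y = srS as ms G (y[?i := as ! ?c])"
      by (simp add: Let_def g_def[abs_def] h_def[abs_def])
    note c = hb(1)[OF i(1)]
    have "srS as (m # ms) G y \<in> reach as (m # ms) y"
      unfolding sr using Cons.IH(1)[OF ms pos[OF i(1) c]] i(1) c by auto
    moreover have "G (srS as (m # ms) G y) = mxS as (m # ms) G y"
      unfolding sr mx hb(3)[OF i(1)] by (subst g_def) (rule Cons.IH(2)[OF ms pos[OF i(1) c]])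
    moreover have "G u \<le> mxS as (m # ms) G y" if u: "u \<in> reach as (m # ms) y" for u
    proof -
      obtain j d where jd: "j < m" "d < ?k" "u \<in> reach as ms (y[j := as ! d])" using u by auto
      have "G u \<le> g j d" unfolding g_def by (rule Cons.IH(3)[OF jd(3) ms pos[OF jd(1,2)]])
      then show ?thesis using hb(2)[OF jd(1,2)] i(2)[OF jd(1)] unfolding mx by linarith
    qed
    moreover have "0 \<le> mxS as (m # ms) G y" unfolding mx by (rule h0[OF i(1)])
    ultimately show ?thesis by blast
  qed
  { case 1 show ?case by (rule main[OF 1, THEN conjunct1])
  next case 2 show ?case by (rule main[OF 2, THEN conjunct2, THEN conjunct1])
  next case 3 show ?case by (rule main[OF 3(2,3), THEN conjunct2, THEN conjunct2, THEN conjunct1, THEN bspec]) (use 3(1) in blast)+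
  next case 4 show ?case by (rule main[OF 4, THEN conjunct2, THEN conjunct2, THEN conjunct2]) }
qed

lemma reach_append: "reach as (ms @ ms') y = (\<Union>u\<in>reach as ms y. reach as ms' u)"
  by (induction ms arbitrary: y) auto

text \<open>A step may write the old value again, hence at most \<open>r\<close> changes rather than
  exactly \<open>r\<close>.\<close>

lemma reach_replicate:
  assumes y: "y \<in> valuations n (set as)" and N: "N \<le> n" "as \<noteq> []" "0 < N"
  shows "reach as (replicate r N) y =
    {u \<in> valuations n (set as). (\<forall>l. N \<le> l \<longrightarrow> l < n \<longrightarrow> u ! l = y ! l) \<and> card {l. l < N \<and> u ! l \<noteq> y ! l} \<le> r}"
  using y
proof (induction r arbitrary: y)
  case 0
  have "u = y" if "u \<in> valuations n (set as)" "\<forall>l. N \<le> l \<longrightarrow> l < n \<longrightarrow> u ! l = y ! l" "card {l. l < N \<and> u ! l \<noteq> y ! l} = 0" for u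
  proof (rule nth_equalityI)
    show "length u = length y" using that(1) 0 by (simp add: valuations_def)
    fix l assume "l < length u"
    then have "l < n" using that(1) by (simp add: valuations_def)
    moreover have "\<forall>l<N. u ! l = y ! l" using that(3) by auto
    ultimately show "u ! l = y ! l" using that(2) by (cases "l < N") auto
  qed
  then show ?case using 0 by auto
next
  case (Suc r)
  have len: "length y = n" using Suc.prems by (simp add: valuations_def)
  have upd: "y[i := as ! c] \<in> valuations n (set as)" if "c < length as" for i c
    using Suc.prems that by (auto simp: valuations_def dest: set_update_subset_insert[THEN subsetD])
  show ?case
  proof (intro equalityI subsetI)
    fix u assume "u \<in> reach as (replicate (Suc r) N) y"
    then obtain i c where ic: "i < N" "c < length as" "u \<in> reach as (replicate r N) (y[i := as ! c])" by auto
    then have u: "u \<in> valuations n (set as)" "\<forall>l. N \<le> l \<longrightarrow> l < n \<longrightarrow> u ! l = y[i := as ! c] ! l"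
      "card {l. l < N \<and> u ! l \<noteq> y[i := as ! c] ! l} \<le> r"
      using Suc.IH[OF upd[OF ic(2)]] by auto
    have "{l. l < N \<and> u ! l \<noteq> y ! l} \<subseteq> insert i {l. l < N \<and> u ! l \<noteq> y[i := as ! c] ! l}"
      using nth_list_update_neq by fastforce
    then have "card {l. l < N \<and> u ! l \<noteq> y ! l} \<le> card (insert i {l. l < N \<and> u ! l \<noteq> y[i := as ! c] ! l})"
      by (intro card_mono) auto
    also have "\<dots> \<le> Suc r" using u(3) by (simp add: card_insert_if)
    finally show "u \<in> {u \<in> valuations n (set as). (\<forall>l. N \<le> l \<longrightarrow> l < n \<longrightarrow> u ! l = y ! l) \<and> card {l. l < N \<and> u ! l \<noteq> y ! l} \<le> Suc r}"
      using u ic by auto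
  next
    fix u assume "u \<in> {u \<in> valuations n (set as). (\<forall>l. N \<le> l \<longrightarrow> l < n \<longrightarrow> u ! l = y ! l) \<and> card {l. l < N \<and> u ! l \<noteq> y ! l} \<le> Suc r}"
    then have u: "u \<in> valuations n (set as)" "\<forall>l. N \<le> l \<longrightarrow> l < n \<longrightarrow> u ! l = y ! l" "card {l. l < N \<and> u ! l \<noteq> y ! l} \<le> Suc r"
      by auto
    obtain i where i: "i < N" "i \<in> {l. l < N \<and> u ! l \<noteq> y ! l} \<or> {l. l < N \<and> u ! l \<noteq> y ! l} = {}"
      using N(3) by (cases "{l. l < N \<and> u ! l \<noteq> y ! l} = {}") (blast, auto)
    have "i < length u" using u(1) i(1) N by (simp add: valuations_def)
    then have "u ! i \<in> set u" by (rule nth_mem)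
    then have "u ! i \<in> set as" using u(1) by (auto simp: valuations_def)
    then obtain c where c: "c < length as" "as ! c = u ! i" by (auto simp: in_set_conv_nth)
    have e: "{l. l < N \<and> u ! l \<noteq> y[i := as ! c] ! l} = {l. l < N \<and> u ! l \<noteq> y ! l} - {i}"
      using c len i N by (auto simp: nth_list_update)
    have "card {l. l < N \<and> u ! l \<noteq> y[i := as ! c] ! l} \<le> r"
    proof (cases "i \<in> {l. l < N \<and> u ! l \<noteq> y ! l}")
      case True then show ?thesis unfolding e using u(3) by (subst card_Diff_singleton) auto
    next
      case False
      then have "{l. l < N \<and> u ! l \<noteq> y ! l} = {}" using i(2) by blast
      then show ?thesis unfolding e by (simp only: empty_Diff card.empty le0)
    qed
    then have "u \<in> reach as (replicate r N) (y[i := as ! c])"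
      unfolding Suc.IH[OF upd[OF c(1)]] using u i by auto
    then show "u \<in> reach as (replicate (Suc r) N) y"
      unfolding replicate_Suc reach.simps using i(1) c(1) by blast
  qed
qed

lemma reach_ball:
  assumes y: "y \<in> valuations n (set as)" and f: "1 \<le> f" "f \<le> n" "f \<le> F" and as: "as \<noteq> []"
  shows "reach as (replicate F f @ replicate r n) y = {u \<in> valuations n (set as). card {l. f \<le> l \<and> l < n \<and> y ! l \<noteq> u ! l} \<le> r}"
    (is "_ = ?B")
proof (intro equalityI subsetI)
  fix u assume "u \<in> reach as (replicate F f @ replicate r n) y"
  then obtain w where w: "w \<in> reach as (replicate F f) y" "u \<in> reach as (replicate r n) w"
    unfolding reach_append by blast
  have wv: "w \<in> valuations n (set as)" "\<forall>l. f \<le> l \<longrightarrow> l < n \<longrightarrow> w ! l = y ! l"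
    using w(1) reach_replicate[OF y, of f F] f as by auto
  have u: "u \<in> valuations n (set as)" "card {l. l < n \<and> u ! l \<noteq> w ! l} \<le> r"
    using w(2) reach_replicate[OF wv(1), of n r] f as by auto
  have "card {l. f \<le> l \<and> l < n \<and> y ! l \<noteq> u ! l} \<le> card {l. l < n \<and> u ! l \<noteq> w ! l}"
    using wv(2) by (intro card_mono) auto
  then show "u \<in> ?B" using u by simp
next
  fix u assume u: "u \<in> ?B"
  \<comment> \<open>The vector between the two phases: \<open>u\<close> on the free coordinates,
    \<open>y\<close> elsewhere. The second phase then spends no step on free coordinates.\<close>
  define w where "w = map (\<lambda>l. if l < f then u ! l else y ! l) [0..<n]"
  have lens: "length y = n" "length u = n" using y u by (auto simp: valuations_def)
  have wl: "w ! l = (if l < f then u ! l else y ! l)" if "l < n" for l using that by (simp add: w_def)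
  have wv: "w \<in> valuations n (set as)"
  proof -
    have "y ! l \<in> set as" "u ! l \<in> set as" if "l < n" for l
      using y u that lens by (auto simp: valuations_def)
    then show ?thesis by (auto simp: valuations_def w_def)
  qed
  have "card {l. l < f \<and> w ! l \<noteq> y ! l} \<le> card {..<f}" by (intro card_mono) auto
  then have "w \<in> reach as (replicate F f) y"
    using reach_replicate[OF y, of f F] f as wv wl by auto
  moreover have "{l. l < n \<and> u ! l \<noteq> w ! l} = {l. f \<le> l \<and> l < n \<and> y ! l \<noteq> u ! l}"
    by (auto simp: wl split: if_splits)
  then have "u \<in> reach as (replicate r n) w"
    using reach_replicate[OF wv, of n r] f as u by auto
  ultimately show "u \<in> reach as (replicate F f @ replicate r n) y" unfolding reach_append by blast
qed


section \<open>Legality of the queries and search expressions\<close>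

lemma qs_valuations:
  assumes f: "f \<le> n" "wfe e ks lv" and ix: "\<And>i. i < length ks \<Longrightarrow> ix i < (if ks ! i then n else length as)"
    and vs: "\<And>a. a < lv \<Longrightarrow> vs a \<in> valuations n (set as)"
  shows "set (qs n as f e ix vs) \<subseteq> valuations n (set as)"
  using assms(2-)
proof (induction e arbitrary: ks lv ix vs)
  case (Sum b x e)
  have bv: "j < (if kind b then n else length as)" if "j < bval n (length as) f ix b" for j
    using Sum.prems(1) Sum.prems(2)[of "case b of BX y \<Rightarrow> y | _ \<Rightarrow> 0"] that f(1) by (cases b) auto
  have ext: "(ix(x := j)) i < (if (ks @ [kind b]) ! i then n else length as)"
    if "j < bval n (length as) f ix b" "i < length (ks @ [kind b])" for i j
    using Sum.prems(1) Sum.prems(2)[of i] bv[OF that(1)] that(2)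
    by (cases "i < length ks") (auto simp: nth_append less_Suc_eq)
  have "set (qs n as f e (ix(x := j)) vs) \<subseteq> valuations n (set as)" if "j < bval n (length as) f ix b" for j
    using Sum.prems(1) by (intro Sum.IH[of "ks @ [kind b]" lv] Sum.prems(3) ext[OF that]) auto
  then show ?case by (simp add: UN_subset_iff)
next
  case (Best b x e1 e2)
  have bv: "j < (if kind b then n else length as)" if "j < bval n (length as) f ix b" for j
    using Best.prems(1) Best.prems(2)[of "case b of BX y \<Rightarrow> y | _ \<Rightarrow> 0"] that f(1) by (cases b) auto
  have ext: "(ix(x := j)) i < (if (ks @ [kind b]) ! i then n else length as)"
    if "j < bval n (length as) f ix b" "i < length (ks @ [kind b])" for i j
    using Best.prems(1) Best.prems(2)[of i] bv[OF that(1)] that(2)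
    by (cases "i < length ks") (auto simp: nth_append less_Suc_eq)
  have "set (qs n as f e1 (ix(x := j)) vs) \<subseteq> valuations n (set as)" if "j < bval n (length as) f ix b" for j
    using Best.prems(1) by (intro Best.IH(1)[of "ks @ [kind b]" lv] Best.prems(3) ext[OF that]) auto
  moreover have "set (qs n as f e2 (ix(x := j)) vs) \<subseteq> valuations n (set as)" if "j < bval n (length as) f ix b" for j
    using Best.prems(1) by (intro Best.IH(2)[of "ks @ [kind b]" lv] Best.prems(3) ext[OF that]) auto
  ultimately show ?case by (simp add: UN_subset_iff)
next
  case (Upd a' a i c e)
  have "ix c < length as" using Upd.prems(1) Upd.prems(2)[of c] by auto
  moreover have "vs a \<in> valuations n (set as)" using Upd.prems(1,3) by simp
  ultimately have u: "(vs a)[ix i := as ! ix c] \<in> valuations n (set as)"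
    by (auto simp: valuations_def dest: set_update_subset_insert[THEN subsetD])
  show ?case
    unfolding qs.simps
  proof (rule Upd.IH[of ks "Suc lv"])
    show "wfe e ks (Suc lv)" using Upd.prems(1) by simp
    show "(vs(a' := (vs a)[ix i := as ! ix c])) b \<in> valuations n (set as)" if "b < Suc lv" for b
      using u Upd.prems(1) Upd.prems(3)[of b] that by (cases "b = a'") auto
  qed (rule Upd.prems(2))
next
  case (Qry a i)
  then show ?case by simp
next
  case (Ifl e1 e2 e3 e4)
  then show ?case unfolding qs.simps set_append Un_subset_iff wfe.simps by blast
next
  case (Add e1 e2)
  then show ?case unfolding qs.simps set_append Un_subset_iff wfe.simps by blast
next
  case (Sub e1 e2)
  then show ?case unfolding qs.simps set_append Un_subset_iff wfe.simps by blast
next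
  case (Mul e1 e2)
  then show ?case unfolding qs.simps set_append Un_subset_iff wfe.simps by blast
next
  case (Div e1 e2)
  then show ?case unfolding qs.simps set_append Un_subset_iff wfe.simps by blast
qed simp_all

text \<open>\<open>x\<close> is the next index variable and \<open>a\<close> the current vector; the
  continuation \<open>K\<close> receives them after the last step. With key and returned value
  equal, \<open>Best\<close> yields the maximum. Duplicated subexpressions are harmless since the
  number of steps is constant.\<close>

primrec mxE :: "bnd list \<Rightarrow> (nat \<Rightarrow> nat \<Rightarrow> expr) \<Rightarrow> nat \<Rightarrow> nat \<Rightarrow> expr" where
  "mxE [] K = (\<lambda>x a. K x a)"
| "mxE (b # bs) K = (\<lambda>x a.
     let g = Upd (Suc a) a x (Suc x) (mxE bs K (Suc (Suc x)) (Suc a)); h = Best BK (Suc x) g g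
     in Best b x h h)"

primrec srE :: "bnd list \<Rightarrow> (nat \<Rightarrow> nat \<Rightarrow> expr) \<Rightarrow> (nat \<Rightarrow> nat \<Rightarrow> expr) \<Rightarrow> nat \<Rightarrow> nat \<Rightarrow> expr" where
  "srE [] K Q = (\<lambda>x a. Q x a)"
| "srE (b # bs) K Q = (\<lambda>x a.
     let g = Upd (Suc a) a x (Suc x) (mxE bs K (Suc (Suc x)) (Suc a)); h = Best BK (Suc x) g g
     in Best b x h (Best BK (Suc x) g (Upd (Suc a) a x (Suc x) (srE bs K Q (Suc (Suc x)) (Suc a)))))"

text \<open>Quantifies over all extensions of the context, because a search calls its continuation
  under further binders.\<close>

definition wfK :: "(nat \<Rightarrow> nat \<Rightarrow> expr) \<Rightarrow> bool list \<Rightarrow> nat \<Rightarrow> bool" where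
  "wfK K ks a \<longleftrightarrow> (\<forall>ks' a'. a \<le> a' \<longrightarrow> wfe (K (length (ks @ ks')) a') (ks @ ks') (Suc a'))"

lemma wfKI: "(\<And>ks' a'. a \<le> a' \<Longrightarrow> wfe (K (length (ks @ ks')) a') (ks @ ks') (Suc a')) \<Longrightarrow> wfK K ks a"
  by (simp add: wfK_def)

lemma wfK_ext: "wfK K ks a \<Longrightarrow> a \<le> a' \<Longrightarrow> wfK K (ks @ ks') a'"
  unfolding wfK_def by (metis append.assoc le_trans)

lemma wfKD: "wfK K ks a \<Longrightarrow> wfe (K (length ks) a) ks (Suc a)"
  unfolding wfK_def by (metis append_Nil2 le_refl)

lemma wf_mxE: "wfK K ks a \<Longrightarrow> set bs \<subseteq> {BN, BF} \<Longrightarrow> wfe (mxE bs K (length ks) a) ks (Suc a)"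
proof (induction bs arbitrary: ks a)
  case Nil then show ?case by (simp add: wfKD)
next
  case (Cons b bs)
  have "wfe (mxE bs K (length (ks @ [True, False])) (Suc a)) (ks @ [True, False]) (Suc (Suc a))"
    using Cons.prems by (intro Cons.IH wfK_ext) auto
  then show ?case using Cons.prems(2) by (auto simp: Let_def nth_append)
qed

lemma wf_srE: "wfK K ks a \<Longrightarrow> wfK Q ks a \<Longrightarrow> set bs \<subseteq> {BN, BF} \<Longrightarrow> wfe (srE bs K Q (length ks) a) ks (Suc a)"
proof (induction bs arbitrary: ks a)
  case Nil then show ?case by (simp add: wfKD)
next
  case (Cons b bs)
  have "wfe (mxE bs K (length (ks @ [True, False])) (Suc a)) (ks @ [True, False]) (Suc (Suc a))"
    using Cons.prems by (intro wf_mxE wfK_ext) auto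
  moreover have "wfe (srE bs K Q (length (ks @ [True, False])) (Suc a)) (ks @ [True, False]) (Suc (Suc a))"
    using Cons.prems by (intro Cons.IH wfK_ext) auto
  ultimately show ?case using Cons.prems(3) by (auto simp: Let_def nth_append)
qed


locale lang =
  fixes n f :: nat and as :: "real list" and A :: "real list \<Rightarrow> real list"
  assumes n: "1 \<le> n" and f: "1 \<le> f" "f \<le> n" and as: "as \<noteq> []"
begin

abbreviation "vals \<equiv> valuations n (set as)"
abbreviation "ev' \<equiv> ev n as f A"

definition bv :: "bnd \<Rightarrow> nat" where "bv b = (if b = BF then f else n)"

lemma bv: "b \<in> {BN, BF} \<Longrightarrow> bval n k f ix b = bv b"
  by (auto simp: bv_def)
lemma bv_pos: "0 < bv b" using n f by (auto simp: bv_def)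

text \<open>In every extension of the environment the continuation has to be a function of the
  current vector alone; only then does a search over vectors make sense.\<close>

definition evK :: "(nat \<Rightarrow> nat \<Rightarrow> expr) \<Rightarrow> nat \<Rightarrow> nat \<Rightarrow> (nat \<Rightarrow> nat) \<Rightarrow> (nat \<Rightarrow> real list) \<Rightarrow> (real list \<Rightarrow> real) \<Rightarrow> bool" where
  "evK K x a ix vs G \<longleftrightarrow> (\<forall>x' a' ix' vs'. x \<le> x' \<longrightarrow> a \<le> a' \<longrightarrow> (\<forall>i<x. ix' i = ix i) \<longrightarrow> (\<forall>b\<le>a. vs' b = vs b) \<longrightarrow>
     vs' a' \<in> vals \<longrightarrow> ev' (K x' a') ix' vs' = G (vs' a'))"

lemma evKI: "(\<And>x' a' ix' vs'. x \<le> x' \<Longrightarrow> a \<le> a' \<Longrightarrow> (\<And>i. i < x \<Longrightarrow> ix' i = ix i) \<Longrightarrow> (\<And>b. b \<le> a \<Longrightarrow> vs' b = vs b) \<Longrightarrow>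
     vs' a' \<in> vals \<Longrightarrow> ev' (K x' a') ix' vs' = G (vs' a')) \<Longrightarrow> evK K x a ix vs G"
  by (simp add: evK_def)

lemma evKD: "evK K x a ix vs G \<Longrightarrow> vs a \<in> vals \<Longrightarrow> ev' (K x a) ix vs = G (vs a)"
  by (simp add: evK_def)

lemma evK_ext: "evK K x a ix vs G \<Longrightarrow> x \<le> x' \<Longrightarrow> a \<le> a' \<Longrightarrow> (\<And>i. i < x \<Longrightarrow> ix' i = ix i) \<Longrightarrow>
    (\<And>b. b \<le> a \<Longrightarrow> vs' b = vs b) \<Longrightarrow> evK K x' a' ix' vs' G"
  unfolding evK_def by (smt (verit, best) le_trans less_le_trans)

lemma vals_upd: "y \<in> vals \<Longrightarrow> c < length as \<Longrightarrow> y[i := as ! c] \<in> vals"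
  by (auto simp: valuations_def dest: set_update_subset_insert[THEN subsetD])

lemma ev_mxE: "evK K x a ix vs G \<Longrightarrow> vs a \<in> vals \<Longrightarrow> set bs \<subseteq> {BN, BF} \<Longrightarrow>
    ev' (mxE bs K x a) ix vs = mxS as (map bv bs) G (vs a)"
proof (induction bs arbitrary: x a ix vs)
  case Nil then show ?case by (simp add: evKD)
next
  case (Cons b bs)
  have e: "ev' (mxE bs K (Suc (Suc x)) (Suc a)) (ix(x := i, Suc x := c)) (vs(Suc a := (vs a)[i := as ! c])) =
      mxS as (map bv bs) G ((vs a)[i := as ! c])" if "c < length as" for i c
    using Cons.prems that vals_upd[of "vs a" c i]
    by (subst Cons.IH[OF evK_ext[OF Cons.prems(1)]]) auto
  have "bval n (length as) f ix b = bv b" using bv Cons.prems(3) by simp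
  then show ?case
    by (auto simp: Let_def e intro!: arg_cong[of _ _ snd] bfold_cong)
qed

lemma ev_srE: "evK K x a ix vs G \<Longrightarrow> evK Q x a ix vs H \<Longrightarrow> vs a \<in> vals \<Longrightarrow> set bs \<subseteq> {BN, BF} \<Longrightarrow>
    (\<And>u. u \<in> vals \<Longrightarrow> 0 \<le> G u) \<Longrightarrow> ev' (srE bs K Q x a) ix vs = H (srS as (map bv bs) G (vs a))"
proof (induction bs arbitrary: x a ix vs)
  case Nil then show ?case by (simp add: evKD)
next
  case (Cons b bs)
  have m: "ev' (mxE bs K (Suc (Suc x)) (Suc a)) (ix(x := i, Suc x := c)) (vs(Suc a := (vs a)[i := as ! c])) =
      mxS as (map bv bs) G ((vs a)[i := as ! c])" if "c < length as" for i c
    using Cons.prems that vals_upd[of "vs a" c i]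
    by (subst ev_mxE[OF evK_ext[OF Cons.prems(1)]]) auto
  have s: "ev' (srE bs K Q (Suc (Suc x)) (Suc a)) (ix(x := i, Suc x := c)) (vs(Suc a := (vs a)[i := as ! c])) =
      H (srS as (map bv bs) G ((vs a)[i := as ! c]))" if "c < length as" for i c
    using Cons.prems(3-5) that vals_upd[of "vs a" c i]
    by (subst Cons.IH[OF evK_ext[OF Cons.prems(1)] evK_ext[OF Cons.prems(2)]]) auto
  define g where "g i c = mxS as (map bv bs) G ((vs a)[i := as ! c])" for i c
  define h where "h i = snd (bfold (g i) (g i) (length as))" for i
  define H' where "H' i c = H (srS as (map bv bs) G ((vs a)[i := as ! c]))" for i c
  have "bval n (length as) f ix b = bv b" using bv Cons.prems(4) by simp
  then have "ev' (srE (b # bs) K Q x a) ix vs = snd (bfold h (\<lambda>i. snd (bfold (g i) (H' i) (length as))) (bv b))"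
    by (auto simp: Let_def m s g_def h_def H'_def intro!: arg_cong[of _ _ snd] bfold_cong)
  moreover have k: "0 < length as" using as by simp
  have g0: "0 \<le> g i c" if "c < length as" for i c
    unfolding g_def using reach_vals[OF vals_upd[OF Cons.prems(3) that]] Cons.prems(5) bv_pos
    by (intro search(4)[OF as]) (auto simp: image_iff intro: less_not_refl2[symmetric])
  have hb: "h i = g i (bidx (g i) (length as))" "bidx (g i) (length as) < length as" for i
    using bfold_bidx(1)[OF k g0] bfold_bidx(3)[OF k g0] by (auto simp: h_def)
  have h0: "0 \<le> h i" for i using hb g0 by simp
  have "snd (bfold h (\<lambda>i. snd (bfold (g i) (H' i) (length as))) (bv b)) = H' (bidx h (bv b)) (bidx (g (bidx h (bv b))) (length as))"
    using bfold_bidx(3)[OF bv_pos h0] bfold_bidx(3)[OF k g0] by simp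
  ultimately show ?case by (simp add: Let_def H'_def g_def[abs_def] h_def[abs_def])
qed

end


section \<open>The transformation as an expression\<close>

abbreviation "num0 \<equiv> Num 0 1"
abbreviation "num1 \<equiv> Num 1 1"

text \<open>Expressions cannot read an index variable as a number; adding up ones does it.\<close>

definition cntE :: "bnd \<Rightarrow> nat \<Rightarrow> expr" where "cntE b x = Sum b x num1"
definition eqE :: "expr \<Rightarrow> expr \<Rightarrow> expr" where "eqE u v = Ifl u v num0 (Ifl v u num0 num1)"

definition rkE :: "nat \<Rightarrow> nat \<Rightarrow> nat \<Rightarrow> expr" where
  "rkE a i x = Sum BK x (Ifl num0 (As x) (Ifl (Val a i) (As x) num0 num1) num0)"

text \<open>Counts positions in the list, so repeated values make the ranks skip numbers. On
  positive values they still increase strictly and stay in \<open>{1..k}\<close>.\<close>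

definition rk :: "real list \<Rightarrow> real \<Rightarrow> nat" where
  "rk as t = card {c. c < length as \<and> 0 < as ! c \<and> as ! c \<le> t}"

definition fixedE :: "nat \<Rightarrow> expr \<Rightarrow> expr" where
  "fixedE x e = Ifl (cntE (BX x) (Suc x)) (cntE BF (Suc x)) num0 e"

definition lowE :: "nat \<Rightarrow> nat \<Rightarrow> nat \<Rightarrow> expr" where
  "lowE y w x = Sum BN x (fixedE x (Ifl (Val w x) (Val y x) num1 num0))"
definition neqE :: "nat \<Rightarrow> nat \<Rightarrow> nat \<Rightarrow> expr" where
  "neqE y w x = Sum BN x (Ifl (Val w x) (Val y x) num1 (Ifl (Val y x) (Val w x) num1 num0))"
definition violE :: "nat \<Rightarrow> nat \<Rightarrow> nat \<Rightarrow> nat \<Rightarrow> expr" where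
  "violE y b z x = Sum BN x (Add (Ifl (Val y x) (Val z x) num1 num0) (fixedE x (Ifl (Val z x) (Val b x) num1 num0)))"

definition sum1E :: "nat \<Rightarrow> nat \<Rightarrow> expr" where
  "sum1E a x = Sum BN x (fixedE x (Sub (rkE a x (Suc x)) num1))"
definition sum2E :: "nat \<Rightarrow> nat \<Rightarrow> expr" where
  "sum2E a x = Sum BN x (fixedE x (Mul (Add (Sub (cntE (BX x) (Suc x)) (cntE BF (Suc x))) num1) (Sub (rkE a x (Suc x)) num1)))"

text \<open>With \<open>c = 1 / C\<close> all numbers become rational: \<open>S p\<close> is
  \<open>1 / kap p\<close>, \<open>M\<close> is \<open>24 / xm\<close> so that
  \<open>th = (M - 1) / M\<close>, and \<open>Gam\<close> is \<open>4 / xm\<close>. Without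
  \<open>flag\<close> there are no centers.\<close>

locale params =
  fixes k C D :: nat and flag :: bool
begin

definition F :: nat where "F = fact k"
definition S :: "nat \<Rightarrow> nat" where "S p = (64 * C) ^ p"
definition M :: nat where "M = 192 * C * S k"
definition Gam :: nat where "Gam = 32 * C * S k"
definition Rr :: "nat \<Rightarrow> nat \<Rightarrow> nat" where "Rr p t = D + 3 * ((k + 1) * t + (k - p))"
definition Rm :: nat where "Rm = D + 3 * ((k + 1) * k + k)"

definition farC :: "nat \<Rightarrow> nat \<Rightarrow> nat \<Rightarrow> expr" where
  "farC p r t = (if r \<le> Rr p t then Num ((M - 1) ^ D * Gam ^ t) (M ^ D) else num0)"

text \<open>Cutoffs and powers of \<open>Gam\<close> are constants of the program, whereas the rank
  is known only at run time; hence a case distinction over the possible ranks.\<close>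

primrec farE :: "nat \<Rightarrow> nat \<Rightarrow> nat \<Rightarrow> nat \<Rightarrow> nat \<Rightarrow> nat \<Rightarrow> expr" where
  "farE p r a i x 0 = farC p r 0"
| "farE p r a i x (Suc t) = Ifl (Num t 1) (rkE a i x) (farC p r (Suc t)) (farE p r a i x t)"

definition phiE :: "nat \<Rightarrow> nat \<Rightarrow> nat \<Rightarrow> nat \<Rightarrow> nat \<Rightarrow> expr" where
  "phiE p r a i x = Ifl num0 (Val a i) (if r \<le> D then Num ((M - 1) ^ r) (M ^ r) else farE p r a i x k) num0"

definition termE :: "nat \<Rightarrow> nat \<Rightarrow> nat \<Rightarrow> nat \<Rightarrow> nat \<Rightarrow> expr" where
  "termE p r y u x = Mul (Mul (phiE p r y x (Suc x)) (Val y x)) (Qry u x)"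

definition scE :: "nat \<Rightarrow> nat \<Rightarrow> nat \<Rightarrow> nat \<Rightarrow> nat \<Rightarrow> expr" where
  "scE p r y x u = Sum BN x (termE p r y u x)"
definition lsE :: "nat \<Rightarrow> nat \<Rightarrow> nat \<Rightarrow> nat \<Rightarrow> nat \<Rightarrow> expr" where
  "lsE p r y x u = Sum BN x (Ifl (rkE y x (Suc x)) (Num p 1) num0 (termE p r y u x))"

text \<open>Divisibility is tested by trying quotients. The \<open>n - f\<close> levels are at most
  \<open>k - 1\<close> each, so all quotients are below \<open>n\<close>.\<close>

definition center1E :: "nat \<Rightarrow> nat \<Rightarrow> expr" where
  "center1E a x = Sum BN x (eqE (sum1E a (Suc x)) (Mul (cntE (BX x) (Suc x)) (Num (k - 1) 1)))"
text \<open>The quotients of the weighted sum by \<open>n - f + 1\<close> are below \<open>n\<^sup>2\<close>, hence two loops.\<close>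

definition center2E :: "nat \<Rightarrow> nat \<Rightarrow> expr" where
  "center2E a x = Sum BN x (Sum BN (Suc x) (eqE (sum2E a (Suc (Suc x)))
     (Mul (Add (Mul (cntE (BX x) (Suc (Suc x))) (cntE BN (Suc (Suc x)))) (cntE (BX (Suc x)) (Suc (Suc x))))
       (Add (Sub (cntE BN (Suc (Suc x))) (cntE BF (Suc (Suc x)))) num1))))"

text \<open>Maximised over the vectors that differ from \<open>y\<close> in at most one place, this
  key finds a center from which \<open>y\<close> was raised if there is one, and \<open>y\<close>
  itself otherwise.\<close>

definition keyB :: "nat \<Rightarrow> nat \<Rightarrow> nat \<Rightarrow> expr" where
  "keyB y x w = Ifl num0 (if flag then Mul (Mul (center1E w x) (center2E w x)) (lowE y w x) else num0) (Num 2 1)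
     (Ifl num0 (neqE y w x) num0 num1)"

definition baseE :: "(nat \<Rightarrow> nat \<Rightarrow> expr) \<Rightarrow> nat \<Rightarrow> nat \<Rightarrow> expr" where
  "baseE Q x a = srE [BN] (keyB a) Q x a"

text \<open>There are at most \<open>F\<close> free coordinates, so \<open>F\<close> steps suffice to set them arbitrarily.\<close>

definition stp :: "nat \<Rightarrow> bnd list" where "stp r = replicate F BF @ replicate r BN"

text \<open>The distances are unrolled into the program: each has its own list of steps and its own
  weights, and their number is constant.\<close>

primrec rmE :: "(nat \<Rightarrow> nat \<Rightarrow> nat \<Rightarrow> expr) \<Rightarrow> nat \<Rightarrow> nat \<Rightarrow> nat \<Rightarrow> expr" where
  "rmE K 0 = mxE (stp 0) (K 0)"
| "rmE K (Suc r) = (\<lambda>x b. let e = rmE K r x b; m = mxE (stp (Suc r)) (K (Suc r)) x b in Ifl e m m e)"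

primrec rsE :: "(nat \<Rightarrow> nat \<Rightarrow> nat \<Rightarrow> expr) \<Rightarrow> (nat \<Rightarrow> nat \<Rightarrow> nat \<Rightarrow> expr) \<Rightarrow> nat \<Rightarrow> nat \<Rightarrow> nat \<Rightarrow> expr" where
  "rsE K Q 0 = srE (stp 0) (K 0) (Q 0)"
| "rsE K Q (Suc r) = (\<lambda>x b. Ifl (rmE K r x b) (mxE (stp (Suc r)) (K (Suc r)) x b)
     (srE (stp (Suc r)) (K (Suc r)) (Q (Suc r)) x b) (rsE K Q r x b))"

text \<open>The score of options that are not good, and zero otherwise. Validity thereby becomes a
  comparison of two maxima.\<close>

definition badE :: "nat \<Rightarrow> nat \<Rightarrow> nat \<Rightarrow> nat \<Rightarrow> nat \<Rightarrow> expr" where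
  "badE p z r x u = Ifl (lsE p r z x u) (Mul (Num 1 (S p)) (scE p r z x u)) (scE p r z x u) num0"

definition validE :: "nat \<Rightarrow> nat \<Rightarrow> nat \<Rightarrow> expr" where
  "validE p x z = baseE (\<lambda>x b. Ifl (rmE (badE p z) Rm x b)
     (Mul (Num (S p - 1) (S p)) (rmE (\<lambda>r. scE p r z) Rm x b)) num1 num0) x z"

text \<open>All of \<open>Below\<close> lies within distance 1 of the base, so this search is
  exhaustive; vectors outside \<open>Below\<close> are given the key 0.\<close>

definition reliableE :: "nat \<Rightarrow> nat \<Rightarrow> nat \<Rightarrow> expr" where
  "reliableE p x y = baseE (\<lambda>x b. mxE (stp 1) (\<lambda>x z. Ifl num0 (violE y b z x) num0 (validE p x z)) x b) x y"

definition payE :: "nat \<Rightarrow> nat \<Rightarrow> nat \<Rightarrow> nat \<Rightarrow> nat \<Rightarrow> expr" where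
  "payE p y r x u = Mul (Mul (Num (if r \<le> D then 1 else 2) 1) (phiE p r y 0 x)) (Qry u 0)"

definition pickE :: "nat \<Rightarrow> nat \<Rightarrow> nat \<Rightarrow> expr" where
  "pickE p x y = baseE (\<lambda>x b. rsE (\<lambda>r. scE p r y) (payE p y) Rm x b) x y"

primrec xiE :: "nat \<Rightarrow> nat \<Rightarrow> nat \<Rightarrow> expr" where
  "xiE 0 = (\<lambda>x y. pickE 1 x y)"
| "xiE (Suc q) = (\<lambda>x y. Ifl num0 (reliableE (Suc q) x y) (pickE (Suc q) x y) (xiE q x y))"

text \<open>A minimum expressed as a maximum: on nonnegative amounts \<open>e\<close> the key
  \<open>1 / (1 + e)\<close> is positive and decreasing. Values below the declared one get the key 0
  and never win, since the declared value itself has a positive key.\<close>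

definition outE :: expr where
  "outE = (let e = Upd 1 0 0 1 (xiE k 2 1) in
     Best BK 1 (Ifl (As 1) (Val 0 0) num0 (Div num1 (Add num1 e))) e)"

lemma wf_cnt: "x = length ks \<Longrightarrow> wfb ks b \<Longrightarrow> wfe (cntE b x) ks lv"
  by (simp add: cntE_def)
lemma wf_rk: "x = length ks \<Longrightarrow> a < lv \<Longrightarrow> i < length ks \<Longrightarrow> ks ! i \<Longrightarrow> wfe (rkE a i x) ks lv"
  by (simp add: rkE_def nth_append)
lemma wf_fixed: "Suc x = length ks \<Longrightarrow> ks ! x \<Longrightarrow> wfe e ks lv \<Longrightarrow> wfe (fixedE x e) ks lv"
  by (simp add: fixedE_def wf_cnt)
lemma wf_far: "x = length ks \<Longrightarrow> a < lv \<Longrightarrow> i < length ks \<Longrightarrow> ks ! i \<Longrightarrow> wfe (farE p r a i x t) ks lv"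
  by (induction t) (simp_all add: farC_def wf_rk)
lemma wf_phi: "x = length ks \<Longrightarrow> a < lv \<Longrightarrow> i < length ks \<Longrightarrow> ks ! i \<Longrightarrow> wfe (phiE p r a i x) ks lv"
  by (simp add: phiE_def wf_far)
lemma wf_sc: "x = length ks \<Longrightarrow> y < lv \<Longrightarrow> u < lv \<Longrightarrow> wfe (scE p r y x u) ks lv"
  by (simp add: scE_def termE_def wf_phi nth_append)
lemma wf_ls: "x = length ks \<Longrightarrow> y < lv \<Longrightarrow> u < lv \<Longrightarrow> wfe (lsE p r y x u) ks lv"
  by (simp add: lsE_def termE_def wf_phi wf_rk nth_append)
lemma wf_low: "x = length ks \<Longrightarrow> y < lv \<Longrightarrow> u < lv \<Longrightarrow> wfe (lowE y u x) ks lv"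
  by (simp add: lowE_def wf_fixed nth_append)
lemma wf_neq: "x = length ks \<Longrightarrow> y < lv \<Longrightarrow> u < lv \<Longrightarrow> wfe (neqE y u x) ks lv"
  by (simp add: neqE_def nth_append)
lemma wf_viol: "x = length ks \<Longrightarrow> y < lv \<Longrightarrow> b < lv \<Longrightarrow> z < lv \<Longrightarrow> wfe (violE y b z x) ks lv"
  by (simp add: violE_def wf_fixed nth_append)
lemma wf_sum1: "x = length ks \<Longrightarrow> a < lv \<Longrightarrow> wfe (sum1E a x) ks lv"
  by (simp add: sum1E_def wf_fixed wf_rk nth_append)
lemma wf_sum2: "x = length ks \<Longrightarrow> a < lv \<Longrightarrow> wfe (sum2E a x) ks lv"
  by (simp add: sum2E_def wf_fixed wf_cnt wf_rk nth_append)
lemma wf_center1: "x = length ks \<Longrightarrow> a < lv \<Longrightarrow> wfe (center1E a x) ks lv"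
  by (simp add: center1E_def eqE_def wf_sum1 wf_cnt nth_append)
lemma wf_center2: "x = length ks \<Longrightarrow> a < lv \<Longrightarrow> wfe (center2E a x) ks lv"
  by (simp add: center2E_def eqE_def wf_sum2 wf_cnt nth_append)
lemma wf_keyB: "x = length ks \<Longrightarrow> y < lv \<Longrightarrow> w < lv \<Longrightarrow> wfe (keyB y x w) ks lv"
  by (simp add: keyB_def wf_center1 wf_center2 wf_low wf_neq)

lemma stp_set: "set (stp r) \<subseteq> {BN, BF}"
  by (auto simp: stp_def)

lemma wf_base: "wfK Q ks a \<Longrightarrow> wfe (baseE Q (length ks) a) ks (Suc a)"
  unfolding baseE_def by (rule wf_srE) (auto intro!: wfKI wf_keyB)

lemma wf_rm: "(\<And>r. wfK (K r) ks a) \<Longrightarrow> wfe (rmE K R (length ks) a) ks (Suc a)"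
  by (induction R) (auto simp: Let_def intro!: wf_mxE stp_set)

lemma wf_rs: "(\<And>r. wfK (K r) ks a) \<Longrightarrow> (\<And>r. wfK (Q r) ks a) \<Longrightarrow> wfe (rsE K Q R (length ks) a) ks (Suc a)"
  by (induction R) (auto intro!: wf_mxE wf_srE wf_rm stp_set)

lemma wfK_sc: "y \<le> a \<Longrightarrow> wfK (scE p r y) ks a"
  by (auto intro!: wfKI wf_sc)

lemma wf_valid: "wfe (validE p (length ks) z) ks (Suc z)"
  unfolding validE_def
proof (rule wf_base, rule wfKI)
  fix ks' a' assume a: "z \<le> a'"
  have "wfK (badE p z r) (ks @ ks') a'" for r
    using a by (auto simp: badE_def intro!: wfKI wf_ls wf_sc)
  then show "wfe (Ifl (rmE (badE p z) Rm (length (ks @ ks')) a') (Mul (Num (S p - 1) (S p)) (rmE (\<lambda>r. scE p r z) Rm (length (ks @ ks')) a')) num1 num0)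
     (ks @ ks') (Suc a')"
    using wfK_sc[OF a] by (simp add: wf_rm del: length_append)
qed

lemma wf_reliable: "wfe (reliableE p (length ks) y) ks (Suc y)"
  unfolding reliableE_def
proof (rule wf_base, rule wfKI, rule wf_mxE[OF wfKI stp_set])
  fix ks' a ks'' a' assume a: "y \<le> a" "a \<le> a'"
  show "wfe (Ifl num0 (violE y a a' (length ((ks @ ks') @ ks''))) num0 (validE p (length ((ks @ ks') @ ks'')) a'))
     ((ks @ ks') @ ks'') (Suc a')"
    using a wf_valid[of p "(ks @ ks') @ ks''" a'] by (simp add: wf_viol del: length_append)
qed

lemma wf_pick: assumes ks: "ks \<noteq> []" "ks ! 0" shows "wfe (pickE p (length ks) y) ks (Suc y)"
  unfolding pickE_def
proof (rule wf_base, rule wfKI, rule wf_rs)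
  fix ks' a r assume a: "y \<le> a"
  show "wfK (scE p r y) (ks @ ks') a" by (rule wfK_sc[OF a])
  show "wfK (payE p y r) (ks @ ks') a"
  proof (rule wfKI)
    fix ks'' a' assume "a \<le> a'"
    then show "wfe (payE p y r (length ((ks @ ks') @ ks'')) a') ((ks @ ks') @ ks'') (Suc a')"
      using a ks unfolding payE_def wfe.simps by (intro conjI wf_phi) (auto simp: nth_append)
  qed
qed

lemma wf_xi: "ks \<noteq> [] \<Longrightarrow> ks ! 0 \<Longrightarrow> wfe (xiE q (length ks) y) ks (Suc y)"
  by (induction q) (simp_all add: wf_pick wf_reliable)

lemma wf_out: "wfe outE [True] 1"
  using wf_xi[of "[True, False]" k 1] by (simp add: outE_def Let_def numeral_2_eq_2)

end


section \<open>Meaning of the expressions\<close>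

locale prog = params k C D flag for k C D :: nat and flag :: bool +
  fixes n :: nat and as :: "real list" and A :: "real list \<Rightarrow> real list"
  assumes n1: "1 \<le> n" and len: "length as = k" and k: "1 \<le> k" and C: "1 \<le> C" and D: "1 \<le> D"
    and A0: "u \<in> valuations n (set as) \<Longrightarrow> i < n \<Longrightarrow> 0 \<le> A u ! i"
    and gap: "s \<in> set as \<Longrightarrow> t \<in> set as \<Longrightarrow> 0 < s \<Longrightarrow> s < t \<Longrightarrow> real n * s \<le> real C * (t - s)"
begin

definition f :: nat where "f = free_count F n"
definition c :: real where "c = 1 / C"
definition th :: real where "th = 1 - c * (c / 64) ^ k / 8 / 24"

lemma f: "1 \<le> f" "f \<le> n" "f \<le> F"
proof -
  have "(n - 1) mod F \<le> n - 1" by (rule mod_less_eq_dividend)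
  then show "1 \<le> f" "f \<le> n" using n1 unfolding f_def free_count_def by linarith+
  show "f \<le> F" by (simp add: f_def free_count_def F_def Suc_le_eq)
qed

sublocale lang n f as A
  using n1 f len k by unfold_locales auto

lemma c_pow: "(c / 64) ^ p = 1 / S p"
  by (simp add: c_def S_def power_divide mult.commute)

lemma S_pos: "1 \<le> S p"
  using C by (simp add: S_def)

lemma M_pos: "1 < M"
proof -
  have "1 * 1 \<le> C * S k" using C S_pos by (intro mult_le_mono) auto
  then show ?thesis unfolding M_def mult.assoc by linarith
qed

lemma th_M: "th = real (M - 1) / real M"
proof -
  have "th = 1 - 1 / real M" by (simp add: th_def c_pow) (simp add: c_def M_def)
  then show ?thesis using M_pos by (simp add: field_simps of_nat_diff)
qed

lemma rk_le: "rk as t \<le> k"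
proof -
  have "rk as t \<le> card {..<length as}" unfolding rk_def by (intro card_mono) auto
  then show ?thesis using len by simp
qed

lemma sch: "scheme n k D Gam (set as) (rk as) A c th"
proof
  fix t assume t: "t \<in> set as" "0 < t"
  then obtain i where "i < length as" "as ! i = t" by (auto simp: in_set_conv_nth)
  then have "{} \<subset> {c. c < length as \<and> 0 < as ! c \<and> as ! c \<le> t}" using t by auto
  then have "card ({} :: nat set) < rk as t" unfolding rk_def by (intro psubset_card_mono) auto
  then show "1 \<le> rk as t \<and> rk as t \<le> k" using rk_le by simp
next
  fix s t assume st: "s \<in> set as" "t \<in> set as" "0 < s" "s < t"
  then obtain i where i: "i < length as" "as ! i = t" by (auto simp: in_set_conv_nth)
  show "rk as s < rk as t" unfolding rk_def
  proof (rule psubset_card_mono)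
    show "{c. c < length as \<and> 0 < as ! c \<and> as ! c \<le> s} \<subset> {c. c < length as \<and> 0 < as ! c \<and> as ! c \<le> t}"
    proof (rule psubsetI)
      show "{c. c < length as \<and> 0 < as ! c \<and> as ! c \<le> s} \<subseteq> {c. c < length as \<and> 0 < as ! c \<and> as ! c \<le> t}"
        using st(4) by fastforce
      have "i \<in> {c. c < length as \<and> 0 < as ! c \<and> as ! c \<le> t}" "i \<notin> {c. c < length as \<and> 0 < as ! c \<and> as ! c \<le> s}"
        using i st by simp_all
      then show "{c. c < length as \<and> 0 < as ! c \<and> as ! c \<le> s} \<noteq> {c. c < length as \<and> 0 < as ! c \<and> as ! c \<le> t}"
        by blast
    qed
  qed auto
  have C0: "0 < real C" using C by simp
  have "real n * s / C \<le> t - s" using gap[OF st] C0 by (simp add: divide_le_eq mult.commute)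
  then show "c * real n * s \<le> t - s" by (simp add: c_def)
next
  show "4 \<le> real Gam * (c * (c / 64) ^ k / 8)"
    unfolding c_pow using C S_pos[of k] by (simp add: Gam_def c_def)
next
  show "th = 1 - c * (c / 64) ^ k / 8 / 24" by (rule th_def)
next
  fix u i assume "u \<in> vals" "i < n"
  then show "0 \<le> A u ! i" by (rule A0)
next
  show "0 < c" "c \<le> 1" using C by (simp_all add: c_def)
qed (use n1 D k in simp_all)

abbreviation "ph \<equiv> scheme.phi k D Gam (rk as) th"
abbreviation "score \<equiv> scheme.sc n k D Gam (rk as) A th"
lemmas ph_def = scheme.phi_def[OF sch] and score_def = scheme.sc_def[OF sch]

definition level_score :: "nat \<Rightarrow> nat \<Rightarrow> real list \<Rightarrow> real list \<Rightarrow> real" where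
  "level_score p r y u = (\<Sum>l<n. if p \<le> rk as (y ! l) then ph p r (y ! l) * y ! l * A u ! l else 0)"

lemma ev_cnt: "ev' (cntE b x) ix vs = real (bval n (length as) f ix b)"
  by (simp add: cntE_def)

lemma ev_rk: "i < x \<Longrightarrow> ev' (rkE a i x) ix vs = real (rk as (vs a ! ix i))"
proof -
  assume i: "i < x"
  have "ev' (rkE a i x) ix vs = (\<Sum>c<length as. if 0 < as ! c \<and> as ! c \<le> vs a ! ix i then 1 else 0)"
    using i by (auto simp: rkE_def intro!: sum.cong)
  also have "\<dots> = real (card ({..<length as} \<inter> {c. 0 < as ! c \<and> as ! c \<le> vs a ! ix i}))"
    by (simp add: sum.If_cases)
  also have "{..<length as} \<inter> {c. 0 < as ! c \<and> as ! c \<le> vs a ! ix i} = {c. c < length as \<and> 0 < as ! c \<and> as ! c \<le> vs a ! ix i}"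
    by auto
  finally show ?thesis by (simp add: rk_def)
qed

lemma ev_fixed: "ev' (fixedE x e) ix vs = (if ix x < f then 0 else ev' e ix vs)"
  by (simp add: fixedE_def ev_cnt)

lemma ev_farC: "ev' (farC p r t) ix vs = (if r \<le> Rr p t then th ^ D * real Gam ^ t else 0)"
  by (simp add: farC_def th_M power_divide)

lemma ev_far: "i < x \<Longrightarrow> rk as (vs a ! ix i) \<le> t \<Longrightarrow>
    ev' (farE p r a i x t) ix vs = (if r \<le> Rr p (rk as (vs a ! ix i)) then th ^ D * real Gam ^ rk as (vs a ! ix i) else 0)"
proof (induction t)
  case (Suc t)
  show ?case
  proof (cases "rk as (vs a ! ix i) \<le> t")
    case True then show ?thesis using Suc by (simp add: ev_rk)
  next
    case False
    then have "rk as (vs a ! ix i) = Suc t" using Suc.prems by simp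
    then show ?thesis using Suc.prems by (simp add: ev_rk ev_farC)
  qed
qed (simp add: ev_farC)

lemma ev_phi: "i < x \<Longrightarrow> ev' (phiE p r a i x) ix vs = ph p r (vs a ! ix i)"
proof -
  assume i: "i < x"
  have R: "scheme.Rr k D p t = Rr p t" for t by (simp add: Rr_def scheme.Rr_def[OF sch])
  have core: "real (M - Suc 0) ^ r / real M ^ r = th ^ r" by (simp add: th_M power_divide)
  show ?thesis unfolding ph_def R
    using ev_far[OF i rk_le, where a = a and vs = vs and p = p and r = r] i by (simp add: phiE_def core)
qed

lemma ev_term: "ev' (termE p r y u x) ix vs = ph p r (vs y ! ix x) * vs y ! ix x * A (vs u) ! ix x"
  by (simp add: termE_def ev_phi)

lemma ev_sc: "ev' (scE p r y x u) ix vs = score p r (vs y) (vs u)"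
  by (simp add: scE_def ev_term score_def)

lemma ev_ls: "ev' (lsE p r y x u) ix vs = level_score p r (vs y) (vs u)"
  unfolding lsE_def level_score_def by (auto simp: ev_term ev_rk intro!: sum.cong)

definition sum1 :: "real list \<Rightarrow> real" where
  "sum1 w = (\<Sum>l<n. if l < f then 0 else real (rk as (w ! l)) - 1)"
definition sum2 :: "real list \<Rightarrow> real" where
  "sum2 w = (\<Sum>l<n. if l < f then 0 else (real l - real f + 1) * (real (rk as (w ! l)) - 1))"

definition center :: "real list \<Rightarrow> bool" where
  "center w \<longleftrightarrow> flag \<and> (\<exists>m<n. sum1 w = real m * real (k - 1)) \<and>
     (\<exists>m<n. \<exists>m'<n. sum2 w = (real m * real n + real m') * (real n - real f + 1))"

definition lower :: "real list \<Rightarrow> real list \<Rightarrow> bool" where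
  "lower y w \<longleftrightarrow> (\<exists>l<n. f \<le> l \<and> w ! l < y ! l)"

definition keyS :: "real list \<Rightarrow> real list \<Rightarrow> real" where
  "keyS y w = (if center w \<and> lower y w then 2 else if \<forall>l<n. w ! l = y ! l then 1 else 0)"

lemma ev_sum1: "ev' (sum1E a x) ix vs = sum1 (vs a)"
  unfolding sum1E_def sum1_def by (auto simp: ev_fixed ev_rk intro!: sum.cong)
lemma ev_sum2: "ev' (sum2E a x) ix vs = sum2 (vs a)"
  unfolding sum2E_def sum2_def by (auto simp: ev_fixed ev_rk ev_cnt intro!: sum.cong)

lemma sum_pos_iff: "(\<And>i. i < m \<Longrightarrow> 0 \<le> g i) \<Longrightarrow> 0 < (\<Sum>i<m. g i) \<longleftrightarrow> (\<exists>i<m. 0 < (g i :: real))"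
  for m :: nat
proof -
  assume g: "\<And>i. i < m \<Longrightarrow> 0 \<le> g i"
  have "(\<Sum>i<m. g i) = 0 \<longleftrightarrow> (\<forall>i\<in>{..<m}. g i = 0)" using g by (intro sum_nonneg_eq_0_iff) auto
  moreover have "0 \<le> (\<Sum>i<m. g i)" using g by (intro sum_nonneg) auto
  ultimately have "0 < (\<Sum>i<m. g i) \<longleftrightarrow> (\<exists>i\<in>{..<m}. g i \<noteq> 0)"
    unfolding less_le by (metis (no_types, lifting))
  also have "\<dots> \<longleftrightarrow> (\<exists>i<m. 0 < g i)" using g by force
  finally show ?thesis .
qed

lemma ev_eq: "ev' (eqE u v) ix vs = (if ev' u ix vs = ev' v ix vs then 1 else 0)"
  by (simp add: eqE_def)

lemma ev_center1: "0 < ev' (center1E a x) ix vs \<longleftrightarrow> (\<exists>m<n. sum1 (vs a) = real m * real (k - 1))"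
    "0 \<le> ev' (center1E a x) ix vs"
proof -
  have e: "ev' (center1E a x) ix vs = (\<Sum>m<n. if sum1 (vs a) = real m * real (k - 1) then 1 else 0)"
    by (simp add: center1E_def ev_eq ev_sum1 ev_cnt)
  show "0 < ev' (center1E a x) ix vs \<longleftrightarrow> (\<exists>m<n. sum1 (vs a) = real m * real (k - 1))"
    unfolding e by (subst sum_pos_iff) auto
  show "0 \<le> ev' (center1E a x) ix vs" unfolding e by (intro sum_nonneg) auto
qed

lemma ev_center2: "0 < ev' (center2E a x) ix vs \<longleftrightarrow>
     (\<exists>m<n. \<exists>m'<n. sum2 (vs a) = (real m * real n + real m') * (real n - real f + 1))"
    "0 \<le> ev' (center2E a x) ix vs"
proof -
  let ?g = "\<lambda>m m'. if sum2 (vs a) = (real m * real n + real m') * (real n - real f + 1) then 1 else (0::real)"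
  have e: "ev' (center2E a x) ix vs = (\<Sum>m<n. \<Sum>m'<n. ?g m m')"
    by (simp add: center2E_def ev_eq ev_sum2 ev_cnt)
  have i: "0 < (\<Sum>m'<n. ?g m m') \<longleftrightarrow> (\<exists>m'<n. sum2 (vs a) = (real m * real n + real m') * (real n - real f + 1))" for m
    by (subst sum_pos_iff) auto
  show "0 < ev' (center2E a x) ix vs \<longleftrightarrow>
     (\<exists>m<n. \<exists>m'<n. sum2 (vs a) = (real m * real n + real m') * (real n - real f + 1))"
    unfolding e i[symmetric] by (rule sum_pos_iff) (auto intro: sum_nonneg)
  show "0 \<le> ev' (center2E a x) ix vs" unfolding e by (intro sum_nonneg) auto
qed

lemma ev_low: "0 < ev' (lowE y w x) ix vs \<longleftrightarrow> lower (vs y) (vs w)" "0 \<le> ev' (lowE y w x) ix vs"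
proof -
  have e: "ev' (lowE y w x) ix vs = (\<Sum>l<n. if l < f then 0 else if vs w ! l < vs y ! l then 1 else 0)"
    unfolding lowE_def by (auto simp: ev_fixed intro!: sum.cong)
  show "0 < ev' (lowE y w x) ix vs \<longleftrightarrow> lower (vs y) (vs w)"
    unfolding e lower_def by (subst sum_pos_iff) (auto simp: not_less)
  show "0 \<le> ev' (lowE y w x) ix vs" unfolding e by (intro sum_nonneg) auto
qed

lemma ev_neq: "0 < ev' (neqE y w x) ix vs \<longleftrightarrow> \<not> (\<forall>l<n. vs w ! l = vs y ! l)"
  unfolding neqE_def by simp (subst sum_pos_iff, auto)

lemma ev_viol: "0 < ev' (violE y b z x) ix vs \<longleftrightarrow>
    \<not> (\<forall>l<n. vs z ! l \<le> vs y ! l \<and> (f \<le> l \<longrightarrow> vs b ! l \<le> vs z ! l))"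
proof -
  let ?g = "\<lambda>l. (if vs y ! l < vs z ! l then 1 else 0) + (if l < f then 0 else if vs z ! l < vs b ! l then 1 else (0::real))"
  have "ev' (violE y b z x) ix vs = (\<Sum>l<n. ?g l)"
    unfolding violE_def by (auto simp: ev_fixed intro!: sum.cong)
  then have "0 < ev' (violE y b z x) ix vs \<longleftrightarrow> 0 < (\<Sum>l<n. ?g l)" by (simp only:)
  also have "\<dots> \<longleftrightarrow> (\<exists>l<n. 0 < ?g l)" by (rule sum_pos_iff) simp
  also have "\<dots> \<longleftrightarrow> (\<exists>l<n. vs y ! l < vs z ! l \<or> (f \<le> l \<and> vs z ! l < vs b ! l))"
    by (intro ex_cong1 conj_cong refl) (simp add: not_less)
  also have "\<dots> \<longleftrightarrow> \<not> (\<forall>l<n. vs z ! l \<le> vs y ! l \<and> (f \<le> l \<longrightarrow> vs b ! l \<le> vs z ! l))"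
    unfolding not_less[symmetric] by blast
  finally show ?thesis .
qed

lemma ev_keyB: "ev' (keyB y x w) ix vs = keyS (vs y) (vs w)"
proof -
  let ?c1 = "ev' (center1E w x) ix vs" and ?c2 = "ev' (center2E w x) ix vs" and ?l = "ev' (lowE y w x) ix vs"
  have "0 < ?c1 * ?c2 * ?l \<longleftrightarrow> 0 < ?c1 \<and> 0 < ?c2 \<and> 0 < ?l"
    using ev_center1(2)[of w x ix vs] ev_center2(2)[of w x ix vs] ev_low(2)[of y w x ix vs]
    unfolding zero_less_mult_iff by linarith
  then have "(flag \<and> 0 < ?c1 * ?c2 * ?l) \<longleftrightarrow> center (vs w) \<and> lower (vs y) (vs w)"
    unfolding center_def ev_center1 ev_center2 ev_low by blast
  moreover have "ev' (keyB y x w) ix vs = (if flag \<and> 0 < ?c1 * ?c2 * ?l then 2 else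
      if 0 < ev' (neqE y w x) ix vs then 0 else 1)"
    by (simp add: keyB_def)
  ultimately show ?thesis by (simp add: keyS_def ev_neq)
qed

definition baseS :: "real list \<Rightarrow> real list" where "baseS y = srS as [n] (keyS y) y"

lemma keyS_nonneg: "0 \<le> keyS y w" by (simp add: keyS_def)

lemma baseS_vals: assumes "y \<in> vals" shows "baseS y \<in> vals"
proof -
  have "baseS y \<in> reach as [n] y"
    unfolding baseS_def by (rule search(1)[OF as]) (use n1 keyS_nonneg in auto)
  then show ?thesis using reach_vals[OF assms] by blast
qed

lemma ev_base: "evK Q x a ix vs H \<Longrightarrow> vs a \<in> vals \<Longrightarrow> ev' (baseE Q x a) ix vs = H (baseS (vs a))"
  unfolding baseE_def baseS_def
proof (subst ev_srE[where G = "keyS (vs a)" and H = H])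
  show "evK (keyB a) x a ix vs (keyS (vs a))" by (rule evKI) (simp add: ev_keyB)
qed (auto simp: keyS_nonneg bv_def)

definition stS :: "nat \<Rightarrow> nat list" where "stS r = replicate F f @ replicate r n"

lemma stS: "map bv (stp r) = stS r"
  by (simp add: stp_def stS_def bv_def)

lemma stS_pos: "0 \<notin> set (stS r)" using f n1 by (auto simp: stS_def)

primrec rmS :: "(nat \<Rightarrow> real list \<Rightarrow> real) \<Rightarrow> nat \<Rightarrow> real list \<Rightarrow> real" where
  "rmS G 0 y = mxS as (stS 0) (G 0) y"
| "rmS G (Suc r) y = max (rmS G r y) (mxS as (stS (Suc r)) (G (Suc r)) y)"

primrec rsS :: "(nat \<Rightarrow> real list \<Rightarrow> real) \<Rightarrow> nat \<Rightarrow> real list \<Rightarrow> nat \<times> real list" where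
  "rsS G 0 y = (0, srS as (stS 0) (G 0) y)"
| "rsS G (Suc r) y = (if rmS G r y < mxS as (stS (Suc r)) (G (Suc r)) y
     then (Suc r, srS as (stS (Suc r)) (G (Suc r)) y) else rsS G r y)"

lemma ev_rm:
  assumes K: "\<And>r. evK (K r) x b ix vs (G r)" and b: "vs b \<in> vals"
  shows "ev' (rmE K R x b) ix vs = rmS G R (vs b)"
proof -
  have "ev' (mxE (stp r) (K r) x b) ix vs = mxS as (stS r) (G r) (vs b)" for r
    using ev_mxE[OF K b stp_set] by (simp add: stS)
  then show ?thesis by (induction R) (auto simp: Let_def max_def)
qed

lemma ev_rs:
  assumes K: "\<And>r. evK (K r) x b ix vs (G r)" and Q: "\<And>r. evK (Q r) x b ix vs (H r)" and b: "vs b \<in> vals"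
    and G: "\<And>r u. u \<in> vals \<Longrightarrow> 0 \<le> G r u"
  shows "ev' (rsE K Q R x b) ix vs = H (fst (rsS G R (vs b))) (snd (rsS G R (vs b)))"
proof -
  have "ev' (mxE (stp r) (K r) x b) ix vs = mxS as (stS r) (G r) (vs b)" for r
    using ev_mxE[OF K b stp_set] by (simp add: stS)
  moreover have "ev' (srE (stp r) (K r) (Q r) x b) ix vs = H r (srS as (stS r) (G r) (vs b))" for r
    using ev_srE[OF K Q b stp_set G] by (simp add: stS)
  ultimately show ?thesis by (induction R) (auto simp: ev_rm[OF K b])
qed

lemma rsS_max:
  assumes y: "y \<in> vals" and G: "\<And>r u. u \<in> vals \<Longrightarrow> 0 \<le> G r u"
  shows "fst (rsS G R y) \<le> R \<and> snd (rsS G R y) \<in> reach as (stS (fst (rsS G R y))) y \<and>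
    G (fst (rsS G R y)) (snd (rsS G R y)) = rmS G R y \<and> (\<forall>r\<le>R. \<forall>u\<in>reach as (stS r) y. G r u \<le> rmS G R y)"
proof -
  have G': "\<And>u. u \<in> reach as (stS r) y \<Longrightarrow> 0 \<le> G r u" for r using G reach_vals[OF y] by blast
  have s: "srS as (stS r) (G r) y \<in> reach as (stS r) y" for r
    by (rule search(1)[OF as stS_pos]) (rule G')
  have s2: "G r (srS as (stS r) (G r) y) = mxS as (stS r) (G r) y" for r
    by (rule search(2)[OF as stS_pos]) (rule G')
  have s3: "\<forall>u\<in>reach as (stS r) y. G r u \<le> mxS as (stS r) (G r) y" for r
  proof
    fix u assume "u \<in> reach as (stS r) y"
    then show "G r u \<le> mxS as (stS r) (G r) y" by (rule search(3)[OF as stS_pos, rotated]) (rule G')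
  qed
  show ?thesis
  proof (induction R)
    case 0 then show ?case using s[of 0] s2[of 0] s3[of 0] by auto
  next
    case (Suc R)
    have all: "G r u \<le> rmS G (Suc R) y" if r: "r \<le> Suc R" and u: "u \<in> reach as (stS r) y" for r u
    proof (cases "r = Suc R")
      case True
      then have "G r u \<le> mxS as (stS (Suc R)) (G (Suc R)) y" using s3[of "Suc R"] u by blast
      then show ?thesis by (simp add: le_max_iff_disj)
    next
      case False
      then have "r \<le> R" using r by simp
      then have "G r u \<le> rmS G R y" using Suc u by blast
      then show ?thesis by (simp add: le_max_iff_disj)
    qed
    show ?case
    proof (cases "rmS G R y < mxS as (stS (Suc R)) (G (Suc R)) y")
      case True
      then have "rsS G (Suc R) y = (Suc R, srS as (stS (Suc R)) (G (Suc R)) y)"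
        "rmS G (Suc R) y = mxS as (stS (Suc R)) (G (Suc R)) y" by auto
      then show ?thesis using s[of "Suc R"] s2[of "Suc R"] all by simp
    next
      case False
      then have "rsS G (Suc R) y = rsS G R y" "rmS G (Suc R) y = rmS G R y" by auto
      then show ?thesis using Suc all by (metis le_Suc_eq)
    qed
  qed
qed

end

section \<open>Levels, choices and outputs as computed\<close>

context prog
begin

definition Bl :: "real list \<Rightarrow> nat \<Rightarrow> real list set" where
  "Bl y r = {u \<in> vals. card {l. f \<le> l \<and> l < n \<and> baseS y ! l \<noteq> u ! l} \<le> r}"

definition Below :: "real list \<Rightarrow> real list set" where
  "Below y = {z \<in> vals. \<forall>l<n. z ! l \<le> y ! l \<and> (f \<le> l \<longrightarrow> baseS y ! l \<le> z ! l)}"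

lemma reach_Bl: "y \<in> vals \<Longrightarrow> reach as (stS r) (baseS y) = Bl y r"
  unfolding stS_def Bl_def by (rule reach_ball[OF baseS_vals f as])

abbreviation "val \<equiv> scheme.valid n k D Gam (rk as) A c th Bl"
abbreviation "opts \<equiv> scheme.opt k D Bl"

lemma Rm_eq: "scheme.Rm k D = Rm"
  by (simp add: scheme.Rm_def[OF sch] Rm_def)

lemma opts_iff: "(r, u) \<in> opts y \<longleftrightarrow> r \<le> Rm \<and> u \<in> Bl y r"
  by (simp add: scheme.opt_def[OF sch] Rm_eq)

lemma kap_eq: "scheme.kap c p = 1 / S p"
  by (simp add: scheme.kap_def[OF sch] c_pow)

lemma good_iff: "scheme.good n k D Gam (rk as) A c th p r y u \<longleftrightarrow> 1 / S p * score p r y u \<le> level_score p r y u"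
  by (simp add: scheme.good_def[OF sch] kap_eq level_score_def)

lemma score_nonneg: "u \<in> vals \<Longrightarrow> 0 \<le> score p r y u"
  using scheme.sc_nonneg[OF sch] by (simp add: scheme.vals_def[OF sch])

definition badS :: "nat \<Rightarrow> real list \<Rightarrow> nat \<Rightarrow> real list \<Rightarrow> real" where
  "badS p z r u = (if level_score p r z u < 1 / S p * score p r z u then score p r z u else 0)"

abbreviation "scoreS p z \<equiv> (\<lambda>r u. score p r z u)"

lemma best:
  assumes z: "z \<in> vals" and G: "\<forall>r. \<forall>u\<in>vals. 0 \<le> G r u"
  shows "rsS G Rm (baseS z) \<in> opts z" "G (fst (rsS G Rm (baseS z))) (snd (rsS G Rm (baseS z))) = rmS G Rm (baseS z)"
    "\<And>r u. (r, u) \<in> opts z \<Longrightarrow> G r u \<le> rmS G Rm (baseS z)"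
proof -
  have m: "fst (rsS G Rm (baseS z)) \<le> Rm \<and> snd (rsS G Rm (baseS z)) \<in> Bl z (fst (rsS G Rm (baseS z))) \<and>
    G (fst (rsS G Rm (baseS z))) (snd (rsS G Rm (baseS z))) = rmS G Rm (baseS z) \<and>
    (\<forall>r\<le>Rm. \<forall>u\<in>Bl z r. G r u \<le> rmS G Rm (baseS z))"
    unfolding reach_Bl[OF z, symmetric] by (rule rsS_max[OF baseS_vals[OF z]]) (use G in blast)
  show "rsS G Rm (baseS z) \<in> opts z"
    using m opts_iff[of "fst (rsS G Rm (baseS z))" "snd (rsS G Rm (baseS z))"] by simp
  show "G (fst (rsS G Rm (baseS z))) (snd (rsS G Rm (baseS z))) = rmS G Rm (baseS z)" using m by blast
  show "G r u \<le> rmS G Rm (baseS z)" if "(r, u) \<in> opts z" for r u using m that opts_iff by blast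
qed

text \<open>The best option serves as reference and is compared with the best bad one. If all
  options are good, the left side is 0, and the inequality says that some score is positive; here
  \<open>p \<ge> 1\<close> is needed for \<open>S p > 1\<close>.\<close>

lemma valid_iff:
  assumes z: "z \<in> vals" and p: "1 \<le> p"
  shows "val p z \<longleftrightarrow> rmS (badS p z) Rm (baseS z) < (1 - 1 / S p) * rmS (scoreS p z) Rm (baseS z)"
proof -
  have s0: "\<forall>r. \<forall>u\<in>vals. 0 \<le> scoreS p z r u" using score_nonneg by blast
  have b0: "\<forall>r. \<forall>u\<in>vals. 0 \<le> badS p z r u" using score_nonneg by (simp add: badS_def)
  note s = best[OF z s0]
  note b = best[OF z b0]
  let ?ms = "rmS (scoreS p z) Rm (baseS z)" and ?mb = "rmS (badS p z) Rm (baseS z)"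
  have "64 * 1 \<le> 64 * C" using C by simp
  then have "1 < 64 * C" by simp
  then have "1 < S p" unfolding S_def using p by (intro one_less_power) auto
  then have q: "0 < 1 - 1 / real (S p)" by simp
  have vd: "val p z \<longleftrightarrow> (\<exists>(r0, u0)\<in>opts z. 0 < score p r0 z u0 \<and>
     (\<forall>(r, u)\<in>opts z. badS p z r u < (1 - 1 / S p) * score p r0 z u0 \<or>
        (1 / S p * score p r z u \<le> level_score p r z u)))"
    unfolding scheme.valid_def[OF sch] kap_eq good_iff badS_def not_le[symmetric] by (fastforce split: if_splits)
  show ?thesis
  proof
    assume "val p z"
    then obtain r0 u0 where r0: "(r0, u0) \<in> opts z" "0 < score p r0 z u0"
      "\<And>r u. (r, u) \<in> opts z \<Longrightarrow> badS p z r u < (1 - 1 / S p) * score p r0 z u0 \<or> (1 / S p * score p r z u \<le> level_score p r z u)"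
      unfolding vd by fastforce
    let ?w = "rsS (badS p z) Rm (baseS z)"
    have le: "(1 - 1 / S p) * score p r0 z u0 \<le> (1 - 1 / S p) * ?ms"
      using s(3)[OF r0(1)] q by (intro mult_left_mono) auto
    have w: "(fst ?w, snd ?w) \<in> opts z" using b(1) by simp
    have "badS p z (fst ?w) (snd ?w) < (1 - 1 / S p) * score p r0 z u0"
    proof (cases "1 / S p * score p (fst ?w) z (snd ?w) \<le> level_score p (fst ?w) z (snd ?w)")
      case True
      then have "badS p z (fst ?w) (snd ?w) = 0" by (simp add: badS_def)
      then show ?thesis using mult_pos_pos[OF q r0(2)] by simp
    next
      case False then show ?thesis using r0(3)[OF w] by blast
    qed
    then show "?mb < (1 - 1 / S p) * ?ms" using b(2) le by linarith
  next
    assume less: "?mb < (1 - 1 / S p) * ?ms"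
    let ?w = "rsS (scoreS p z) Rm (baseS z)"
    have w: "(fst ?w, snd ?w) \<in> opts z" using s(1) by simp
    let ?w' = "rsS (badS p z) Rm (baseS z)"
    have "snd ?w' \<in> vals" using b(1) opts_iff[of "fst ?w'" "snd ?w'" z] by (simp add: Bl_def)
    then have "0 \<le> ?mb" using b0 b(2) by metis
    then have "0 < (1 - 1 / S p) * ?ms" using less by linarith
    then have pos: "0 < score p (fst ?w) z (snd ?w)" unfolding s(2) using q by (simp add: zero_less_mult_iff)
    have "badS p z r u < (1 - 1 / S p) * score p (fst ?w) z (snd ?w)" if "(r, u) \<in> opts z" for r u
      unfolding s(2) using b(3)[OF that] less by linarith
    then show "val p z" unfolding vd using w pos by (intro bexI[of _ "?w"]) (auto simp: case_prod_beta)
  qed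
qed

lemma ev_valid:
  assumes z: "vs z \<in> vals" and p: "1 \<le> p"
  shows "ev' (validE p x z) ix vs = (if val p (vs z) then 1 else 0)"
proof -
  have Kb: "evK (badE p z r) x b ix' vs' (badS p (vs' z) r)" if "z \<le> b" for x b ix' r and vs' :: "nat \<Rightarrow> real list"
    by (rule evKI) (use that in \<open>simp add: badE_def ev_ls ev_sc badS_def\<close>)
  have Ks: "evK (scE p r z) x b ix' vs' (score p r (vs' z))" if "z \<le> b" for x b ix' r and vs' :: "nat \<Rightarrow> real list"
    by (rule evKI) (use that in \<open>simp add: ev_sc\<close>)
  have q: "real (S p - Suc 0) / real (S p) = 1 - 1 / real (S p)"
    using S_pos[of p] by (simp add: of_nat_diff field_simps)
  have "ev' (validE p x z) ix vs = (\<lambda>b. if rmS (badS p (vs z)) Rm b < (1 - 1 / S p) * rmS (scoreS p (vs z)) Rm b then 1 else 0) (baseS (vs z))"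
    unfolding validE_def
  proof (rule ev_base[where vs = vs and a = z, OF _ z], rule evKI)
    fix x' a' ix' vs' assume a: "z \<le> a'" "\<And>b. b \<le> z \<Longrightarrow> vs' b = vs b" "vs' a' \<in> vals"
    show "ev' (Ifl (rmE (badE p z) Rm x' a') (Mul (Num (S p - 1) (S p)) (rmE (\<lambda>r. scE p r z) Rm x' a')) num1 num0) ix' vs' =
      (if rmS (badS p (vs z)) Rm (vs' a') < (1 - 1 / S p) * rmS (scoreS p (vs z)) Rm (vs' a') then 1 else 0)"
      using ev_rm[where K = "badE p z" and G = "badS p (vs' z)" and b = a' and vs = vs' and x = x' and ix = ix' and R = Rm, OF Kb[OF a(1)] a(3)]
        ev_rm[where K = "\<lambda>r. scE p r z" and G = "scoreS p (vs' z)" and b = a' and vs = vs' and x = x' and ix = ix' and R = Rm, OF Ks[OF a(1)] a(3)] a(2)[of z]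
      by (simp add: q del: times_divide_eq_left)
  qed
  then show ?thesis using valid_iff[OF z p] by simp
qed

text \<open>The base differs from \<open>y\<close> in at most one coordinate, and elsewhere
  \<open>z\<close> is squeezed between the two.\<close>

lemma Below_Bl: assumes y: "y \<in> vals" shows "Below y \<subseteq> Bl y 1"
proof
  fix z assume z: "z \<in> Below y"
  have "baseS y \<in> reach as [n] y"
    unfolding baseS_def by (rule search(1)[OF as]) (use n1 keyS_nonneg in auto)
  then obtain i s where b: "baseS y = y[i := s]" by auto
  have "{l. f \<le> l \<and> l < n \<and> baseS y ! l \<noteq> z ! l} \<subseteq> {i}"
  proof
    fix l assume l: "l \<in> {l. f \<le> l \<and> l < n \<and> baseS y ! l \<noteq> z ! l}"
    then have "baseS y ! l \<le> z ! l" "z ! l \<le> y ! l" using z by (auto simp: Below_def)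
    then show "l \<in> {i}" using l b by (cases "l = i") auto
  qed
  then have "card {l. f \<le> l \<and> l < n \<and> baseS y ! l \<noteq> z ! l} \<le> card {i}" by (intro card_mono) auto
  then show "z \<in> Bl y 1" using z by (simp add: Bl_def Below_def)
qed

lemma ev_reliable:
  assumes y: "vs y \<in> vals" and p: "1 \<le> p"
  shows "0 < ev' (reliableE p x y) ix vs \<longleftrightarrow> (\<exists>z\<in>Below (vs y). val p z)"
proof -
  let ?Y = "vs y"
  define G where "G b z = (if \<not> (\<forall>l<n. z ! l \<le> ?Y ! l \<and> (f \<le> l \<longrightarrow> b ! l \<le> z ! l)) then 0 else if val p z then 1 else (0::real))" for b z
  have "ev' (reliableE p x y) ix vs = (\<lambda>b. mxS as (stS 1) (G b) b) (baseS ?Y)"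
    unfolding reliableE_def
  proof (rule ev_base[where vs = vs and a = y, OF _ y], rule evKI)
    fix x' a ix' vs' assume a: "y \<le> a" "\<And>b. b \<le> y \<Longrightarrow> vs' b = vs b" "vs' a \<in> vals"
    have K: "evK (\<lambda>x z. Ifl num0 (violE y a z x) num0 (validE p x z)) x' a ix' vs' (G (vs' a))"
    proof (rule evKI)
      fix x'' a'' ix'' vs'' assume b: "a \<le> a''" "\<And>b. b \<le> a \<Longrightarrow> vs'' b = vs' b" "vs'' a'' \<in> vals"
      have e: "vs'' y = ?Y" "vs'' a = vs' a" using a b(2) by auto
      show "ev' (Ifl num0 (violE y a a'' x'') num0 (validE p x'' a'')) ix'' vs'' = G (vs' a) (vs'' a'')"
        using ev_viol[of y a a'' x'' ix'' vs''] ev_valid[where vs = vs'' and z = a'' and x = x'' and ix = ix'', OF b(3) p] unfolding e by (simp add: G_def)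
    qed
    show "ev' (mxE (stp 1) (\<lambda>x z. Ifl num0 (violE y a z x) num0 (validE p x z)) x' a) ix' vs' = mxS as (stS 1) (G (vs' a)) (vs' a)"
      using ev_mxE[OF K a(3) stp_set] by (simp only: stS)
  qed
  moreover have G0: "\<And>u. u \<in> reach as (stS 1) (baseS ?Y) \<Longrightarrow> 0 \<le> G (baseS ?Y) u" by (simp add: G_def)
  let ?m = "mxS as (stS 1) (G (baseS ?Y)) (baseS ?Y)" and ?s = "srS as (stS 1) (G (baseS ?Y)) (baseS ?Y)"
  have s1: "?s \<in> Bl ?Y 1" unfolding reach_Bl[OF y, symmetric] by (rule search(1)[OF as stS_pos]) (rule G0)
  have s2: "G (baseS ?Y) ?s = ?m" by (rule search(2)[OF as stS_pos]) (rule G0)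
  note s = s1 s2
  have "0 < ?m \<longleftrightarrow> (\<exists>z\<in>Below ?Y. val p z)"
  proof
    assume "0 < ?m"
    then have "0 < G (baseS ?Y) ?s" using s(2) by simp
    then have "?s \<in> Below ?Y \<and> val p ?s" using s(1) by (auto simp: G_def Below_def Bl_def split: if_splits)
    then show "\<exists>z\<in>Below ?Y. val p z" by blast
  next
    assume "\<exists>z\<in>Below ?Y. val p z"
    then obtain z where z: "z \<in> Below ?Y" "val p z" by blast
    then have "z \<in> reach as (stS 1) (baseS ?Y)" unfolding reach_Bl[OF y] using Below_Bl[OF y] by blast
    then have "G (baseS ?Y) z \<le> ?m" by (rule search(3)[OF as stS_pos, rotated]) (rule G0)
    moreover have "G (baseS ?Y) z = 1" using z by (simp add: G_def Below_def)
    ultimately show "0 < ?m" by simp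
  qed
  ultimately show ?thesis by simp
qed

primrec PS :: "nat \<Rightarrow> real list \<Rightarrow> nat" where
  "PS 0 y = 1"
| "PS (Suc q) y = (if \<exists>z\<in>Below y. val (Suc q) z then Suc q else PS q y)"

definition P :: "real list \<Rightarrow> nat" where "P y = PS k y"

definition pick :: "nat \<Rightarrow> real list \<Rightarrow> nat \<times> real list" where
  "pick p y = rsS (scoreS p y) Rm (baseS y)"
definition pk :: "real list \<Rightarrow> nat \<times> real list" where "pk y = pick (P y) y"

definition pay :: "nat \<Rightarrow> real list \<Rightarrow> nat \<Rightarrow> real" where
  "pay p y i = (if fst (pick p y) \<le> D then 1 else 2) * ph p (fst (pick p y)) (y ! i) * A (snd (pick p y)) ! i"

lemma ev_pick:
  assumes y: "vs y \<in> vals" and x: "0 < x"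
  shows "ev' (pickE p x y) ix vs = pay p (vs y) (ix 0)"
proof -
  let ?H = "\<lambda>r u. (if r \<le> D then 1 else 2) * ph p r (vs y ! ix 0) * A u ! ix 0"
  have "ev' (pickE p x y) ix vs = (\<lambda>b. ?H (fst (rsS (scoreS p (vs y)) Rm b)) (snd (rsS (scoreS p (vs y)) Rm b))) (baseS (vs y))"
    unfolding pickE_def
  proof (rule ev_base[where vs = vs and a = y, OF _ y], rule evKI)
    fix x' a ix' vs' assume a: "x \<le> x'" "y \<le> a" "\<And>i. i < x \<Longrightarrow> ix' i = ix i" "\<And>b. b \<le> y \<Longrightarrow> vs' b = vs b" "vs' a \<in> vals"
    have K: "evK (scE p r y) x' a ix' vs' (score p r (vs y))" for r
      by (rule evKI) (use a in \<open>simp add: ev_sc\<close>)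
    have Q: "evK (payE p y r) x' a ix' vs' (?H r)" for r
    proof (rule evKI)
      fix x'' a'' ix'' vs''
      assume b: "x' \<le> x''" "\<And>i. i < x' \<Longrightarrow> ix'' i = ix' i" "\<And>b. b \<le> a \<Longrightarrow> vs'' b = vs' b"
      have "ix'' 0 = ix 0" "vs'' y = vs y" using a b x by auto
      then show "ev' (payE p y r x'' a'') ix'' vs'' = ?H r (vs'' a'')"
        using ev_phi[of 0 x'' p r y ix'' vs''] x a(1) b(1) by (simp add: payE_def)
    qed
    show "ev' (rsE (\<lambda>r. scE p r y) (payE p y) Rm x' a) ix' vs' =
       ?H (fst (rsS (scoreS p (vs y)) Rm (vs' a))) (snd (rsS (scoreS p (vs y)) Rm (vs' a)))"
      by (rule ev_rs[where G = "\<lambda>r. score p r (vs y)" and H = ?H, OF K Q a(5)]) (rule score_nonneg)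
  qed
  then show ?thesis by (simp add: pay_def pick_def)
qed

lemma ev_xi: "vs y \<in> vals \<Longrightarrow> 0 < x \<Longrightarrow> ev' (xiE q x y) ix vs = pay (PS q (vs y)) (vs y) (ix 0)"
  by (induction q) (auto simp: ev_pick ev_reliable)

abbreviation "xi \<equiv> scheme.xi k D Gam (rk as) A th P pk"
abbreviation "TT \<equiv> scheme.T k D Gam (set as) (rk as) A th P pk"

lemma xi_pay: "xi y i = pay (P y) y i"
  unfolding scheme.xi_def[OF sch] pay_def pk_def ..

lemma pick_vals: "y \<in> vals \<Longrightarrow> snd (pick p y) \<in> vals \<and> pick p y \<in> opts y"
proof -
  assume y: "y \<in> vals"
  have "pick p y \<in> opts y" unfolding pick_def by (rule best(1)[OF y]) (use score_nonneg in blast)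
  moreover then have "snd (pick p y) \<in> Bl y (fst (pick p y))"
    using opts_iff[of "fst (pick p y)" "snd (pick p y)"] by simp
  ultimately show ?thesis by (simp add: Bl_def)
qed

lemma xi_nonneg: "y \<in> vals \<Longrightarrow> i < n \<Longrightarrow> 0 \<le> xi y i"
  unfolding xi_pay pay_def using scheme.phi_nonneg[OF sch] A0 pick_vals by (auto intro!: mult_nonneg_nonneg)

lemma ev_out:
  assumes v: "v \<in> vals" and i: "i < n"
  shows "ev' outE (\<lambda>_. i) (\<lambda>_. v) = TT v i"
proof -
  define X where "X j = xi (v[i := as ! j]) i" for j
  define key where "key j = (if as ! j < v ! i then 0 else 1 / (1 + X j))" for j
  have vj: "v[i := as ! j] \<in> vals" if "j < length as" for j using vals_upd[OF v that] .
  have X0: "0 \<le> X j" if "j < length as" for j unfolding X_def by (rule xi_nonneg[OF vj[OF that] i])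
  have e: "ev' (Upd 1 0 0 1 (xiE k 2 1)) ((\<lambda>_. i)(Suc 0 := j)) (\<lambda>_. v) = X j" if "j < length as" for j
    using ev_xi[of "(\<lambda>_. v)(1 := v[i := as ! j])" 1 2 k] vj[OF that] by (simp add: X_def xi_pay P_def)
  have "ev' outE (\<lambda>_. i) (\<lambda>_. v) = snd (bfold key X (length as))"
    unfolding outE_def Let_def using e
    by (auto simp: key_def intro!: arg_cong[of _ _ snd] bfold_cong)
  moreover have k0: "0 < length as" using as by simp
  have key0: "0 \<le> key j" if "j < length as" for j using X0[OF that] by (simp add: key_def)
  have b: "bidx key (length as) < length as" "\<And>i. i < length as \<Longrightarrow> key i \<le> key (bidx key (length as))"
      "snd (bfold key X (length as)) = X (bidx key (length as))"
    by (rule bfold_bidx(1)[OF k0 key0] bfold_bidx(2)[OF k0 key0] bfold_bidx(3)[OF k0 key0], assumption+)+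
  let ?j = "bidx key (length as)"
  have "v ! i \<in> set as" using v i by (auto simp: valuations_def)
  then obtain j0 where j0: "j0 < length as" "as ! j0 = v ! i" by (auto simp: in_set_conv_nth)
  have "0 < key j0" using j0 X0[OF j0(1)] by (simp add: key_def)
  then have "0 < key ?j" using b(2)[OF j0(1)] by linarith
  then have ge: "v ! i \<le> as ! ?j" "key ?j = 1 / (1 + X ?j)" by (auto simp: key_def split: if_splits)
  have le: "X ?j \<le> X j" if "j < length as" "v ! i \<le> as ! j" for j
  proof -
    have "1 / (1 + X j) \<le> 1 / (1 + X ?j)" using b(2)[OF that(1)] that(2) ge by (simp add: key_def)
    then show ?thesis using X0[OF that(1)] X0[OF b(1)] by (simp add: frac_le_eq divide_simps split: if_splits)
  qed
  have "TT v i = X ?j" unfolding scheme.T_def[OF sch]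
  proof (rule Min_eqI)
    show "X ?j \<in> (\<lambda>b. xi (v[i := b]) i) ` {b \<in> set as. v ! i \<le> b}"
      using ge(1) b(1) by (auto simp: X_def intro!: image_eqI[of _ _ "as ! ?j"])
    fix t assume "t \<in> (\<lambda>b. xi (v[i := b]) i) ` {b \<in> set as. v ! i \<le> b}"
    then obtain j where "j < length as" "v ! i \<le> as ! j" "t = X j" by (auto simp: X_def in_set_conv_nth)
    then show "X ?j \<le> t" using le by simp
  qed simp
  ultimately show ?thesis using b(3) by simp
qed

lemma T_le_xi: "v \<in> vals \<Longrightarrow> i < n \<Longrightarrow> TT v i \<le> xi v i"
proof -
  assume v: "v \<in> vals" and i: "i < n"
  have "v ! i \<in> set as" using v i by (auto simp: valuations_def)
  then show ?thesis unfolding scheme.T_def[OF sch] by (intro Min_le) (auto intro!: image_eqI[of _ _ "v ! i"])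
qed

lemma T_nonneg: "v \<in> vals \<Longrightarrow> i < n \<Longrightarrow> 0 \<le> TT v i"
proof -
  assume v: "v \<in> vals" and i: "i < n"
  have ne: "v ! i \<in> set as" using v i by (auto simp: valuations_def)
  have "v[i := b] \<in> vals" if "b \<in> set as" for b
    using v that by (auto simp: valuations_def dest: set_update_subset_insert[THEN subsetD])
  then show ?thesis unfolding scheme.T_def[OF sch] using ne i xi_nonneg by (subst Min_ge_iff) auto
qed

lemma T_nonpos: "v \<in> vals \<Longrightarrow> i < n \<Longrightarrow> v ! i \<le> 0 \<Longrightarrow> TT v i = 0"
  using T_le_xi[of v i] T_nonneg[of v i] by (simp add: xi_pay pay_def ph_def)

lemma T_mono: "v \<in> vals \<Longrightarrow> i < n \<Longrightarrow> b \<in> set as \<Longrightarrow> v ! i \<le> b \<Longrightarrow> TT v i \<le> TT (v[i := b]) i"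
proof -
  assume v: "v \<in> vals" and i: "i < n" and b: "b \<in> set as" "v ! i \<le> b"
  have l: "length v = n" using v by (simp add: valuations_def)
  show ?thesis unfolding scheme.T_def[OF sch]
    using b l i by (intro Min_antimono) (auto simp: image_iff)
qed

text \<open>This gives feasibility. Up to \<open>D\<close> the discount is at most 1; beyond
  \<open>D\<close> the assumption \<open>small\<close> absorbs both the factor 2 and the powers of
  \<open>Gam\<close>.\<close>

lemma xi_le:
  assumes y: "y \<in> vals" and i: "i < n" and small: "2 * th ^ D * real Gam ^ k \<le> 1"
  shows "xi y i \<le> A (snd (pk y)) ! i"
proof -
  let ?r = "fst (pk y)"
  have A: "0 \<le> A (snd (pk y)) ! i" using A0 pick_vals[OF y] i unfolding pk_def by blast
  note t = scheme.th01[OF sch] and G = scheme.Gam4[OF sch]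
  have "(if ?r \<le> D then 1 else 2) * ph (P y) ?r (y ! i) \<le> 1"
  proof (cases "?r \<le> D")
    case True
    then show ?thesis using t by (auto simp: ph_def intro: power_le_one)
  next
    case False
    have "real Gam ^ rk as (y ! i) \<le> real Gam ^ k" using G rk_le by (intro power_increasing) auto
    then have "th ^ D * real Gam ^ rk as (y ! i) \<le> th ^ D * real Gam ^ k" using t by (intro mult_left_mono) auto
    moreover have "0 \<le> th ^ D * real Gam ^ k" using t by simp
    ultimately have "ph (P y) ?r (y ! i) \<le> th ^ D * real Gam ^ k" using False by (simp add: ph_def)
    then show ?thesis using small False by simp
  qed
  then have "(if ?r \<le> D then 1 else 2) * ph (P y) ?r (y ! i) * A (snd (pk y)) ! i \<le> 1 * A (snd (pk y)) ! i"
    using A by (intro mult_right_mono)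
  then show ?thesis by (simp only: scheme.xi_def[OF sch] mult_1_left)
qed

lemma P_bounds: "1 \<le> PS q y" "PS q y \<le> max 1 q"
  by (induction q) auto

lemma PS_ge: "1 \<le> p \<Longrightarrow> p \<le> q \<Longrightarrow> z \<in> Below y \<Longrightarrow> val p z \<Longrightarrow> p \<le> PS q y"
  by (induction q) (auto simp: le_Suc_eq)

lemma PS_valid: "PS q y \<noteq> 1 \<Longrightarrow> \<exists>z\<in>Below y. val (PS q y) z"
  by (induction q) (auto split: if_splits)

lemma pk_max:
  assumes y: "y \<in> vals" and o: "(r, u) \<in> opts y"
  shows "score (P y) r y u \<le> score (P y) (fst (pk y)) y (snd (pk y))"
proof -
  have s0: "\<forall>r. \<forall>u\<in>vals. 0 \<le> scoreS (P y) y r u" using score_nonneg by blast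
  show ?thesis using best(2)[OF y s0] best(3)[OF y s0 o] unfolding pk_def pick_def by simp
qed

end


section \<open>The computed choices satisfy the abstract assumptions\<close>

locale prog_code = prog + cd: unique_parents n f "set as" center
begin

lemma baseS_eq: assumes y: "y \<in> vals" shows "baseS y = cd.base y"
proof -
  have sr: "baseS y \<in> reach as [n] y" "\<And>u. u \<in> reach as [n] y \<Longrightarrow> keyS y u \<le> keyS y (baseS y)"
    unfolding baseS_def
    using search(1)[OF as, where ms = "[n]" and y = y and G = "keyS y"] search(2,3)[OF as, where ms = "[n]" and y = y and G = "keyS y"]
      n1 keyS_nonneg by (simp_all only: list.set empty_iff insert_iff) (auto simp del: reach.simps srS.simps mxS.simps)
  then obtain i c where ic: "i < n" "c < length as" "baseS y = y[i := as ! c]" by auto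
  have reachI: "y[j := s] \<in> reach as [n] y" if "j < n" "s \<in> set as" for j s
    using that by (auto simp: in_set_conv_nth)
  show ?thesis using y
  proof (cases rule: cd.base_cases)
    case (child j s)
    have "lower y (y[j := s])" unfolding lower_def using child cd.vals_len[OF y] by (intro exI[of _ j]) simp
    then have "keyS y (y[j := s]) = 2" using child by (simp add: keyS_def)
    then have "2 \<le> keyS y (baseS y)" using sr(2)[OF reachI[OF child(2,3)]] by simp
    then have "center (baseS y)" "lower y (baseS y)" by (auto simp: keyS_def split: if_splits)
    then have "cd.parent y (baseS y)"
      using ic cd.vals_len[OF y] unfolding lower_def
      by (metis ic(3) nth_list_update_neq nth_list_update_eq nth_mem cd.parentI less_irrefl)
    then show ?thesis using cd.parent_eq[OF y] by simp
  next
    case orphan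
    have yr: "y \<in> reach as [n] y"
      using reachI[of 0 "y ! 0"] n1 cd.vals_nth[OF y, of 0] by simp
    have "1 \<le> keyS y (baseS y)" using sr(2)[OF yr] by (auto simp: keyS_def split: if_splits)
    moreover have "\<not> (center (baseS y) \<and> lower y (baseS y))"
    proof
      assume a: "center (baseS y) \<and> lower y (baseS y)"
      then have "cd.parent y (baseS y)"
        using ic cd.vals_len[OF y] unfolding lower_def
        by (metis ic(3) nth_list_update_neq nth_list_update_eq nth_mem cd.parentI less_irrefl)
      then show False using orphan by blast
    qed
    ultimately have "\<forall>l<n. baseS y ! l = y ! l" by (auto simp: keyS_def split: if_splits)
    moreover have "length (baseS y) = n" using cd.vals_len[OF baseS_vals[OF y]] .
    ultimately have "baseS y = y" using cd.vals_len[OF y] by (intro nth_equalityI) auto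
    then show ?thesis using orphan by simp
  qed
qed

lemma Bl_eq: "y \<in> vals \<Longrightarrow> Bl y = cd.Bl y"
  by (simp add: fun_eq_iff Bl_def cd.Bl_def cd.dist_def baseS_eq)

lemma Below_eq: "y \<in> vals \<Longrightarrow> Below y = cd.Below y"
  by (simp add: Below_def cd.Below_def baseS_eq)

lemma stable_E: "y \<in> vals \<Longrightarrow> l < n \<Longrightarrow> cd.stable y l \<Longrightarrow> l \<in> scheme.E n (set as) Bl Below y"
  using cd.vals_upd by (simp add: scheme.E_def[OF sch] cd.stable_def Bl_eq Below_eq)

sublocale ch: choice n k D Gam "set as" "rk as" A c th Bl Below P pk
proof (intro choice.intro sch choice_axioms.intro)
  show "Bl y r \<subseteq> vals" for y r by (auto simp: Bl_def)
  show "y \<in> Bl y 1" if "y \<in> vals" for y using cd.own[OF that] Bl_eq[OF that] by simp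
  show "Bl (y[j := b]) r \<subseteq> Bl y (r + 3) \<and> Bl y r \<subseteq> Bl (y[j := b]) (r + 3)"
    if "y \<in> vals" "j < n" "b \<in> set as" "y ! j < b" for y j b r
    using cd.Bl_step[OF that(1,3)] Bl_eq[OF that(1)] Bl_eq[OF cd.vals_upd[OF that(1,3)]] by simp
  show "y \<in> Below y" if "y \<in> vals" for y using cd.Below_self[OF that] Below_eq[OF that] by simp
  show "z \<in> vals \<and> Bl z = Bl y \<and> (\<forall>l<n. z ! l \<le> y ! l \<and> (z ! l \<noteq> y ! l \<longrightarrow> l \<in> scheme.E n (set as) Bl Below y))"
    if y: "y \<in> vals" "z \<in> Below y" for y z
    using cd.Below[OF y(1), of z] y stable_E[OF y(1)] Below_eq[OF y(1)] Bl_eq by auto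
  show "1 \<le> P y" "P y \<le> k" for y using P_bounds[where y = y and q = k] k unfolding P_def by auto
  show "p \<le> P y" if "y \<in> vals" "1 \<le> p" "p \<le> k" "z \<in> Below y" "val p z" for y p z
    unfolding P_def using PS_ge that by blast
  show "\<exists>z\<in>Below y. val (P y) z" if "y \<in> vals" "P y \<noteq> 1" for y
    using PS_valid that unfolding P_def by blast
  show "pk y \<in> opts y" if "y \<in> vals" for y unfolding pk_def using pick_vals[OF that] by blast
  show "score (P y) r y u \<le> score (P y) (fst (pk y)) y (snd (pk y))" if "y \<in> vals" "(r, u) \<in> opts y" for y r u
    by (rule pk_max[OF that])
qed

end


section \<open>The transformation\<close>

text \<open>The definition lowers one coordinate at a time, so the vectors
  \<open>take m y @ drop m x\<close> lead from \<open>x\<close> to \<open>y\<close>.\<close>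

lemma downward_closed_le:
  assumes F: "downward_closed n F" "x \<in> F" and y: "length y = n" "\<And>i. i < n \<Longrightarrow> 0 \<le> y ! i \<and> y ! i \<le> x ! i"
  shows "y \<in> F"
proof -
  have x: "length x = n" using F by (simp add: downward_closed_def)
  have "take m y @ drop m x \<in> F" if "m \<le> n" for m
    using that
  proof (induction m)
    case 0 then show ?case using F by simp
  next
    case (Suc m)
    let ?z = "take m y @ drop m x"
    have "?z \<in> F" "m < n" using Suc by auto
    moreover have "?z ! m = x ! m" using x y Suc.prems by (simp add: nth_append)
    ultimately have "?z[m := y ! m] \<in> F" using F(1) y(2)[of m] unfolding downward_closed_def by auto
    moreover have "?z[m := y ! m] = take (Suc m) y @ drop (Suc m) x"
      using x y Suc.prems by (simp add: list_update_append take_Suc_conv_app_nth Cons_nth_drop_Suc[symmetric])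
    ultimately show ?case by simp
  qed
  from this[of n] show ?thesis using x y by simp
qed

lemma set_value_lists: "set (value_lists k a n) = a n ` {1..k}"
  by (simp add: value_lists_def atLeastLessThanSuc_atLeastAtMost del: upt_Suc)

text \<open>The hypothesis controls the ratios only for large \<open>n\<close>. The finitely many
  smaller \<open>n\<close> have finitely many values, and their quotients are absorbed into
  \<open>C\<close>. Since signs and order are not given, the estimates run over absolute
  values.\<close>

lemma gap_constant:
  fixes k :: nat and a :: "nat \<Rightarrow> nat \<Rightarrow> real"
  assumes om: "\<forall>i\<in>{1..<k}. (\<lambda>n. a n (i + 1) / a n i) \<in> \<Omega>(\<lambda>n. real n)"
  shows "\<exists>C::nat. 1 \<le> C \<and> (\<forall>n. \<forall>s\<in>set (value_lists k a n). \<forall>t\<in>set (value_lists k a n).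
     0 < s \<longrightarrow> s < t \<longrightarrow> real n * s \<le> real C * (t - s))"
proof -
  have "\<forall>i\<in>{1..<k}. \<exists>c>0. eventually (\<lambda>n. c * real n \<le> \<bar>a n (i + 1) / a n i\<bar>) sequentially"
  proof
    fix i assume "i \<in> {1..<k}"
    then have "(\<lambda>n. a n (i + 1) / a n i) \<in> \<Omega>(\<lambda>n. real n)" using om by blast
    then obtain c where "0 < c" "eventually (\<lambda>n. norm (a n (i + 1) / a n i) \<ge> c * norm (real n)) sequentially"
      by (rule landau_omega.bigE)
    then show "\<exists>c>0. eventually (\<lambda>n. c * real n \<le> \<bar>a n (i + 1) / a n i\<bar>) sequentially"
      by (intro exI[of _ c]) (simp only: real_norm_def abs_of_nat simp_thms)
  qed
  then obtain c where c: "\<And>i. i \<in> {1..<k} \<Longrightarrow> 0 < c i \<and> eventually (\<lambda>n. c i * real n \<le> \<bar>a n (i + 1) / a n i\<bar>) sequentially"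
    by metis
  define c0 where "c0 = Min (insert 1 (c ` {1..<k}))"
  have "0 < c0" unfolding c0_def by (subst Min_gr_iff) (use c in auto)
  moreover have "c0 \<le> c i" if "i \<in> {1..<k}" for i unfolding c0_def by (rule Min_le) (use that in auto)
  ultimately have c0: "0 < c0" "\<And>i. i \<in> {1..<k} \<Longrightarrow> c0 \<le> c i" by blast+
  have "eventually (\<lambda>n. \<forall>i\<in>{1..<k}. c i * real n \<le> \<bar>a n (i + 1) / a n i\<bar>) sequentially"
    using c by (intro eventually_ball_finite) auto
  \<comment> \<open>From \<open>c0 * n \<ge> 2\<close> on the absolute values at least double at
    each index. So positive \<open>s < t\<close> appear in this order, and
    \<open>t \<le> 2 * (t - s)\<close>.\<close>
  moreover have "eventually (\<lambda>n. 2 / c0 \<le> real n) sequentially"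
    by (meson eventually_sequentiallyI real_arch_simple order_trans of_nat_le_iff)
  ultimately have "eventually (\<lambda>n. (\<forall>i\<in>{1..<k}. c i * real n \<le> \<bar>a n (i + 1) / a n i\<bar>) \<and> 2 / c0 \<le> real n) sequentially"
    by eventually_elim simp
  then obtain N where N: "\<And>n. N \<le> n \<Longrightarrow> (\<forall>i\<in>{1..<k}. c i * real n \<le> \<bar>a n (i + 1) / a n i\<bar>) \<and> 2 / c0 \<le> real n"
    unfolding eventually_sequentially by blast
  let ?V = "\<lambda>n. set (value_lists k a n)"
  have large: "real n * s \<le> 2 / c0 * (t - s)" if n: "N \<le> n" and st: "s \<in> ?V n" "t \<in> ?V n" "0 < s" "s < t" for n s t
  proof -
    have n2: "2 \<le> c0 * real n" using N[OF n] c0(1) by (simp add: divide_le_eq mult.commute)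
    have step: "c0 * real n * \<bar>a n i\<bar> \<le> \<bar>a n (Suc i)\<bar>" if i: "i \<in> {1..<k}" for i
    proof (cases "a n i = 0")
      case False
      have "c0 * real n \<le> c i * real n" using c0(2)[OF i] by (intro mult_right_mono) auto
      also have "\<dots> \<le> \<bar>a n (i + 1)\<bar> / \<bar>a n i\<bar>" using N[OF n] i by simp
      finally show ?thesis using False by (simp add: le_divide_eq)
    qed simp
    have up: "c0 * real n * \<bar>a n i\<bar> \<le> \<bar>a n j\<bar>" if ij: "1 \<le> i" "i < j" "j \<le> k" for i j
      using ij(2,3)
    proof (induction j)
      case (Suc j)
      show ?case
      proof (cases "i = j")
        case True then show ?thesis using step[of i] ij Suc.prems by simp
      next
        case False
        then have IH: "c0 * real n * \<bar>a n i\<bar> \<le> \<bar>a n j\<bar>" using Suc by simp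
        have "1 * \<bar>a n j\<bar> \<le> c0 * real n * \<bar>a n j\<bar>" using n2 by (intro mult_right_mono) auto
        then show ?thesis using IH step[of j] Suc.prems ij by simp
      qed
    qed simp
    obtain i j where ij: "1 \<le> i" "i \<le> k" "s = a n i" "1 \<le> j" "j \<le> k" "t = a n j"
      using st unfolding set_value_lists by auto
    have "i < j"
    proof (rule ccontr)
      assume "\<not> i < j"
      then have "j < i" using ij st by (cases "i = j") auto
      then have "c0 * real n * t \<le> s" using up[of j i] ij st by simp
      moreover have "1 * t \<le> c0 * real n * t" using n2 st by (intro mult_right_mono) auto
      ultimately show False using st by simp
    qed
    then have u: "c0 * real n * s \<le> t" using up[of i j] ij st by simp
    have "2 * s \<le> c0 * real n * s" using n2 st by (intro mult_right_mono) auto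
    then have "c0 * (real n * s) \<le> 2 * (t - s)" using u by simp
    then show ?thesis using c0(1) by (simp add: le_divide_eq mult.commute)
  qed
  \<comment> \<open>The bound for large \<open>n\<close> together with all quotients that occur for
    the exceptional ones. Pairs with \<open>s \<ge> t\<close> are included too, which only enlarges
    the finite set.\<close>
  define X where "X = insert (2 / c0) ((\<lambda>(n, s, t). real n * s / (t - s)) ` (SIGMA n:{..<N}. ?V n \<times> ?V n))"
  have fX: "finite X" by (simp add: X_def)
  obtain C :: nat where C: "max 1 (Max X) \<le> real C" using real_arch_simple by blast
  have le: "x \<le> real C" if "x \<in> X" for x using Max_ge[OF fX that] C by simp
  have "real n * s \<le> real C * (t - s)" if st: "s \<in> ?V n" "t \<in> ?V n" "0 < s" "s < t" for n s t
  proof (cases "N \<le> n")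
    case True
    have "2 / c0 * (t - s) \<le> real C * (t - s)" using le[of "2 / c0"] st by (intro mult_right_mono) (auto simp: X_def)
    then show ?thesis using large[OF True st] by linarith
  next
    case False
    then have "real n * s / (t - s) \<in> X" using st unfolding X_def
      by (intro insertI2 image_eqI[of _ _ "(n, s, t)"]) auto
    then have "real n * s / (t - s) \<le> real C" by (rule le)
    then show ?thesis using st by (simp add: pos_divide_le_eq)
  qed
  moreover have "1 \<le> C" using C by simp
  ultimately show ?thesis by blast
qed

context prog
begin

definition queries :: "real list \<Rightarrow> real list list" where
  "queries v = concat (map (\<lambda>i. qs n as f outE (\<lambda>_. i) (\<lambda>_. v)) [0..<n])"

lemma queries_vals: "v \<in> vals \<Longrightarrow> set (queries v) \<subseteq> vals"
proof -
  assume v: "v \<in> vals"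
  have "set (qs n as f outE (\<lambda>_. i) (\<lambda>_. v)) \<subseteq> vals" if "i < n" for i
    by (rule qs_valuations[OF f(2) wf_out]) (use that v in auto)
  then show ?thesis by (simp add: queries_def UN_subset_iff)
qed

lemma runs_out:
  assumes v: "v \<in> vals"
  shows "\<exists>t. runs n as (program k F outE) A v t (queries v) (map (TT v) [0..<n]) \<and>
    t \<le> (n + k) * (tm (n + k) outE + 10 + 5 * nt outE + nv outE) + 5 * nt outE + nv outE + 20"
proof -
  have l: "length v = n" using v by (simp add: valuations_def)
  have F: "1 \<le> F" by (simp add: F_def)
  have m: "map (\<lambda>i. ev n as (free_count F n) A outE (\<lambda>_. i) (\<lambda>_. v)) [0..<n] = map (TT v) [0..<n]"
    using ev_out[OF v] by (simp add: f_def)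
  show ?thesis unfolding queries_def f_def by (rule program_runs[OF n1 F l wf_out, of as A, unfolded len m])
qed

lemma transformed_T: "v \<in> vals \<Longrightarrow> transformed n as (program k F outE) A v = map (TT v) [0..<n]"
  using runs_out transformed_eq by blast

lemma feasible:
  assumes small: "2 * th ^ D * real Gam ^ k \<le> 1" and bb: "black_box n as Fs A" and v: "v \<in> vals"
  shows "map (TT v) [0..<n] \<in> Fs"
proof -
  let ?u = "snd (pk v)"
  have u: "?u \<in> vals" using pick_vals[OF v] unfolding pk_def by blast
  have "A ?u \<in> Fs" using bb u by (simp add: black_box_def allocation_rule_def)
  moreover have "0 \<le> TT v i \<and> TT v i \<le> A ?u ! i" if "i < n" for i
    using T_nonneg[OF v that] T_le_xi[OF v that] xi_le[OF v that small] by linarith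
  ultimately show ?thesis
    using downward_closed_le[of n Fs "A ?u" "map (TT v) [0..<n]"] bb by (simp add: black_box_def)
qed

lemma monotone_T: "monotone_rule n (set as) (transformed n as (program k F outE) A)"
  unfolding monotone_rule_def
proof (intro ballI allI impI)
  fix v i b assume a: "v \<in> vals" "i < n" "b \<in> set as" "v ! i \<le> b"
  have "v[i := b] \<in> vals" using a by (auto simp: valuations_def dest: set_update_subset_insert[THEN subsetD])
  then show "transformed n as (program k F outE) A v ! i \<le> transformed n as (program k F outE) A (v[i := b]) ! i"
    using T_mono[OF a] a by (simp add: transformed_T)
qed

lemma welfare_T: "v \<in> vals \<Longrightarrow> welfare v (transformed n as (program k F outE) A v) = (\<Sum>i<n. v ! i * TT v i)"
  by (simp add: transformed_T welfare_def valuations_def)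

lemma welfare_nonpos:
  assumes "\<forall>t\<in>set as. t \<le> 0" and v: "v \<in> vals"
  shows "welfare v (transformed n as (program k F outE) A v) = 0" "welfare v (A v) \<le> 0"
proof -
  have v0: "v ! i \<le> 0" if "i < n" for i
  proof -
    have "v ! i \<in> set as" using v that by (auto simp: valuations_def)
    then show ?thesis using assms(1) by blast
  qed
  show "welfare v (transformed n as (program k F outE) A v) = 0"
    unfolding welfare_T[OF v] using T_nonpos[OF v] v0 by (intro sum.neutral) auto
  have "length v = n" using v by (simp add: valuations_def)
  then show "welfare v (A v) \<le> 0" unfolding welfare_def
    using v0 A0[OF v] by (intro sum_nonpos mult_nonpos_nonneg) auto
qed

definition fraction :: real where "fraction = scheme.xm k c / 6 * (scheme.kap c k / 16)"

lemma fraction_eq: "fraction = 1 / (C * S k) / 48 * (1 / S k / 16)"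
  unfolding fraction_def scheme.xm_def[OF sch] kap_eq by (simp add: c_def)

end

context prog_code
begin

lemma constant_welfare:
  assumes v: "v \<in> vals"
  shows "fraction * welfare v (A v) \<le> welfare v (transformed n as (program k F outE) A v)"
proof -
  have fr: "0 \<le> fraction" by (simp add: fraction_eq)
  have len: "length v = n" using v by (simp add: valuations_def)
  have "welfare v (A v) \<le> (\<Sum>i<n. if 0 < v ! i then v ! i * A v ! i else 0)"
    unfolding welfare_def len using A0[OF v] by (intro sum_mono) (auto simp: mult_nonpos_nonneg not_less)
  then have "fraction * welfare v (A v) \<le> fraction * (\<Sum>i<n. if 0 < v ! i then v ! i * A v ! i else 0)"
    using fr by (intro mult_left_mono)
  also have "\<dots> \<le> (\<Sum>i<n. v ! i * TT v i)"
    using ch.constant_fraction[of v] v unfolding fraction_def ch.vals_def by simp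
  finally show ?thesis using welfare_T[OF v] by simp
qed

lemma full_welfare_center:
  assumes small: "2 * th ^ D * real Gam ^ k \<le> 1" and pos: "\<forall>t\<in>set as. 0 < t"
    and w: "w \<in> vals" "center w" and alt: "(\<forall>s\<in>set as. \<forall>t\<in>set as. s < t \<longrightarrow> 2 * s \<le> t) \<or> n = 1"
  shows "welfare w (A w) \<le> welfare w (transformed n as (program k F outE) A w)"
proof -
  have len: "length w = n" using w by (simp add: valuations_def)
  have "(\<Sum>i<n. w ! i * A w ! i) \<le> (\<Sum>i<n. w ! i * TT w i)"
  proof (rule ch.full_welfare[OF _ pos small])
    show "w \<in> ch.vals" using w by (simp add: ch.vals_def)
    show "l \<in> ch.E w" if "l < n" for l using stable_E[OF w(1) that] cd.center_stable[OF w that] by blast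
    show "w \<in> Bl w 0" using cd.center_own[OF w] Bl_eq[OF w(1)] by simp
    show "(\<forall>s\<in>set as. \<forall>t\<in>set as. s < t \<longrightarrow> 2 * s \<le> t) \<or> (\<forall>r. Bl w r = Bl w 0)"
    proof (cases "n = 1")
      case True
      then have "n \<le> f" using f by simp
      then have "Bl w r = vals" for r using cd.Bl_all_free Bl_eq[OF w(1)] by simp
      then show ?thesis by simp
    qed (use alt in blast)
  qed
  then show ?thesis unfolding welfare_T[OF w(1)] by (simp add: welfare_def len)
qed

end

text \<open>Without centers each vector is its own base, and the conditions on parents hold
  vacuously. This version needs no strict order on the values.\<close>

lemma (in prog) no_centers: "\<not> flag \<Longrightarrow> prog_code k C D flag n as A"
proof -
  assume "\<not> flag"
  then have "\<not> center w" for w unfolding center_def by blast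
  then show ?thesis by unfold_locales simp_all
qed

text \<open>The program tries only finitely many quotients. The point is that all possible ones are
  among them, so that the tests decide divisibility.\<close>

lemma (in prog) strict_values:
  assumes flag: "flag" and pos: "\<forall>t\<in>set as. 0 < t" and dist: "distinct as"
  shows "ranked n f k (set as) (\<lambda>t. rk as t - 1) center"
proof
  show "1 \<le> f" "f \<le> n" by (fact f)+
  have "n - f = (n - 1) - (n - 1) mod F" unfolding f_def free_count_def by simp
  then show "fact k dvd n - f" by (simp add: F_def minus_mod_eq_mult_div)
  have r1: "1 \<le> rk as t \<and> rk as t \<le> k" if "t \<in> set as" for t using scheme.rk1[OF sch that] pos that by blast
  show less: "rk as s - 1 < rk as t - 1" if "s \<in> set as" "t \<in> set as" "s < t" for s t
    by (rule diff_less_mono) (use scheme.rk2[OF sch that(1,2) _ that(3)] pos that r1[OF that(1)] in auto)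
  have inj: "inj_on (\<lambda>t. rk as t - 1) (set as)"
    by (rule inj_onI) (metis less less_irrefl linorder_neqE_linordered_idom)
  have sub: "(\<lambda>t. rk as t - 1) ` set as \<subseteq> {..<k}" using r1 by force
  have "card ((\<lambda>t. rk as t - 1) ` set as) = k" using card_image[OF inj] distinct_card[OF dist] len by simp
  then have "(\<lambda>t. rk as t - 1) ` set as = {..<k}" using sub by (intro card_subset_eq) auto
  then show bij: "bij_betw (\<lambda>t. rk as t - 1) (set as) {..<k}" using inj by (simp add: bij_betw_def)
  fix w assume w: "w \<in> vals"
  let ?l = "\<lambda>l. rk as (w ! l) - 1"
  let ?S1 = "\<Sum>l\<in>{f..<n}. ?l l" and ?S2 = "\<Sum>l\<in>{f..<n}. (l - f + 1) * ?l l"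
  let ?p = "n - f + 1"
  have wl: "1 \<le> rk as (w ! l)" "?l l \<le> k - 1" if "l < n" for l
  proof -
    have "w ! l \<in> set as" using w that by (auto simp: valuations_def)
    then show "1 \<le> rk as (w ! l)" "?l l \<le> k - 1" using r1[of "w ! l"] by auto
  qed
  have S1: "sum1 w = real ?S1"
    unfolding sum1_def of_nat_sum
    by (rule sum.mono_neutral_cong_right) (use wl in \<open>auto simp: of_nat_diff\<close>)
  have S2: "sum2 w = real ?S2"
    unfolding sum2_def of_nat_sum
  proof (rule sum.mono_neutral_cong_right)
    fix l assume l: "l \<in> {f..<n}"
    then have "\<not> l < f" "f \<le> l" "1 \<le> rk as (w ! l)" using wl by auto
    then show "(if l < f then 0 else (real l - real f + 1) * (real (rk as (w ! l)) - 1)) = real ((l - f + 1) * ?l l)"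
      by (simp only: if_False of_nat_mult of_nat_add of_nat_diff of_nat_1)
  qed auto
  have p: "real n - real f + 1 = real ?p" using f by (simp add: of_nat_diff)
  have b1: "?S1 \<le> (n - f) * (k - 1)"
    using sum_bounded_above[of "{f..<n}" ?l "k - 1"] wl by simp
  have "?S2 \<le> (\<Sum>l\<in>{f..<n}. (n - f) * (k - 1))" using wl by (intro sum_mono mult_le_mono) auto
  then have b2: "?S2 \<le> (n - f) * ((n - f) * (k - 1))" by simp
  have e1: "(\<exists>m<n. sum1 w = real m * real (k - 1)) \<longleftrightarrow> (k - 1) dvd ?S1"
  proof
    assume "\<exists>m<n. sum1 w = real m * real (k - 1)"
    then obtain m where "real ?S1 = real (m * (k - 1))" unfolding S1 by auto
    then have "?S1 = m * (k - 1)" by (simp only: of_nat_eq_iff)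
    then show "(k - 1) dvd ?S1" by (rule dvdI[OF trans[OF _ mult.commute]])
  next
    assume "(k - 1) dvd ?S1"
    then obtain m where m: "?S1 = (k - 1) * m" by (elim dvdE)
    show "\<exists>m<n. sum1 w = real m * real (k - 1)"
    proof (cases "k - 1 = 0")
      case True
      then show ?thesis using m n1 unfolding S1 by (intro exI[of _ 0]) simp
    next
      case False
      have "(k - 1) * m \<le> (k - 1) * (n - f)" using b1 m by (simp add: mult.commute)
      then have "m \<le> n - f" using False by simp
      then have "m < n" using f by simp
      moreover have "real ?S1 = real m * real (k - 1)" unfolding m by simp
      ultimately show ?thesis unfolding S1 by blast
    qed
  qed
  have e2: "(\<exists>m<n. \<exists>m'<n. sum2 w = (real m * real n + real m') * (real n - real f + 1)) \<longleftrightarrow> ?p dvd ?S2"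
  proof
    assume "\<exists>m<n. \<exists>m'<n. sum2 w = (real m * real n + real m') * (real n - real f + 1)"
    then obtain m m' where "sum2 w = (real m * real n + real m') * (real n - real f + 1)" by blast
    then have "real ?S2 = real ((m * n + m') * ?p)" unfolding S2 p by (simp only: of_nat_mult of_nat_add)
    then have "?S2 = (m * n + m') * ?p" by (simp only: of_nat_eq_iff)
    then show "?p dvd ?S2" by (rule dvdI[OF trans[OF _ mult.commute]])
  next
    assume "?p dvd ?S2"
    then obtain q where q: "?S2 = ?p * q" by (elim dvdE)
    \<comment> \<open>Unless all coordinates are free, \<open>k!\<close> divides the positive number
      \<open>n - f\<close>, so \<open>k \<le> n - f\<close>. Hence the factor \<open>k - 1\<close>
      in the bound for the weighted sum is below \<open>n\<close>.\<close>
    have "q < n * n"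
    proof (cases "n - f = 0")
      case True
      then have "?S2 = 0" using b2 by simp
      then show ?thesis using q n1 by simp
    next
      case False
      have "fact k dvd n - f" using \<open>fact k dvd n - f\<close> .
      then have "(fact k :: nat) \<le> n - f" using False by (intro dvd_imp_le) auto
      then have kn: "k \<le> n - f" using fact_ge_self[of k] by linarith
      have "?p * q \<le> ?p * ((n - f) * (k - 1))" using b2 q mult_le_mono1[of "n - f" ?p "(n - f) * (k - 1)"] by linarith
      then have "q \<le> (n - f) * (k - 1)" by (rule mult_left_le_imp_le) simp
      also have "\<dots> \<le> (n - f) * n" using kn by (intro mult_left_mono) auto
      also have "\<dots> < n * n" using f n1 by simp
      finally show ?thesis .
    qed
    then have "q div n < n" "q mod n < n" using n1 by (simp_all add: less_mult_imp_div_less)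
    moreover have "real q = real (q div n) * real n + real (q mod n)"
      by (metis div_mult_mod_eq of_nat_add of_nat_mult)
    then have "real ?S2 = (real (q div n) * real n + real (q mod n)) * real ?p"
      unfolding q of_nat_mult by (simp only: mult.commute)
    ultimately show "\<exists>m<n. \<exists>m'<n. sum2 w = (real m * real n + real m') * (real n - real f + 1)"
      unfolding S2 p by blast
  qed
  show "center w \<longleftrightarrow> (k - 1) dvd ?S1 \<and> ?p dvd ?S2" unfolding center_def e1 e2 using flag by simp
qed


lemma small_exists:
  fixes th :: real
  assumes "0 < th" "th < 1"
  shows "\<exists>D::nat. 1 \<le> D \<and> 2 * th ^ D * G \<le> 1"
proof -
  have "0 < 1 / (2 * \<bar>G\<bar> + 1)" by (simp add: add_nonneg_pos)
  then obtain m where m: "th ^ m < 1 / (2 * \<bar>G\<bar> + 1)" using real_arch_pow_inv[OF _ assms(2)] by blast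
  have "th ^ Suc m \<le> th ^ m" using assms by (intro power_decreasing) auto
  then have t: "th ^ Suc m \<le> 1 / (2 * \<bar>G\<bar> + 1)" using m by linarith
  have "2 * th ^ Suc m * G \<le> th ^ Suc m * (2 * \<bar>G\<bar> + 1)"
  proof -
    have "2 * G \<le> 2 * \<bar>G\<bar> + 1" by simp
    then have "th ^ Suc m * (2 * G) \<le> th ^ Suc m * (2 * \<bar>G\<bar> + 1)" using assms by (intro mult_left_mono) auto
    then show ?thesis by (simp only: ac_simps)
  qed
  also have "\<dots> \<le> 1 / (2 * \<bar>G\<bar> + 1) * (2 * \<bar>G\<bar> + 1)" using t by (intro mult_right_mono) auto
  also have "\<dots> = 1" by (simp add: add_nonneg_pos[THEN less_imp_neq, symmetric])
  finally show ?thesis by (intro exI[of _ "Suc m"]) auto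
qed

section \<open>One program for all numbers of agents\<close>

locale family = params k C D flag for k C D :: nat and flag :: bool +
  fixes a :: "nat \<Rightarrow> nat \<Rightarrow> real"
  assumes k: "1 \<le> k" and C: "1 \<le> C" and D: "1 \<le> D"
    and gap: "s \<in> set (value_lists k a n) \<Longrightarrow> t \<in> set (value_lists k a n) \<Longrightarrow> 0 < s \<Longrightarrow> s < t \<Longrightarrow>
      real n * s \<le> real C * (t - s)"
    and small: "2 * (1 - 1 / C * (1 / C / 64) ^ k / 8 / 24) ^ D * real Gam ^ k \<le> 1"
begin

abbreviation "values \<equiv> value_lists k a"

definition trans_prog :: com where "trans_prog = program k F outE"

lemma is_prog: assumes n: "1 \<le> n" and bb: "black_box n (values n) Fs A" shows "prog k C D n (values n) A"
proof
  show "length (values n) = k" by (simp add: value_lists_def)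
  fix u i assume "u \<in> valuations n (set (values n))" "i < n"
  moreover then have "A u \<in> Fs" using bb by (simp add: black_box_def allocation_rule_def)
  ultimately show "0 \<le> A u ! i" using bb by (simp add: black_box_def downward_closed_def)
qed (use n k C D gap in auto)

lemma runs_same: "runs n as T A v t Q x \<Longrightarrow> runs n as T A v t' Q' x' \<Longrightarrow> Q = Q'"
  unfolding runs_def using exec_deterministic by blast

lemma small_prog: "prog k C D n as A \<Longrightarrow> 2 * prog.th k C ^ D * real Gam ^ k \<le> 1"
  using small prog.th_def[of k C D n as A] prog.c_def[of k C D n as A] by simp

lemma is_transformation: "transformation values trans_prog"
  unfolding transformation_def trans_prog_def
proof (intro allI impI ballI)
  fix n Fs A v assume n: "1 \<le> n" and bb: "black_box n (values n) Fs A" and v: "v \<in> valuations n (set (values n))"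
  interpret p: prog k C D flag n "values n" A by (rule is_prog[OF n bb])
  show "\<exists>t Q x. runs n (values n) (program k F outE) A v t Q x \<and> set Q \<subseteq> valuations n (set (values n)) \<and> x \<in> Fs"
    using p.runs_out[OF v] p.queries_vals[OF v] p.feasible[OF small_prog[OF p.prog_axioms] bb v] by blast
qed

text \<open>The list \<open>queries\<close> is defined without reference to the black box.\<close>

lemma is_nonadaptive: "nonadaptive values trans_prog"
  unfolding nonadaptive_def trans_prog_def
proof (intro allI impI ballI)
  fix n Fs A Fs' A' v t Q x t' Q' x'
  assume n: "1 \<le> n" and bb: "black_box n (values n) Fs A" "black_box n (values n) Fs' A'"
    and v: "v \<in> valuations n (set (values n))"
    and r: "runs n (values n) (program k F outE) A v t Q x" "runs n (values n) (program k F outE) A' v t' Q' x'"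
  interpret p: prog k C D flag n "values n" A by (rule is_prog[OF n bb(1)])
  interpret p': prog k C D flag n "values n" A' by (rule is_prog[OF n bb(2)])
  have "Q = p.queries v" using p.runs_out[OF v] runs_same[OF r(1)] by blast
  moreover have "Q' = p'.queries v" using p'.runs_out[OF v] runs_same[OF r(2)] by blast
  ultimately show "Q = Q'" unfolding p.queries_def p'.queries_def by simp
qed

text \<open>The expression depends on \<open>k\<close>, \<open>C\<close>, \<open>D\<close> and
  \<open>flag\<close> only, so one exponent serves all \<open>n\<close>; the shift by
  \<open>k\<close> is absorbed through \<open>n + k \<le> n * (k + 1)\<close>.\<close>

lemma is_polynomial: "polynomial_time values trans_prog"
proof -
  obtain c d where tm: "\<And>B. 1 \<le> B \<Longrightarrow> tm B outE \<le> c * B ^ d" using tm_poly by blast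
  define c1 where "c1 = 10 + 5 * nt outE + nv outE"
  define c2 where "c2 = 5 * nt outE + nv outE + 20"
  define K where "K = (k + 1) * (c * (k + 1) ^ d + c1) + c2"
  have bound: "(n + k) * (tm (n + k) outE + c1) + c2 \<le> K * n ^ (d + 1)" if n: "1 \<le> n" for n
  proof -
    have nk: "n + k \<le> n * (k + 1)" using n by (simp add: algebra_simps)
    have nd: "1 \<le> n ^ d" "1 \<le> n ^ (d + 1)" using n by auto
    have "tm (n + k) outE \<le> c * (n + k) ^ d" using tm n by simp
    also have "\<dots> \<le> c * (n * (k + 1)) ^ d" using nk by (intro mult_le_mono2 power_mono) auto
    also have "\<dots> = c * (k + 1) ^ d * n ^ d" by (simp only: power_mult_distrib ac_simps)
    finally have t1: "tm (n + k) outE \<le> c * (k + 1) ^ d * n ^ d" .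
    have t2: "c1 \<le> c1 * n ^ d" using nd(1) by simp
    have "tm (n + k) outE + c1 \<le> (c * (k + 1) ^ d + c1) * n ^ d"
      unfolding distrib_right by (rule add_mono[OF t1 t2])
    then have "(n + k) * (tm (n + k) outE + c1) \<le> (n * (k + 1)) * ((c * (k + 1) ^ d + c1) * n ^ d)"
      by (rule mult_le_mono[OF nk])
    also have "\<dots> = (k + 1) * (c * (k + 1) ^ d + c1) * n ^ (d + 1)" by (simp only: power_add power_one_right ac_simps)
    finally have t3: "(n + k) * (tm (n + k) outE + c1) \<le> (k + 1) * (c * (k + 1) ^ d + c1) * n ^ (d + 1)" .
    have "c2 \<le> c2 * n ^ (d + 1)" using nd(2) by simp
    then show ?thesis unfolding K_def distrib_right[of _ c2] using t3 by linarith
  qed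
  show ?thesis unfolding polynomial_time_def
  proof (rule exI[of _ K], rule exI[of _ "d + 1"], intro allI impI ballI)
    fix n Fs A v assume n: "1 \<le> n" and bb: "black_box n (values n) Fs A" and v: "v \<in> valuations n (set (values n))"
    interpret p: prog k C D flag n "values n" A by (rule is_prog[OF n bb])
    obtain t where t: "runs n (values n) trans_prog A v t (p.queries v) (map (p.TT v) [0..<n])"
      "t \<le> (n + k) * (tm (n + k) outE + c1) + c2"
      using p.runs_out[OF v] unfolding trans_prog_def c1_def c2_def add.assoc by blast
    then show "\<exists>t Q x. runs n (values n) trans_prog A v t Q x \<and> t \<le> K * n ^ (d + 1)"
      using bound[OF n] le_trans by blast
  qed
qed

lemma is_monotone: "monotone_transformation values trans_prog"
  unfolding monotone_transformation_def trans_prog_def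
  using prog.monotone_T[OF is_prog] by blast

text \<open>If no value is positive, the output has welfare 0 and that of \<open>A\<close> is at
  most 0, so the code is needed only when a positive value exists.\<close>

lemma is_constant:
  assumes code: "\<And>n Fs A. 1 \<le> n \<Longrightarrow> black_box n (values n) Fs A \<Longrightarrow> (\<exists>t\<in>set (values n). 0 < t) \<Longrightarrow>
      prog_code k C D flag n (values n) A"
  shows "constant_fraction_preserving values trans_prog"
  unfolding constant_fraction_preserving_def
proof (intro exI conjI allI impI ballI)
  let ?c = "1 / (C * S k) / 48 * (1 / S k / 16) :: real"
  have S: "1 \<le> S k" using C by (simp add: S_def)
  show c0: "0 < ?c" using C S by simp
  fix n Fs A v assume n: "1 \<le> n" and bb: "black_box n (values n) Fs A" and v: "v \<in> valuations n (set (values n))"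
  interpret p: prog k C D flag n "values n" A by (rule is_prog[OF n bb])
  show "?c * welfare v (A v) \<le> welfare v (transformed n (values n) trans_prog A v)"
  proof (cases "\<exists>t\<in>set (values n). 0 < t")
    case True
    interpret q: prog_code k C D flag n "values n" A by (rule code[OF n bb True])
    show ?thesis using q.constant_welfare[OF v] unfolding trans_prog_def p.fraction_eq .
  next
    case False
    then have "\<forall>t\<in>set (values n). t \<le> 0" by (auto simp: not_less)
    note w = p.welfare_nonpos[OF this v]
    have "?c * welfare v (A v) \<le> 0" using w(2) c0 by (intro mult_nonneg_nonpos) auto
    then show ?thesis using w(1) unfolding trans_prog_def by (simp only:)
  qed
qed

end

text \<open>A positive ratio forces neighbouring values to have the same sign, so one positive value
  makes all positive. Then a ratio above \<open>n \<ge> 1\<close> makes them strictly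
  increasing.\<close>

lemma ratio_values:
  fixes a :: "nat \<Rightarrow> nat \<Rightarrow> real"
  assumes n: "1 \<le> n" and r: "\<forall>i\<in>{1..<k}. real n < a n (i + 1) / a n i" and pos: "\<exists>t\<in>set (value_lists k a n). 0 < t"
  shows "\<forall>t\<in>set (value_lists k a n). 0 < t" "distinct (value_lists k a n)"
    "\<forall>s\<in>set (value_lists k a n). \<forall>t\<in>set (value_lists k a n). s < t \<longrightarrow> real n * s \<le> t"
proof -
  have sgn: "0 < a n (Suc i) \<longleftrightarrow> 0 < a n i" if "i \<in> {1..<k}" for i
  proof -
    have "0 < a n (Suc i) / a n i" using r that n by fastforce
    then show ?thesis by (auto simp: zero_less_divide_iff)
  qed
  have all: "0 < a n i \<longleftrightarrow> 0 < a n 1" if "1 \<le> i" "i \<le> k" for i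
    using that
  proof (induction i rule: dec_induct)
    case (step i)
    then show ?case using sgn[of i] by simp
  qed simp
  obtain i0 where "1 \<le> i0" "i0 \<le> k" "0 < a n i0" using pos unfolding set_value_lists by auto
  then have p: "0 < a n i" if "1 \<le> i" "i \<le> k" for i using all[of i0] all[OF that] by simp
  then show "\<forall>t\<in>set (value_lists k a n). 0 < t" unfolding set_value_lists by auto
  have step: "real n * a n i < a n (Suc i)" if "i \<in> {1..<k}" for i
    using r that p[of i] by (auto simp: less_divide_eq)
  have inc: "a n i < a n (Suc i)" if "i \<in> {1..<k}" for i
  proof -
    have "1 * a n i \<le> real n * a n i" using n p[of i] that by (intro mult_right_mono) auto
    then show ?thesis using step[OF that] by simp
  qed
  have up: "real n * a n i < a n j \<and> a n i < a n j" if "1 \<le> i" "i < j" "j \<le> k" for i j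
    using that(2,3)
  proof (induction j)
    case (Suc j)
    show ?case
    proof (cases "i = j")
      case True then show ?thesis using step[of i] inc[of i] that(1) Suc.prems by simp
    next
      case False
      then show ?thesis using Suc.IH Suc.prems inc[of j] that(1) by simp
    qed
  qed simp
  have "inj_on (a n) (set [1..<Suc k])"
  proof (rule inj_onI)
    fix i j assume ij: "i \<in> set [1..<Suc k]" "j \<in> set [1..<Suc k]" "a n i = a n j"
    show "i = j" using up[of i j] up[of j i] ij by (cases i j rule: linorder_cases) auto
  qed
  then show "distinct (value_lists k a n)" unfolding value_lists_def by (simp add: distinct_map del: upt_Suc)
  show "\<forall>s\<in>set (value_lists k a n). \<forall>t\<in>set (value_lists k a n). s < t \<longrightarrow> real n * s \<le> t"
  proof (intro ballI impI)
    fix s t assume st: "s \<in> set (value_lists k a n)" "t \<in> set (value_lists k a n)" "s < t"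
    then obtain i j where ij: "1 \<le> i" "i \<le> k" "s = a n i" "1 \<le> j" "j \<le> k" "t = a n j"
      unfolding set_value_lists by auto
    then have "i < j" using st(3) up[of j i] by (cases i j rule: linorder_cases) auto
    then show "real n * s \<le> t" using up[of i j] ij by simp
  qed
qed

lemma card_valuations: "distinct as \<Longrightarrow> card (valuations n (set as)) = length as ^ n"
  using card_lists_length_eq[of "set as" n] distinct_card[of as] unfolding valuations_def by (simp add: conj_commute)

theorem theorem9:
  fixes k :: nat and a :: "nat \<Rightarrow> nat \<Rightarrow> real"
  assumes "k \<ge> 1"
    and "\<forall>i\<in>{1..<k}. (\<lambda>n. a n (i + 1) / a n i) \<in> \<Omega>(\<lambda>n. real n)"
  shows "(\<exists>T. transformation (value_lists k a) T \<and>
            nonadaptive (value_lists k a) T \<and>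
            polynomial_time (value_lists k a) T \<and>
            monotone_transformation (value_lists k a) T \<and>
            constant_fraction_preserving (value_lists k a) T) \<and>
         ((\<forall>n\<ge>1. \<forall>i\<in>{1..<k}. a n (i + 1) / a n i > real n) \<longrightarrow>
          (\<exists>T. transformation (value_lists k a) T \<and>
            nonadaptive (value_lists k a) T \<and>
            polynomial_time (value_lists k a) T \<and>
            monotone_transformation (value_lists k a) T \<and>
            constant_fraction_preserving (value_lists k a) T \<and>
            preserves_full_welfare_at_fraction (value_lists k a) T
              (\<lambda>n. 1 / ((real k - 1) * real n))))"
proof -
  obtain C :: nat where C: "1 \<le> C" and gap: "\<forall>n. \<forall>s\<in>set (value_lists k a n). \<forall>t\<in>set (value_lists k a n).
     0 < s \<longrightarrow> s < t \<longrightarrow> real n * s \<le> real C * (t - s)"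
    using gap_constant[OF assms(2)] by blast
  let ?th = "1 - 1 / real C * (1 / real C / 64) ^ k / 8 / 24"
  define x where "x = 1 / real C * (1 / real C / 64) ^ k"
  have "x \<le> 1 * 1"
    unfolding x_def using C by (intro mult_mono power_le_one) (auto simp: divide_le_eq)
  moreover have "0 < x" using C by (simp add: x_def)
  ultimately have "0 < ?th" "?th < 1" unfolding x_def[symmetric] by auto
  \<comment> \<open>\<open>D\<close> can be chosen last because neither \<open>th\<close> nor
    \<open>Gam\<close> depends on it.\<close>
  then obtain D where D: "1 \<le> D" "2 * ?th ^ D * real (params.Gam k C) ^ k \<le> 1"
    using small_exists by blast
  have fam: "family k C D a"
    using assms(1) C D gap by unfold_locales auto
  \<comment> \<open>For small \<open>n\<close> the asymptotic hypothesis permits repeated or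
    nonpositive values, for which centers need not be unique; so they are switched off.\<close>
  have first: "constant_fraction_preserving (value_lists k a) (family.trans_prog k C D False)"
    using family.is_constant[OF fam] prog.no_centers[OF family.is_prog[OF fam]] by blast
  have second: "constant_fraction_preserving (value_lists k a) (family.trans_prog k C D True) \<and>
      preserves_full_welfare_at_fraction (value_lists k a) (family.trans_prog k C D True) (\<lambda>n. 1 / ((real k - 1) * real n))"
    if ratio: "\<forall>n\<ge>1. \<forall>i\<in>{1..<k}. a n (i + 1) / a n i > real n"
  proof
    interpret fm: family k C D True a by (rule fam)
    have ranked: "ranked n (prog.f k n) k (set (fm.values n)) (\<lambda>t. rk (fm.values n) t - 1) (prog.center k True n (fm.values n))"
      if n: "1 \<le> n" and bb: "black_box n (fm.values n) Fs A" and pos: "\<exists>t\<in>set (fm.values n). 0 < t" for n Fs A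
      using prog.strict_values[OF fm.is_prog[OF n bb]] ratio_values(1,2)[OF n _ pos] ratio n by simp
    have code: "prog_code k C D True n (fm.values n) A"
      if n: "1 \<le> n" and bb: "black_box n (fm.values n) Fs A" and pos: "\<exists>t\<in>set (fm.values n). 0 < t" for n Fs A
    proof -
      interpret p: prog k C D True n "fm.values n" A by (rule fm.is_prog[OF n bb])
      interpret r: ranked n p.f k "set (fm.values n)" "\<lambda>t. rk (fm.values n) t - 1" p.center by (rule ranked[OF n bb pos])
      show ?thesis by (intro prog_code.intro p.prog_axioms r.unique_parents_axioms)
    qed
    show "constant_fraction_preserving fm.values fm.trans_prog" by (rule fm.is_constant[OF code])
    show "preserves_full_welfare_at_fraction fm.values fm.trans_prog (\<lambda>n. 1 / ((real k - 1) * real n))"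
      unfolding preserves_full_welfare_at_fraction_def
    proof (intro allI impI)
      fix n Fs A assume n: "1 \<le> n" and bb: "black_box n (fm.values n) Fs A"
      interpret p: prog k C D True n "fm.values n" A by (rule fm.is_prog[OF n bb])
      let ?V = "valuations n (set (fm.values n))"
      let ?G = "{v \<in> ?V. welfare v (A v) \<le> welfare v (transformed n (fm.values n) fm.trans_prog A v)}"
      have fin: "finite ?V"
        using finite_lists_length_eq[of "set (fm.values n)" n] unfolding valuations_def by (simp add: conj_commute)
      show "1 / ((real k - 1) * real n) * real (card ?V) \<le> real (card ?G)"
      \<comment> \<open>For \<open>k = 1\<close> the required fraction is a division by zero, which
        is 0.\<close>
      proof (cases "k = 1")
        case False
        then have k2: "2 \<le> k" using assms(1) by simp
        then have kn: "1 \<le> (real k - 1) * real n" using n mult_mono[of 1 "real k - 1" 1 "real n"] by simp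
        show ?thesis
        proof (cases "\<exists>t\<in>set (fm.values n). 0 < t")
          case True
          interpret q: prog_code k C D True n "fm.values n" A by (rule code[OF n bb True])
          interpret r: ranked n p.f k "set (fm.values n)" "\<lambda>t. rk (fm.values n) t - 1" p.center by (rule ranked[OF n bb True])
          have rn: "\<forall>i\<in>{1..<k}. real n < a n (i + 1) / a n i" using ratio n by blast
          note rv = ratio_values[OF n rn True]
          have alt: "(\<forall>s\<in>set (fm.values n). \<forall>t\<in>set (fm.values n). s < t \<longrightarrow> 2 * s \<le> t) \<or> n = 1"
          proof (cases "n = 1")
            case F: False
            have "2 * s \<le> real n * s" if "s \<in> set (fm.values n)" for s
              using F n rv(1) that by (intro mult_right_mono) auto
            then show ?thesis using rv(3) by (meson order_trans)
          qed simp
          have "{v \<in> ?V. p.center v} \<subseteq> ?G"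
            using q.full_welfare_center[OF fm.small_prog[OF p.prog_axioms] rv(1) _ _ alt] unfolding fm.trans_prog_def by blast
          then have "card {v \<in> ?V. p.center v} \<le> card ?G" using fin by (intro card_mono) auto
          then have "(k - 1) * (n - p.f + 1) * card {v \<in> ?V. p.center v} \<le> (k - 1) * n * card ?G"
            using p.f n by (intro mult_le_mono) auto
          then have "k ^ n \<le> (k - 1) * n * card ?G" using r.count_centers[OF k2] by linarith
          moreover have "card ?V = k ^ n" using card_valuations[OF rv(2), of n] unfolding p.len .
          ultimately have "real (card ?V) \<le> real ((k - 1) * n * card ?G)" by (simp only: of_nat_le_iff)
          also have "\<dots> = (real k - 1) * real n * real (card ?G)" using k2 by (simp add: of_nat_diff)
          finally show ?thesis using kn by (simp add: divide_le_eq mult.commute)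
        next
          case F: False
          then have np: "\<forall>t\<in>set (fm.values n). t \<le> 0" by (auto simp: not_less)
          then have "?G = ?V" using p.welfare_nonpos[OF np] unfolding fm.trans_prog_def by auto
          moreover have "1 / ((real k - 1) * real n) * real (card ?V) \<le> 1 * real (card ?V)"
            using kn by (intro mult_right_mono) auto
          ultimately show ?thesis by simp
        qed
      qed simp
    qed
  qed
  show ?thesis
    using first second family.is_transformation[OF fam] family.is_nonadaptive[OF fam]
      family.is_polynomial[OF fam] family.is_monotone[OF fam] by blast
qed

end
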